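(* Let $N\ge2$, $R>0$, let $g:[0,R]\to(0,\infty)$ be smooth, and let $A,B,p,q$ be positive constants with $0<A<B$, all independent of $\epsilon$. For $\epsilon>0$ let $U_\epsilon$ be the unique solution of problem (N* ) and $\rho_\epsilon$ the net charge density, both described in the context. (I) Let $r_\epsilon\in(0,R)$ be such that $\pi_{\beta_0}(\epsilon):=R-r_\epsilon$ satisfies, for some $\beta_0>1$ independent of $\epsilon$: $\lim_{\epsilon\downarrow0}\pi_{\beta_0}(\epsilon)/\epsilon^{\beta'}=0$ for all $\beta'\in(1,\beta_0)$, $\lim_{\epsilon\downarrow0}\pi_{\beta_0}(\epsilon)/\epsilon^{\beta''}=\infty$ for all $\beta''>\beta_0$, and $\lim_{\epsilon\downarrow0}\pi_{\beta_0}(\epsilon)/\epsilon^{\beta_0}\in\{0,\infty\}$. (a) If $\beta_0\in(1,2)$, or if $\beta_0=2$ and $\lim_{\epsilon\downarrow0}\pi_2(\epsilon)/\epsilon^2=\infty$, then as $\epsilon\downarrow0$, $$U_\epsilon(r_\epsilon)=-\frac2q(\beta_0-1)\log\frac1\epsilon+\frac2q\log\frac{\pi_{\beta_0}(\epsilon)}{\epsilon^{\beta_0}}+\frac2q\log\sqrt{\frac{qA}{2g(R)}}+o_\epsilon(1),$$ $$U_\epsilon'(r_\epsilon)=-\frac{2}{q\pi_{\beta_0}(\epsilon)}(1+o_\epsilon(1)),\qquad \rho_\epsilon(r_\epsilon)=\frac{2g(R)}{q}\Big(\frac{\epsilon}{\pi_{\beta_0}(\epsilon)}\Big)^2(1+o_\epsilon(1)).$$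 (b) If $\beta_0>2$, or if $\beta_0=2$ and $\lim_{\epsilon\downarrow0}\pi_2(\epsilon)/\epsilon^2=0$, then as $\epsilon\downarrow0$, $$U_\epsilon(r_\epsilon)=-\frac2q\log\frac1\epsilon+\frac2q\log\Big[\sqrt{\frac{A}{2qg(R)}}\cdot\frac{2Ng(R)}{R(B-A)}\Big]+o_\epsilon(1),$$ $$U_\epsilon'(r_\epsilon)=-\frac{R(B-A)}{Ng(R)}\epsilon^{-2}(1+o_\epsilon(1)),\qquad\rho_\epsilon(r_\epsilon)=\frac{qR^2(B-A)^2}{2N^2g(R)}\epsilon^{-2}(1+o_\epsilon(1)).$$ (II) Let $\Theta\in(0,1)$, $\gamma>0$, $\tau\in\mathbb{R}$ and an integer $n\ge2$ be independent of $\epsilon$, let $\log^{(n)}$ denote the $n$-fold composition of the natural logarithm, and set $$\kappa(\epsilon)=1-\Big(\log\frac1\epsilon\Big)^{-\Theta},\quad \beta_1(\epsilon)=1+\gamma\Big(\log\frac1\epsilon\Big)^{-\Theta},\quad\beta_2(\epsilon)=1+\Big(\log\frac1\epsilon\Big)^{-1}\Big(\gamma\log^{(n)}\frac1\epsilon+\tau\Big).$$ Then for any fixed $\kappa\in(0,1)$ and $\beta>1$, the points $R-\epsilon^{\kappa(\epsilon)}$ and $R-\epsilon^{\beta_i(\epsilon)}$ ($i=1,2$) lie in $[R-\epsilon^\kappa,R-\epsilon^\beta]$ for all sufficiently small $\epsilon>0$, and as $\epsilon\downarrow0$, $$\lim_{\epsilon\downarrow0}|U_\epsilon(R-\epsilon^{\kappa(\epsilon)})|=\lim_{\epsilon\downarrow0}|U_\epsilon'(R-\epsilon^{\kappa(\epsilon)})|=0,$$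 $$U_\epsilon(R-\epsilon^{\beta_1(\epsilon)})=-\frac{2\gamma}{q}\Big(\log\frac1\epsilon\Big)^{1-\Theta}+\frac1q\log\frac{qA}{2g(R)}+o_\epsilon(1),$$ $$U_\epsilon(R-\epsilon^{\beta_2(\epsilon)})=-\frac{2\gamma}{q}\log^{(n)}\frac1\epsilon+\frac1q\Big(-2\tau+\log\frac{qA}{2g(R)}\Big)+o_\epsilon(1),$$ $$U_\epsilon'(R-\epsilon^{\beta_1(\epsilon)})=-\frac2q\epsilon^{-\beta_1(\epsilon)}(1+o_\epsilon(1)),\qquad\rho_\epsilon(R-\epsilon^{\beta_1(\epsilon)})=\frac{2g(R)}{q}\epsilon^{-2(\beta_1(\epsilon)-1)}(1+o_\epsilon(1)),$$ and, if $n=2$ and $\gamma>2$, $$U_\epsilon'(R-\epsilon^{\beta_2(\epsilon)})=-\frac2q\epsilon^{-\beta_2(\epsilon)}(1+o_\epsilon(1)),\qquad\rho_\epsilon(R-\epsilon^{\beta_2(\epsilon)})=\frac{2g(R)}{q}\epsilon^{-2(\beta_2(\epsilon)-1)}(1+o_\epsilon(1)).$$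
   Context: Problem (N* ): for $\epsilon>0$, find $U_\epsilon\in C^1([0,R])\cap C^\infty((0,R))$ such that for $r\in(0,R)$ $$\epsilon^2 g(r)\Big[U_\epsilon''(r)+\Big(\frac{N-1}{r}+\frac{g'(r)}{g(r)}\Big)U_\epsilon'(r)\Big]=\frac{R^N}{N}\Big(\frac{Ae^{pU_\epsilon(r)}}{\int_0^R s^{N-1}e^{pU_\epsilon(s)}ds}-\frac{Be^{-qU_\epsilon(r)}}{\int_0^R s^{N-1}e^{-qU_\epsilon(s)}ds}\Big),$$ together with $\int_0^R s^{N-1}U_\epsilon(s)\,ds=0$, $U_\epsilon'(0)=0$ and $U_\epsilon'(R)=\frac{R(A-B)}{\epsilon^2Ng(R)}$; it has a unique solution. The net charge density is $\rho_\epsilon(r)=-\frac{R^N}{N}\big(\frac{Ae^{pU_\epsilon(r)}}{\int_0^Rs^{N-1}e^{pU_\epsilon(s)}ds}-\frac{Be^{-qU_\epsilon(r)}}{\int_0^Rs^{N-1}e^{-qU_\epsilon(s)}ds}\big)$. Notation: $o_\epsilon(1)$ denotes a quantity tending to $0$ as $\epsilon\downarrow0$. *)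

theory Defs
  imports "HOL-Analysis.Analysis"
begin

definition smooth_on_real :: "real set \<Rightarrow> (real \<Rightarrow> real) \<Rightarrow> bool" where
  "smooth_on_real S f \<longleftrightarrow>
     (\<exists>D :: nat \<Rightarrow> real \<Rightarrow> real. (\<forall>x\<in>S. D 0 x = f x) \<and>
        (\<forall>k. \<forall>x\<in>S. (D k has_real_derivative D (Suc k) x) (at x within S)))"

definition C1_on_real :: "real set \<Rightarrow> (real \<Rightarrow> real) \<Rightarrow> bool" where
  "C1_on_real S f \<longleftrightarrow>
     (\<exists>f'. continuous_on S f' \<and> (\<forall>x\<in>S. (f has_real_derivative f' x) (at x within S)))"

definition rhs_Nstar ::
  "nat \<Rightarrow> real \<Rightarrow> real \<Rightarrow> real \<Rightarrow> real \<Rightarrow> real \<Rightarrow> (real \<Rightarrow> real) \<Rightarrow> real \<Rightarrow> real" where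
  "rhs_Nstar N R A B p q U r =
     R ^ N / real N *
       (A * exp (p * U r) / integral {0..R} (\<lambda>s. s ^ (N - 1) * exp (p * U s))
        - B * exp (- q * U r) / integral {0..R} (\<lambda>s. s ^ (N - 1) * exp (- q * U s)))"

definition charge_density ::
  "nat \<Rightarrow> real \<Rightarrow> real \<Rightarrow> real \<Rightarrow> real \<Rightarrow> real \<Rightarrow> (real \<Rightarrow> real) \<Rightarrow> real \<Rightarrow> real" where
  "charge_density N R A B p q U r = - rhs_Nstar N R A B p q U r"

definition solves_Nstar ::
  "nat \<Rightarrow> real \<Rightarrow> (real \<Rightarrow> real) \<Rightarrow> real \<Rightarrow> real \<Rightarrow> real \<Rightarrow> real \<Rightarrow> real \<Rightarrow> (real \<Rightarrow> real) \<Rightarrow> bool" where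
  "solves_Nstar N R g A B p q \<epsilon> U \<longleftrightarrow>
     C1_on_real {0..R} U \<and> smooth_on_real {0<..<R} U \<and>
     (\<forall>r\<in>{0<..<R}.
        \<epsilon>\<^sup>2 * g r * (deriv (deriv U) r + ((real N - 1) / r + deriv g r / g r) * deriv U r)
          = rhs_Nstar N R A B p q U r) \<and>
     integral {0..R} (\<lambda>s. s ^ (N - 1) * U s) = 0 \<and>
     (U has_real_derivative 0) (at 0 within {0..R}) \<and>
     (U has_real_derivative (R * (A - B) / (\<epsilon>\<^sup>2 * real N * g R))) (at R within {0..R})"

end

theory Submission
  imports Defs "HOL-Real_Asymp.Real_Asymp"
begin

text \<open>In terms of the depth \<open>\<phi>\<close> of \<open>U\<close> below the value at which the local charge vanishes, the equation reads
  \<open>\<epsilon>\<^sup>2 (r^(N-1) g \<phi>')' = c r^(N-1) F \<phi>\<close> with \<open>F\<close> increasing and \<open>F 0 = 0\<close>; multiplying by \<open>\<phi>\<close> shows that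
  \<open>\<phi>\<close> is nonnegative and increasing. Convexity makes \<open>\<phi>\<close> halve over each interior distance of order \<open>\<epsilon>\<close>,
  which gives the bulk behaviour and \<open>c \<longlongrightarrow> A\<close>. Near \<open>R\<close> multiply by \<open>\<phi>'\<close>: the energy
  \<open>(\<epsilon> r^(N-1) g \<phi>')\<^sup>2 / 2\<close> grows like \<open>c r^(2N-2) g P \<phi>\<close> with \<open>P' = F\<close>, so \<open>Y = exp (-q \<phi> / 2)\<close> satisfies
  \<open>\<epsilon> Y' \<longlongrightarrow> -\<sigma>\<close> wherever \<open>(R - r) / \<epsilon> \<longlongrightarrow> 0\<close>. The boundary condition fixes \<open>Y\<close> at \<open>R\<close>, and the mean value
  theorem gives \<open>Y r ~ \<sigma> (2 \<epsilon> / (q C0) + (R - r) / \<epsilon>)\<close>; whether \<open>R - r\<close> is large or small against \<open>\<epsilon>\<^sup>2\<close>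
  decides which term wins.\<close>

section \<open>Flux form of the equation\<close>

text \<open>The obstacle is nonlocality: the coefficients of both exponentials depend on
  \<open>U\<close>, and no pointwise bound uniform in \<epsilon> is given. What is available comes
  from the zero mean: by Jensen each normalising integral is at least \<open>J\<close>. With the
  sign of \<phi> this confines \<open>c\<close> to \<open>[A, B]\<close> and bounds the mass of
  \<open>exp (q * \<phi>)\<close> by \<open>B * J / A\<close>. As \<phi> is increasing,
  \<open>exp (q * \<phi> r)\<close> is then at most of order \<open>1 / (R - r)\<close>: useless at
  \<open>R\<close>, but enough to start the decay and energy estimates at a distance from
  \<open>R\<close>. The variable \<open>Y\<close> is suggested by the model equation
  \<open>g \<phi>'' = c exp (q \<phi>) / \<epsilon>^2\<close>, whose zero-energy solutions make
  \<open>exp (-q \<phi> / 2)\<close> affine in \<open>r\<close>. Where \<open>Y\<close> tends to 0,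
  multiplying an energy by \<open>Y^2\<close> also turns every bounded error into a vanishing one.
  Limits are taken along arbitrary paths \<open>r \<epsilon>\<close> because the mean value theorem
  returns a point that depends on \<epsilon> in an unknown way.\<close>

lemma has_real_derivative_interior:
  fixes f :: "real \<Rightarrow> real"
  assumes "(f has_real_derivative D) (at r within {a..b})" "a < r" "r < b"
  shows "(f has_real_derivative D) (at r)"
proof -
  have "at r within {a..b} = at r"
    using assms(2,3) by (intro at_within_Icc_at) auto
  then show ?thesis using assms(1) by simp
qed

text \<open>\<open>r ^ (N-1) * g r\<close> is an integrating factor: its logarithmic derivative is
  the coefficient of \<open>deriv U\<close>. The endpoint values of \<open>U'\<close> come from
  uniqueness of derivatives within \<open>{0..R}\<close>, a nondegenerate interval.\<close>

lemma solves_Nstar_flux_form: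
  fixes U g :: "real \<Rightarrow> real"
  assumes N: "N \<ge> 2" and R: "R > 0"
    and gs: "smooth_on_real {0..R} g" and gp: "\<forall>r\<in>{0..R}. g r > 0"
    and eps: "\<epsilon> > 0" and sol: "solves_Nstar N R g A B p q \<epsilon> U"
  obtains U' where "continuous_on {0..R} U'"
    "\<And>r. r \<in> {0..R} \<Longrightarrow> (U has_real_derivative U' r) (at r within {0..R})"
    "U' 0 = 0" "U' R = R * (A - B) / (\<epsilon>\<^sup>2 * real N * g R)"
    "\<And>r. r \<in> {0<..<R} \<Longrightarrow> deriv U r = U' r"
    "\<And>r. r \<in> {0<..<R} \<Longrightarrow> ((\<lambda>r. r ^ (N-1) * g r * U' r) has_real_derivative
        r ^ (N-1) * rhs_Nstar N R A B p q U r / \<epsilon>\<^sup>2) (at r)"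
proof -
  from sol obtain U' where U'c: "continuous_on {0..R} U'"
    and U'd: "\<And>r. r \<in> {0..R} \<Longrightarrow> (U has_real_derivative U' r) (at r within {0..R})"
    unfolding solves_Nstar_def C1_on_real_def by blast
  from sol have UR: "(U has_real_derivative (R * (A - B) / (\<epsilon>\<^sup>2 * real N * g R))) (at R within {0..R})"
    and eq: "\<And>r. r\<in>{0<..<R} \<Longrightarrow>
        \<epsilon>\<^sup>2 * g r * (deriv (deriv U) r + ((real N - 1) / r + deriv g r / g r) * deriv U r)
          = rhs_Nstar N R A B p q U r"
    and sm: "smooth_on_real {0<..<R} U"
    unfolding solves_Nstar_def by auto
  have nontriv: "at R within {0..R} \<noteq> bot"
    using R by (simp add: at_within_Icc_at_left)
  have "U' R = R * (A - B) / (\<epsilon>\<^sup>2 * real N * g R)"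
    using has_field_derivative_unique[OF U'd UR nontriv] R by auto
  moreover have "U' 0 = 0"
  proof (rule has_field_derivative_unique)
    show "(U has_real_derivative U' 0) (at 0 within {0..R})" using R by (intro U'd) auto
    show "(U has_real_derivative 0) (at 0 within {0..R})" using sol unfolding solves_Nstar_def by auto
    show "at 0 within {0..R} \<noteq> bot" using R by (simp add: at_within_Icc_at_right)
  qed
  moreover have dU: "deriv U r = U' r" if "r \<in> {0<..<R}" for r
    using has_real_derivative_interior[OF U'd] that by (intro DERIV_imp_deriv) auto
  moreover have "((\<lambda>r. r ^ (N-1) * g r * U' r) has_real_derivative
        r ^ (N-1) * rhs_Nstar N R A B p q U r / \<epsilon>\<^sup>2) (at r)" if r: "r \<in> {0<..<R}" for r
  proof -
    from sm obtain D where D0: "\<And>x. x \<in> {0<..<R} \<Longrightarrow> D 0 x = U x"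
      and D: "\<And>k x. x \<in> {0<..<R} \<Longrightarrow> (D k has_real_derivative D (Suc k) x) (at x)"
      unfolding smooth_on_real_def by (metis at_within_open open_greaterThanLessThan)
    \<comment> \<open>\<open>deriv (deriv U) r\<close> sees \<open>deriv U\<close> on a whole
      neighbourhood, so agreement with \<open>U'\<close> is needed near \<open>r\<close>, not just
      at \<open>r\<close>.\<close>
    have ev: "\<forall>\<^sub>F x in nhds r. x \<in> {0<..<R}"
      using r by (intro eventually_nhds_in_open) auto
    have D1: "D (Suc 0) x = U' x" if "x \<in> {0<..<R}" for x
    proof -
      have "(U has_real_derivative D (Suc 0) x) (at x)"
        by (rule has_field_derivative_transform_within_open[OF D[OF that, of 0] _ that])
          (simp_all add: D0)
      then show ?thesis using dU[OF that] DERIV_imp_deriv[of U "D (Suc 0) x" x] by simp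
    qed
    have U'D: "(U' has_real_derivative D 2 r) (at r)"
      unfolding numeral_2_eq_2
      by (rule has_field_derivative_transform_within_open[OF D[OF r, of "Suc 0"] _ r])
        (use D1 in simp_all)
    have "deriv (deriv U) r = deriv U' r"
      using eventually_mono[OF ev dU] by (rule deriv_cong_ev) simp_all
    then have dd: "deriv (deriv U) r = D 2 r" using DERIV_imp_deriv[OF U'D] by simp
    from gs obtain G where G0: "\<forall>x\<in>{0..R}. G 0 x = g x"
      and G: "\<forall>k. \<forall>x\<in>{0..R}. (G k has_real_derivative G (Suc k) x) (at x within {0..R})"
      unfolding smooth_on_real_def by blast
    have "(G 0 has_real_derivative G (Suc 0) r) (at r within {0..R})" using G r by simp
    then have "(G 0 has_real_derivative G (Suc 0) r) (at r)"
      using r by (intro has_real_derivative_interior) auto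
    then have gd: "(g has_real_derivative G (Suc 0) r) (at r)"
      by (rule has_field_derivative_transform_within_open[OF _ _ r]) (simp_all add: G0)
    then have dg: "deriv g r = G (Suc 0) r" by (rule DERIV_imp_deriv)
    have gr: "g r > 0" using gp r by auto
    \<comment> \<open>Two successors make \<open>N-1-Suc 0\<close> a genuine predecessor of
      \<open>N-1\<close>, so that in \<open>e1\<close> dividing by \<open>r\<close> lowers the
      exponent.\<close>
    obtain m where m: "N = Suc (Suc m)" using N by (metis add_2_eq_Suc le_Suc_ex)
    have "((\<lambda>r. r ^ (N-1) * g r * U' r) has_real_derivative
       (real (N-1) * r ^ (N-1-Suc 0) * g r + G (Suc 0) r * r ^ (N-1)) * U' r + D 2 r * (r ^ (N-1) * g r)) (at r)"
      by (intro DERIV_mult DERIV_pow gd U'D)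
    moreover have "(real (N-1) * r ^ (N-1-Suc 0) * g r + G (Suc 0) r * r ^ (N-1)) * U' r + D 2 r * (r ^ (N-1) * g r)
       = r ^ (N-1) * rhs_Nstar N R A B p q U r / \<epsilon>\<^sup>2"
    proof -
      have e1: "(real N - 1) / r * r ^ (N-1) = real (N-1) * r ^ (N-1-Suc 0)"
        using r by (simp add: m)
      have e2: "G (Suc 0) r / g r * g r = G (Suc 0) r" using gr by simp
      have "rhs_Nstar N R A B p q U r / \<epsilon>\<^sup>2 = g r * (D 2 r + ((real N - 1) / r + G (Suc 0) r / g r) * U' r)"
        unfolding eq[OF r, symmetric] dd dg dU[OF r] using eps by simp
      then have "r ^ (N-1) * rhs_Nstar N R A B p q U r / \<epsilon>\<^sup>2 =
         r ^ (N-1) * (g r * (D 2 r + ((real N - 1) / r + G (Suc 0) r / g r) * U' r))"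
        by (simp only: times_divide_eq_right[symmetric])
      also have "\<dots> = ((real N - 1) / r * r ^ (N-1)) * g r * U' r + (G (Suc 0) r / g r * g r) * r ^ (N-1) * U' r
            + D 2 r * (r ^ (N-1) * g r)"
        by algebra
      finally show ?thesis unfolding e1 e2 by (simp add: algebra_simps)
    qed
    ultimately show ?thesis by simp
  qed
  ultimately show ?thesis using that U'c U'd by blast
qed

section \<open>Estimates for a single \<open>\<epsilon>\<close>\<close>

lemma mono_from_deriv:
  fixes f :: "real \<Rightarrow> real"
  assumes "continuous_on {a..b} f" "a \<le> b"
    and "\<And>x. a < x \<Longrightarrow> x < b \<Longrightarrow> (f has_real_derivative f' x) (at x)"
    and "\<And>x. a < x \<Longrightarrow> x < b \<Longrightarrow> f' x \<ge> 0"
  shows "f a \<le> f b"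
proof (cases "a = b")
  case False
  then have "a < b" using assms by simp
  then show ?thesis
    using assms by (intro DERIV_nonneg_imp_increasing_open[of a b f]) auto
qed simp

lemma MVT_on:
  fixes f :: "real \<Rightarrow> real"
  assumes "continuous_on {a..b} f" "a < b"
    and "\<And>x. a < x \<Longrightarrow> x < b \<Longrightarrow> (f has_real_derivative f' x) (at x)"
  obtains z where "a < z" "z < b" "f b - f a = (b - a) * f' z"
proof -
  have "\<exists>l z. a < z \<and> z < b \<and> DERIV f z :> l \<and> f b - f a = (b - a) * l"
    using assms by (intro MVT) (auto simp: real_differentiable_def)
  then show ?thesis using that assms(3) DERIV_unique by metis
qed

section \<open>Constants and the reaction term\<close>

locale layer_data =
  fixes N :: nat and R A B p q g0 g1 :: real and g :: "real \<Rightarrow> real"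
  assumes N: "N \<ge> 2" and R: "R > 0" and A: "0 < A" and AB: "A < B" and p: "p > 0" and q: "q > 0"
    and g_cont: "continuous_on {0..R} g" and g0: "g0 > 0"
    and g_ge: "r \<in> {0..R} \<Longrightarrow> g0 \<le> g r" and g_le: "r \<in> {0..R} \<Longrightarrow> g r \<le> g1"
begin

definition "F x = exp (q * x) - exp (- (p * x))"
definition "P x = (exp (q * x) - 1) / q + (exp (- (p * x)) - 1) / p"
text \<open>The integral of \<open>s ^ (N - 1)\<close> over \<open>{0..R}\<close>, that is, the
  total weight.\<close>

definition "J = R ^ N / real N"
text \<open>The slope imposed on \<phi> at \<open>R\<close>, multiplied by
  \<open>\<epsilon>\<^sup>2\<close>.\<close>

definition "C0 = R * (B - A) / (real N * g R)"
text \<open>The mass bound \<open>B * J / A\<close> divided by the least weight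
  \<open>(R / 2) ^ (N - 1)\<close> on the outer half of the interval.\<close>

definition "C1 = B * J / (A * (R / 2) ^ (N - 1))"
text \<open>A convexity rate on \<open>{R/2..R}\<close>: the linear lower bound
  \<open>A * (R / 2) ^ (N - 1) * q\<close> for the source, over an upper bound for
  \<open>r ^ (N - 1) * g r\<close>. It acts as if
  \<open>\<phi>'' \<ge> K * \<phi> / \<epsilon>\<^sup>2\<close>.\<close>

definition "K = A * q * (R / 2) ^ (N - 1) / (R ^ (N - 1) * g1)"
text \<open>The weight in the derivative of the energy: \<open>r ^ (N - 1)\<close> from the source
  times \<open>r ^ (N - 1) * g r\<close> from the flux.\<close>

definition "G r = r ^ (2 * N - 2) * g r"
definition "Gmax = R ^ (2 * N - 2) * g1"

lemma g1: "g1 > 0" using g0 g_ge[of R] g_le[of R] R by auto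
lemma gR: "g R > 0" using g0 g_ge[of R] R by auto
lemma J: "J > 0" using R N by (simp add: J_def)
lemma C0: "C0 > 0" using R N AB gR by (simp add: C0_def)
lemma C1: "C1 > 0" using R N A AB J by (simp add: C1_def)
lemma K: "K > 0" using R A q g1 by (simp add: K_def)
lemma Gmax: "Gmax > 0" using R g1 by (simp add: Gmax_def)

text \<open>Convexity of \<open>exp\<close> supplies the linear growth. A source proportional to
  \<phi> is what drives the exponential decay away from \<open>R\<close>.\<close>

lemma F_ge: "x \<ge> 0 \<Longrightarrow> F x \<ge> q * x"
proof -
  assume "x \<ge> 0"
  then have "exp (- (p * x)) \<le> 1" using p by (simp add: mult_nonneg_nonneg)
  moreover have "1 + q * x \<le> exp (q * x)" by (rule exp_ge_add_one_self)
  ultimately show ?thesis unfolding F_def by linarith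
qed

lemma F_nonneg: "x \<ge> 0 \<Longrightarrow> F x \<ge> 0"
  using F_ge[of x] q by (meson mult_nonneg_nonneg less_imp_le order_trans)

text \<open>The tangent lines of the two exponentials contribute \<open>x\<close> and
  \<open>- x\<close>, which cancel.\<close>

lemma P_nonneg: "P x \<ge> 0"
proof -
  have "q * x \<le> exp (q * x) - 1" "- (p * x) \<le> exp (- (p * x)) - 1"
    using exp_ge_add_one_self[of "q * x"] exp_ge_add_one_self[of "- (p * x)"] by linarith+
  then have "x \<le> (exp (q * x) - 1) / q" "- x \<le> (exp (- (p * x)) - 1) / p"
    using p q by (simp_all add: field_simps)
  then show ?thesis unfolding P_def by linarith
qed

lemma P_le: "x \<ge> 0 \<Longrightarrow> P x \<le> exp (q * x) / q"
proof -
  assume "x \<ge> 0"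
  then have "exp (- (p * x)) \<le> 1" using p by (simp add: mult_nonneg_nonneg)
  then have "(exp (- (p * x)) - 1) / p \<le> 0" using p by (simp add: divide_nonpos_pos)
  moreover have "(exp (q * x) - 1) / q \<le> exp (q * x) / q" using q by (simp add: divide_right_mono)
  ultimately show ?thesis by (simp add: P_def)
qed

lemma P_deriv: "(P has_real_derivative F x) (at x)"
proof -
  have "(P has_real_derivative (exp (q * x) * q) / q + (exp (- (p * x)) * (- p)) / p) (at x)"
    unfolding P_def by (auto intro!: derivative_eq_intros)
  then show ?thesis using p q by (simp add: F_def)
qed

end

text \<open>Write the equation as \<open>\<epsilon>\<^sup>2 (r^(N-1) g U')' = r^(N-1) (a exp (p U) - b exp (-q U))\<close> with constants
  \<open>a, b > 0\<close>, and let \<open>us = ln (b / a) / (p + q)\<close> be the zero of the right-hand side. Below, \<open>\<phi> = us - U\<close> and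
  \<open>c = a exp (p us) = b exp (-q us)\<close>.\<close>

locale layer = layer_data +
  fixes \<epsilon> c :: real and \<phi> \<phi>' :: "real \<Rightarrow> real"
  assumes eps: "\<epsilon> > 0" and c_ge: "A \<le> c" and c_le: "c \<le> B"
    and phi_deriv: "r \<in> {0..R} \<Longrightarrow> (\<phi> has_real_derivative \<phi>' r) (at r within {0..R})"
    and phi'_cont: "continuous_on {0..R} \<phi>'"
    and phi_nonneg: "r \<in> {0..R} \<Longrightarrow> \<phi> r \<ge> 0"
    and phi'_nonneg: "r \<in> {0..R} \<Longrightarrow> \<phi>' r \<ge> 0"
    and flux_deriv: "r \<in> {0<..<R} \<Longrightarrow> ((\<lambda>r. r ^ (N - 1) * g r * \<phi>' r) has_real_derivative
          c * r ^ (N - 1) * F (\<phi> r) / \<epsilon>\<^sup>2) (at r)"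
    and phi'_R: "\<phi>' R = C0 / \<epsilon>\<^sup>2"
    and mass: "integral {0..R} (\<lambda>s. s ^ (N - 1) * exp (q * \<phi> s)) \<le> B * J / A"
begin

definition "W r = r ^ (N - 1) * g r * \<phi>' r"
definition "E r = \<epsilon>\<^sup>2 / 2 * (W r)\<^sup>2"
definition "Y r = exp (- q * \<phi> r / 2)"

lemma c_pos: "c > 0" using A c_ge by simp

lemma phi_cont: "continuous_on {0..R} \<phi>"
  by (rule DERIV_continuous_on[OF phi_deriv])

lemma W_cont: "continuous_on {0..R} W"
  unfolding W_def by (intro continuous_intros g_cont phi'_cont)

lemma W_deriv: "r \<in> {0<..<R} \<Longrightarrow> (W has_real_derivative c * r ^ (N - 1) * F (\<phi> r) / \<epsilon>\<^sup>2) (at r)"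
  using flux_deriv unfolding W_def .

lemma phi_deriv_at: "0 < r \<Longrightarrow> r < R \<Longrightarrow> (\<phi> has_real_derivative \<phi>' r) (at r)"
  by (rule has_real_derivative_interior[OF phi_deriv]) auto

lemma cont_sub: "continuous_on {0..R} f \<Longrightarrow> 0 \<le> a \<Longrightarrow> b \<le> R \<Longrightarrow> continuous_on {a..b} f"
  for f :: "real \<Rightarrow> real"
  by (erule continuous_on_subset) auto

lemma phi_mono: "0 \<le> a \<Longrightarrow> a \<le> b \<Longrightarrow> b \<le> R \<Longrightarrow> \<phi> a \<le> \<phi> b"
  by (rule mono_from_deriv[of a b \<phi> \<phi>'])
    (auto intro!: cont_sub[OF phi_cont] phi_deriv_at phi'_nonneg)

lemma W_nonneg: "r \<in> {0..R} \<Longrightarrow> W r \<ge> 0"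
  using g_ge[of r] g0 phi'_nonneg[of r] by (auto simp: W_def intro!: mult_nonneg_nonneg)

lemma W_mono: "0 \<le> a \<Longrightarrow> a \<le> b \<Longrightarrow> b \<le> R \<Longrightarrow> W a \<le> W b"
  by (rule mono_from_deriv[of a b W "\<lambda>r. c * r ^ (N - 1) * F (\<phi> r) / \<epsilon>\<^sup>2"])
    (auto simp del: One_nat_def intro!: cont_sub[OF W_cont] W_deriv divide_nonneg_nonneg mult_nonneg_nonneg F_nonneg
       phi_nonneg less_imp_le[OF c_pos])

text \<open>A Chebyshev argument: \<phi> is increasing, so the mass on \<open>{r..R}\<close> alone
  is at least \<open>(R - r) * (R / 2) ^ (N - 1) * exp (q * \<phi> r)\<close>.\<close>

lemma exp_phi_le:
  assumes "R / 2 \<le> r" "r < R"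
  shows "exp (q * \<phi> r) \<le> C1 / (R - r)"
proof -
  let ?f = "\<lambda>s. s ^ (N - 1) * exp (q * \<phi> s)"
  have cont: "continuous_on {0..R} ?f" by (intro continuous_intros phi_cont)
  have "(R - r) * ((R / 2) ^ (N - 1) * exp (q * \<phi> r)) = integral {r..R} (\<lambda>s. (R / 2) ^ (N - 1) * exp (q * \<phi> r))"
    using assms by simp
  also have "\<dots> \<le> integral {r..R} ?f"
  proof (rule integral_le)
    show "?f integrable_on {r..R}"
      using assms R by (intro integrable_continuous_real cont_sub[OF cont]) auto
    fix s assume "s \<in> {r..R}"
    then show "(R / 2) ^ (N - 1) * exp (q * \<phi> r) \<le> s ^ (N - 1) * exp (q * \<phi> s)"
      using assms R q phi_mono[of r s] by (intro mult_mono power_mono) auto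
  qed (rule integrable_const_ivl)
  also have "\<dots> \<le> integral {0..R} ?f"
    using assms R by (intro integral_subset_le integrable_continuous_real cont_sub[OF cont] cont) auto
  also have "\<dots> \<le> B * J / A" by (rule mass)
  finally have *: "(R - r) * ((R / 2) ^ (N - 1) * exp (q * \<phi> r)) \<le> B * J / A" .
  have "(R / 2) ^ (N - 1) > 0" using R by simp
  then show ?thesis using * assms A by (simp add: C1_def field_simps)
qed

lemma phi_le: "R / 2 \<le> r \<Longrightarrow> r < R \<Longrightarrow> \<phi> r \<le> C1 / (q * (R - r))"
proof -
  assume r: "R / 2 \<le> r" "r < R"
  have "q * \<phi> r \<le> C1 / (R - r)"
    using exp_phi_le[OF r] exp_ge_add_one_self[of "q * \<phi> r"] by linarith
  then have "\<phi> r \<le> C1 / (R - r) / q" using q by (subst pos_le_divide_eq) (simp_all add: mult.commute)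
  then show ?thesis by (simp add: mult.commute)
qed

section \<open>Discrete convexity of the depth\<close>

lemma W_step_lower:
  assumes "R / 2 \<le> r - h" "r \<le> R" "h > 0"
  shows "h * (K * (R ^ (N - 1) * g1) * \<phi> (r - h) / \<epsilon>\<^sup>2) \<le> W r"
proof -
  obtain z where z: "r - h < z" "z < r"
    "W r - W (r - h) = (r - (r - h)) * (c * z ^ (N - 1) * F (\<phi> z) / \<epsilon>\<^sup>2)"
    using assms R by (rule_tac MVT_on[of "r - h" r W "\<lambda>z. c * z ^ (N - 1) * F (\<phi> z) / \<epsilon>\<^sup>2"])
      (auto simp del: One_nat_def intro!: cont_sub[OF W_cont] W_deriv)
  have "A * (R / 2) ^ (N - 1) * (q * \<phi> (r - h)) \<le> c * z ^ (N - 1) * F (\<phi> z)"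
  proof (rule mult_mono)
    show "A * (R / 2) ^ (N - 1) \<le> c * z ^ (N - 1)"
      using assms z R A c_ge by (intro mult_mono power_mono) auto
    have "q * \<phi> (r - h) \<le> q * \<phi> z" using assms z R q phi_mono[of "r - h" z] by auto
    also have "\<dots> \<le> F (\<phi> z)" using assms z R by (intro F_ge phi_nonneg) auto
    finally show "q * \<phi> (r - h) \<le> F (\<phi> z)" .
    show "0 \<le> c * z ^ (N - 1)" using c_pos assms z R by auto
    show "0 \<le> q * \<phi> (r - h)" using q assms R phi_nonneg[of "r - h"] by auto
  qed
  moreover have "K * (R ^ (N - 1) * g1) = A * (R / 2) ^ (N - 1) * q"
    using R g1 by (simp add: K_def)
  ultimately have "K * (R ^ (N - 1) * g1) * \<phi> (r - h) / \<epsilon>\<^sup>2 \<le> c * z ^ (N - 1) * F (\<phi> z) / \<epsilon>\<^sup>2"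
    by (intro divide_right_mono) (auto simp: mult.assoc)
  then have "h * (K * (R ^ (N - 1) * g1) * \<phi> (r - h) / \<epsilon>\<^sup>2) \<le> h * (c * z ^ (N - 1) * F (\<phi> z) / \<epsilon>\<^sup>2)"
    using assms by (intro mult_left_mono) auto
  moreover have "W (r - h) \<ge> 0" using assms R by (intro W_nonneg) auto
  ultimately show ?thesis using z(3) by simp
qed

lemma W_step_upper:
  assumes "0 < r" "r + h \<le> R" "h > 0"
  shows "h * W r / (R ^ (N - 1) * g1) \<le> \<phi> (r + h) - \<phi> r"
proof -
  obtain z where z: "r < z" "z < r + h" "\<phi> (r + h) - \<phi> r = (r + h - r) * \<phi>' z"
    using assms R by (rule_tac MVT_on[of r "r + h" \<phi> \<phi>'])
      (auto intro!: cont_sub[OF phi_cont] phi_deriv_at)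
  have "W r \<le> W z" using z assms by (intro W_mono) auto
  also have "\<dots> \<le> R ^ (N - 1) * g1 * \<phi>' z"
    unfolding W_def using assms z R g_le[of z] g_ge[of z] g0 phi'_nonneg[of z]
    by (intro mult_mono power_mono mult_nonneg_nonneg) auto
  finally have "W r / (R ^ (N - 1) * g1) \<le> \<phi>' z"
    using R g1 by (simp add: field_simps)
  then have "h * (W r / (R ^ (N - 1) * g1)) \<le> h * \<phi>' z" using assms by (intro mult_left_mono) auto
  then show ?thesis using z(3) by simp
qed

text \<open>A difference version of \<open>\<phi>'' \<ge> K * \<phi> / \<epsilon>\<^sup>2\<close>
  that avoids second derivatives: the left half of the window \<open>{r - h..r + h}\<close> builds
  up flux, the right half converts this flux into growth of \<phi>.\<close>

lemma phi_step:
  assumes "R / 2 \<le> r - h" "r + h \<le> R" "h > 0"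
  shows "\<phi> (r - h) * (1 + K * h\<^sup>2 / \<epsilon>\<^sup>2) \<le> \<phi> (r + h)"
proof -
  define d where "d = R ^ (N - 1) * g1"
  have D: "d > 0" using R g1 by (simp add: d_def)
  have "h * (h * (K * d * \<phi> (r - h) / \<epsilon>\<^sup>2)) / d \<le> h * W r / d"
    using assms D R by (intro divide_right_mono mult_left_mono W_step_lower[folded d_def]) auto
  also have "\<dots> \<le> \<phi> (r + h) - \<phi> r" using assms R by (intro W_step_upper[folded d_def]) auto
  also have "h * (h * (K * d * \<phi> (r - h) / \<epsilon>\<^sup>2)) / d
      = \<phi> (r - h) * (K * h\<^sup>2 / \<epsilon>\<^sup>2)"
    using D by (simp add: power2_eq_square)
  finally have "\<phi> (r - h) * (K * h\<^sup>2 / \<epsilon>\<^sup>2) \<le> \<phi> (r + h) - \<phi> r" .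
  moreover have "\<phi> (r - h) \<le> \<phi> r" using assms R by (intro phi_mono) auto
  ultimately show ?thesis by (simp add: distrib_left)
qed

text \<open>The step \<open>h = \<epsilon> / sqrt K\<close> makes the growth factor
  \<open>1 + K * h\<^sup>2 / \<epsilon>\<^sup>2\<close> equal to 2; each application of
  \<open>phi_step\<close> covers a window of length \<open>2 * h\<close>.\<close>

lemma phi_halving:
  assumes "R / 2 \<le> r" "r + 2 * real n * h \<le> R" "h = \<epsilon> / sqrt K"
  shows "\<phi> r \<le> \<phi> (r + 2 * real n * h) / 2 ^ n"
  using assms(2)
proof (induction n)
  case (Suc n)
  have h: "h > 0" using eps K assms by simp
  have 1: "K * h\<^sup>2 / \<epsilon>\<^sup>2 = 1" using assms(3) K eps by (simp add: power_divide)
  have le: "r + 2 * real n * h \<le> R" using Suc.prems h by (simp add: algebra_simps)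
  have nh: "R / 2 \<le> r + 2 * real n * h" using assms(1) h by (intro add_increasing2) auto
  have "\<phi> ((r + 2 * real n * h + h) - h) * (1 + K * h\<^sup>2 / \<epsilon>\<^sup>2) \<le> \<phi> ((r + 2 * real n * h + h) + h)"
    using nh Suc.prems h by (intro phi_step) (auto simp: algebra_simps)
  then have "\<phi> (r + 2 * real n * h) * 2 \<le> \<phi> (r + 2 * real (Suc n) * h)"
    unfolding 1 by (simp add: algebra_simps)
  moreover have "\<phi> r \<le> \<phi> (r + 2 * real n * h) / 2 ^ n" using Suc.IH le by simp
  ultimately show ?case by (simp add: field_simps)
qed simp

section \<open>Energy balance\<close>

lemma E_deriv: "r \<in> {0<..<R} \<Longrightarrow> (E has_real_derivative c * G r * (F (\<phi> r) * \<phi>' r)) (at r)"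
proof -
  assume r: "r \<in> {0<..<R}"
  have "(E has_real_derivative \<epsilon>\<^sup>2 / 2 * (2 * (W r) * (c * r ^ (N - 1) * F (\<phi> r) / \<epsilon>\<^sup>2))) (at r)"
    unfolding E_def using W_deriv[OF r] by (auto intro!: derivative_eq_intros)
  moreover have "\<epsilon>\<^sup>2 / 2 * (2 * (W r) * (c * r ^ (N - 1) * F (\<phi> r) / \<epsilon>\<^sup>2)) = c * G r * (F (\<phi> r) * \<phi>' r)"
  proof -
    have "r ^ (2 * N - 2) = r ^ (N - 1) * r ^ (N - 1)"
      unfolding power_add[symmetric] by (rule arg_cong[where f = "power r"]) simp
    then show ?thesis using eps by (simp add: W_def G_def)
  qed
  ultimately show ?thesis by simp
qed

lemma Pphi_deriv: "r \<in> {0<..<R} \<Longrightarrow> ((\<lambda>r. P (\<phi> r)) has_real_derivative F (\<phi> r) * \<phi>' r) (at r)"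
  using DERIV_chain2[OF P_deriv phi_deriv_at[of r]] by auto

lemma E_cont: "continuous_on {0..R} E"
  unfolding E_def by (intro continuous_intros W_cont)

lemma Pphi_cont: "continuous_on {0..R} (\<lambda>r. P (\<phi> r))"
  unfolding P_def using p q by (intro continuous_intros phi_cont) auto

text \<open>The derivative of \<open>E\<close> is \<open>c * G\<close> times that of
  \<open>P \<circ> \<phi>\<close>, and the latter is nonnegative, so a one-sided bound for
  \<open>G\<close> on the interval integrates directly. The converse estimate works in the same
  way.\<close>

lemma E_diff_le:
  assumes "0 \<le> a" "a \<le> r" "r \<le> R" "\<And>s. s \<in> {a<..<r} \<Longrightarrow> G s \<le> M"
  shows "E r - E a \<le> c * M * (P (\<phi> r) - P (\<phi> a))"
proof -
  let ?f = "\<lambda>s. c * M * P (\<phi> s) - E s"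
  have "?f a \<le> ?f r"
  proof (rule mono_from_deriv[of a r ?f])
    show "continuous_on {a..r} ?f"
      by (rule cont_sub) (use assms in \<open>auto intro!: continuous_intros Pphi_cont E_cont\<close>)
    fix x assume x: "a < x" "x < r"
    then show "(?f has_real_derivative c * M * (F (\<phi> x) * \<phi>' x) - c * G x * (F (\<phi> x) * \<phi>' x)) (at x)"
      using assms by (intro DERIV_diff DERIV_cmult Pphi_deriv E_deriv) auto
    have "F (\<phi> x) * \<phi>' x \<ge> 0"
      using x assms by (intro mult_nonneg_nonneg phi'_nonneg F_nonneg phi_nonneg) auto
    moreover have "c * G x \<le> c * M" using assms x c_pos by auto
    ultimately show "c * M * (F (\<phi> x) * \<phi>' x) - c * G x * (F (\<phi> x) * \<phi>' x) \<ge> 0"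
      by (simp add: mult_right_mono)
  qed fact
  then show ?thesis by (simp add: algebra_simps)
qed

lemma E_diff_ge:
  assumes "0 \<le> a" "a \<le> r" "r \<le> R" "\<And>s. s \<in> {a<..<r} \<Longrightarrow> m \<le> G s"
  shows "c * m * (P (\<phi> r) - P (\<phi> a)) \<le> E r - E a"
proof -
  let ?f = "\<lambda>s. E s - c * m * P (\<phi> s)"
  have "?f a \<le> ?f r"
  proof (rule mono_from_deriv[of a r ?f])
    show "continuous_on {a..r} ?f"
      by (rule cont_sub) (use assms in \<open>auto intro!: continuous_intros Pphi_cont E_cont\<close>)
    fix x assume x: "a < x" "x < r"
    then show "(?f has_real_derivative c * G x * (F (\<phi> x) * \<phi>' x) - c * m * (F (\<phi> x) * \<phi>' x)) (at x)"
      using assms by (intro DERIV_diff DERIV_cmult Pphi_deriv E_deriv) auto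
    have "F (\<phi> x) * \<phi>' x \<ge> 0"
      using x assms by (intro mult_nonneg_nonneg phi'_nonneg F_nonneg phi_nonneg) auto
    moreover have "c * m \<le> c * G x" using assms x c_pos by auto
    ultimately show "c * G x * (F (\<phi> x) * \<phi>' x) - c * m * (F (\<phi> x) * \<phi>' x) \<ge> 0"
      by (simp add: mult_right_mono)
  qed fact
  then show ?thesis by (simp add: algebra_simps)
qed

lemma G_le: "r \<in> {0..R} \<Longrightarrow> G r \<le> Gmax"
  unfolding G_def Gmax_def using g_le[of r] g_ge[of r] g0 R by (intro mult_mono power_mono) auto

text \<open>The flux vanishes at the centre because \<open>N \<ge> 2\<close>, and
  \<open>P_nonneg\<close> disposes of the term at 0.\<close>

lemma E_le: assumes "r \<in> {0..R}" shows "E r \<le> c * Gmax * P (\<phi> r)"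
proof -
  have "E r - E 0 \<le> c * Gmax * (P (\<phi> r) - P (\<phi> 0))"
    using assms by (intro E_diff_le G_le) auto
  moreover have "E 0 = 0" using N by (simp add: E_def W_def)
  moreover have "c * Gmax * P (\<phi> 0) \<ge> 0" using c_pos Gmax P_nonneg by (intro mult_nonneg_nonneg) auto
  ultimately show ?thesis by (simp add: algebra_simps)
qed

end

context layer_data
begin

text \<open>Read off from \<open>E r * (Y r)\<^sup>2 \<le> B * Gmax / q\<close> once
  \<open>r ^ (N - 1) * g r\<close> is replaced by its lower bound on
  \<open>{R/2..R}\<close>.\<close>

definition "C2 = sqrt (2 * B * Gmax / q) / ((R / 2) ^ (N - 1) * g0)"

lemma integral_power_J: "((\<lambda>s. s ^ (N - 1)) has_integral J) {0..R}"
proof -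
  have "((\<lambda>s. s ^ (N - 1)) has_integral (R ^ N / real N - 0 ^ N / real N)) {0..R}"
  proof (rule fundamental_theorem_of_calculus)
    fix x assume "x \<in> {0..R}"
    have "((\<lambda>s. s ^ N / real N) has_real_derivative (real N * x ^ (N - Suc 0)) / real N) (at x within {0..R})"
      by (intro DERIV_cdivide DERIV_pow)
    then show "((\<lambda>s. s ^ N / real N) has_vector_derivative x ^ (N - 1)) (at x within {0..R})"
      using N by (simp add: has_real_derivative_iff_has_vector_derivative)
  qed (use R in simp)
  then show ?thesis using N by (simp add: J_def zero_power)
qed

text \<open>\<delta> is chosen from \<open>g\<close> alone, before \<epsilon>. The cap
  \<open>R / 2\<close> keeps the neighbourhood inside the region where \<open>exp_phi_le\<close>
  applies.\<close>

lemma G_near_R: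
  assumes "open S" "G R \<in> S"
  obtains \<delta> where "0 < \<delta>" "\<delta> \<le> R / 2" "\<And>s. s \<in> {R-\<delta>..R} \<Longrightarrow> G s \<in> S"
proof -
  have "continuous_on {0..R} G" unfolding G_def by (intro continuous_intros g_cont)
  then have "(G \<longlongrightarrow> G R) (at R within {0..R})" using R by (simp add: continuous_on_def)
  then have "\<forall>\<^sub>F s in at R within {0..R}. G s \<in> S" using assms topological_tendstoD by blast
  then obtain d where d: "d > 0" "\<And>s. s \<in> {0..R} \<Longrightarrow> s \<noteq> R \<Longrightarrow> dist s R < d \<Longrightarrow> G s \<in> S"
    unfolding eventually_at by blast
  have "G s \<in> S" if "s \<in> {R - min (d / 2) (R / 2)..R}" for s
    using d(2)[of s] that d(1) R assms(2) by (cases "s = R") (auto simp: dist_real_def)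
  then show ?thesis using that[of "min (d / 2) (R / 2)"] d(1) R by auto
qed

end

context layer
begin

section \<open>Bounds for \<open>Y\<close> near the boundary\<close>

lemma Y_sq: "(Y r)\<^sup>2 * exp (q * \<phi> r) = 1"
  by (simp add: Y_def power2_eq_square flip: exp_add)

lemma Y_deriv: "0 < r \<Longrightarrow> r < R \<Longrightarrow> (Y has_real_derivative - (q / 2) * (\<phi>' r * Y r)) (at r)"
  unfolding Y_def by (auto intro!: derivative_eq_intros phi_deriv_at)

lemma Y_cont: "continuous_on {0..R} Y"
  unfolding Y_def by (intro continuous_intros phi_cont) auto

lemma EY: "E r * (Y r)\<^sup>2 = (r ^ (N - 1) * g r)\<^sup>2 / 2 * (\<epsilon> * \<phi>' r * Y r)\<^sup>2"
  by (simp add: E_def W_def power_mult_distrib)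

text \<open>The energy grows at most like \<open>exp (q * \<phi>)\<close>, and
  \<open>(Y r)\<^sup>2\<close> cancels exactly this exponential. Since \<open>\<phi>' * Y\<close> is
  proportional to the derivative of \<open>Y\<close>, this is a Lipschitz bound for \<open>Y\<close>
  that holds up to \<open>R\<close>.\<close>

lemma phi'_Y_le:
  assumes "R / 2 \<le> r" "r \<le> R"
  shows "\<phi>' r * Y r \<le> C2 / \<epsilon>"
proof -
  define d where "d = (R / 2) ^ (N - 1) * g0"
  have d: "d > 0" using R g0 by (simp add: d_def)
  have "E r * (Y r)\<^sup>2 \<le> (B * Gmax * (exp (q * \<phi> r) / q)) * (Y r)\<^sup>2"
  proof (rule mult_right_mono)
    have "E r \<le> c * Gmax * P (\<phi> r)" using assms R by (intro E_le) auto
    also have "\<dots> \<le> B * Gmax * (exp (q * \<phi> r) / q)"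
      using c_pos c_le Gmax assms R P_nonneg by (intro mult_mono P_le phi_nonneg) auto
    finally show "E r \<le> B * Gmax * (exp (q * \<phi> r) / q)" .
  qed simp
  also have "\<dots> = B * Gmax / q * ((Y r)\<^sup>2 * exp (q * \<phi> r))" by simp
  also have "\<dots> = B * Gmax / q" by (simp only: Y_sq)
  finally have 1: "E r * (Y r)\<^sup>2 \<le> B * Gmax / q" .
  have "d\<^sup>2 / 2 * (\<epsilon> * \<phi>' r * Y r)\<^sup>2 \<le> E r * (Y r)\<^sup>2"
    unfolding EY d_def using assms R g0 g_ge[of r]
    by (intro mult_right_mono divide_right_mono power_mono mult_mono) auto
  then have "(d * (\<epsilon> * (\<phi>' r * Y r)))\<^sup>2 \<le> 2 * B * Gmax / q"
    using 1 by (simp add: power_mult_distrib)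
  then have "d * (\<epsilon> * (\<phi>' r * Y r)) \<le> sqrt (2 * B * Gmax / q)"
    by (rule real_le_rsqrt)
  then show ?thesis
    using d eps unfolding C2_def d_def[symmetric] by (simp add: field_simps)
qed

text \<open>At \<open>R\<close> the slope \<open>\<phi>' R = C0 / \<epsilon>\<^sup>2\<close> is
  prescribed, so the bound on \<open>\<phi>' * Y\<close> becomes a bound on the value of
  \<open>Y\<close>.\<close>

lemma Y_R_le: "Y R \<le> C2 * \<epsilon> / C0"
  using phi'_Y_le[of R] R eps C0 unfolding phi'_R by (simp add: field_simps power2_eq_square)

text \<open>Integrates the Lipschitz bound backwards from \<open>R\<close>. Consequently
  \<open>Y\<close> tends to 0, and \<phi> to infinity, at every point whose distance from
  \<open>R\<close> is small against \<epsilon>.\<close>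

lemma Y_le:
  assumes "R / 2 \<le> r" "r \<le> R"
  shows "Y r \<le> C2 * \<epsilon> / C0 + q * C2 / 2 * ((R - r) / \<epsilon>)"
proof -
  let ?f = "\<lambda>s. Y s + q * C2 / (2 * \<epsilon>) * s"
  have "?f r \<le> ?f R"
  proof (rule mono_from_deriv[of r R ?f])
    show "continuous_on {r..R} ?f"
      by (rule cont_sub) (use assms R eps in \<open>auto intro!: continuous_intros Y_cont\<close>)
    fix x assume x: "r < x" "x < R"
    then show "(?f has_real_derivative - (q / 2) * (\<phi>' x * Y x) + q * C2 / (2 * \<epsilon>) * 1) (at x)"
      using assms R by (intro DERIV_add DERIV_cmult Y_deriv DERIV_ident) auto
    have "(q / 2) * (\<phi>' x * Y x) \<le> (q / 2) * (C2 / \<epsilon>)"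
      using x assms q by (intro mult_left_mono phi'_Y_le) auto
    then show "- (q / 2) * (\<phi>' x * Y x) + q * C2 / (2 * \<epsilon>) * 1 \<ge> 0" by simp
  qed fact
  then have "Y r \<le> Y R + q * C2 / (2 * \<epsilon>) * R - q * C2 / (2 * \<epsilon>) * r" by simp
  also have "\<dots> = Y R + q * C2 / 2 * ((R - r) / \<epsilon>)"
    by (simp add: diff_divide_distrib left_diff_distrib right_diff_distrib mult.commute)
  finally show ?thesis using Y_R_le by simp
qed

text \<open>Starting at \<open>R - \<delta>\<close> instead of 0 lets \<open>G\<close> be replaced
  by constants close to \<open>G R\<close>. The price is the energy and potential already present
  there, which \<open>exp_phi_le\<close> controls in terms of \<delta>, uniformly in
  \<epsilon>.\<close>

lemma energy_bounds:
  assumes "0 < \<delta>" "\<delta> \<le> R / 2" "R - \<delta> \<le> r" "r \<le> R" "0 \<le> m"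
    and "\<And>s. s \<in> {R-\<delta>..R} \<Longrightarrow> m \<le> G s" "\<And>s. s \<in> {R-\<delta>..R} \<Longrightarrow> G s \<le> M"
  shows "c * m * (P (\<phi> r) - C1 / (q * \<delta>)) \<le> E r"
    and "E r \<le> c * M * P (\<phi> r) + c * Gmax * (C1 / (q * \<delta>))"
proof -
  have "P (\<phi> (R - \<delta>)) \<le> exp (q * \<phi> (R - \<delta>)) / q"
    using assms R by (intro P_le phi_nonneg) auto
  also have "\<dots> \<le> (C1 / (R - (R - \<delta>))) / q"
    using assms R q by (intro divide_right_mono exp_phi_le) auto
  finally have P0: "P (\<phi> (R - \<delta>)) \<le> C1 / (q * \<delta>)" by (simp add: mult.commute)
  have M: "M \<ge> 0" using assms(5) assms(6,7)[of R] assms(1) by auto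
  have "c * m * P (\<phi> (R - \<delta>)) \<le> c * m * (C1 / (q * \<delta>))"
    using P0 c_pos assms by (intro mult_left_mono) auto
  moreover have "c * m * (P (\<phi> r) - P (\<phi> (R - \<delta>))) \<le> E r - E (R - \<delta>)"
    using assms R by (intro E_diff_ge) auto
  moreover have "E (R - \<delta>) \<ge> 0" using eps by (simp add: E_def)
  ultimately show "c * m * (P (\<phi> r) - C1 / (q * \<delta>)) \<le> E r"
    by (simp add: right_diff_distrib)
  have "E r - E (R - \<delta>) \<le> c * M * (P (\<phi> r) - P (\<phi> (R - \<delta>)))"
    using assms R by (intro E_diff_le) auto
  moreover have "E (R - \<delta>) \<le> c * Gmax * P (\<phi> (R - \<delta>))" using assms R by (intro E_le) auto
  moreover have "c * Gmax * P (\<phi> (R - \<delta>)) \<le> c * Gmax * (C1 / (q * \<delta>))"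
    using P0 c_pos Gmax by (intro mult_left_mono) auto
  moreover have "c * M * P (\<phi> (R - \<delta>)) \<ge> 0" using c_pos M P_nonneg by auto
  ultimately show "E r \<le> c * M * P (\<phi> r) + c * Gmax * (C1 / (q * \<delta>))"
    by (simp add: right_diff_distrib)
qed

section \<open>Depth in the interior and its mean\<close>

text \<open>One application of \<open>phi_step\<close> on the window from
  \<open>R - 2 * \<delta>\<close> to \<open>R - \<delta>\<close>, with the crude bound
  \<open>phi_le\<close> at its right end. The explicit dependence on \<delta> allows \<delta> to
  shrink together with \<epsilon>.\<close>

lemma phi_interior_le:
  assumes "0 < \<delta>" "\<delta> \<le> R / 4"
  shows "\<phi> (R - 2 * \<delta>) \<le> 4 * C1 / (q * K) * (\<epsilon>\<^sup>2 / \<delta> ^ 3)"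
proof -
  have nn: "\<phi> (R - 2 * \<delta>) \<ge> 0" using assms R by (intro phi_nonneg) auto
  have "\<phi> ((R - 3 / 2 * \<delta>) - \<delta> / 2) * (1 + K * (\<delta> / 2)\<^sup>2 / \<epsilon>\<^sup>2) \<le> \<phi> ((R - 3 / 2 * \<delta>) + \<delta> / 2)"
    using assms R by (intro phi_step) auto
  also have "\<dots> = \<phi> (R - \<delta>)" by (rule arg_cong[where f = \<phi>]) simp
  also have "\<dots> \<le> C1 / (q * \<delta>)" using phi_le[of "R - \<delta>"] assms R by simp
  also have "\<phi> ((R - 3 / 2 * \<delta>) - \<delta> / 2) = \<phi> (R - 2 * \<delta>)" by (rule arg_cong[where f = \<phi>]) simp
  finally have "\<phi> (R - 2 * \<delta>) * (1 + K * (\<delta> / 2)\<^sup>2 / \<epsilon>\<^sup>2) \<le> C1 / (q * \<delta>)" .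
  then have "\<phi> (R - 2 * \<delta>) * (K * (\<delta> / 2)\<^sup>2 / \<epsilon>\<^sup>2) \<le> C1 / (q * \<delta>)"
    using nn unfolding distrib_left by simp
  then have "\<phi> (R - 2 * \<delta>) \<le> C1 / (q * \<delta>) / (K * (\<delta> / 2)\<^sup>2 / \<epsilon>\<^sup>2)"
    using K eps assms by (subst pos_le_divide_eq) auto
  also have "\<dots> = 4 * C1 / (q * K) * (\<epsilon>\<^sup>2 / \<delta> ^ 3)"
    by (simp add: power2_eq_square power3_eq_cube ac_simps)
  finally show ?thesis .
qed

text \<open>Up to \<open>a\<close> monotonicity bounds the integrand; beyond \<open>a\<close> only
  the mass of \<open>exp (q * \<phi>)\<close> is known, and the parameter \<eta> balances this mass
  against the short length \<open>R - a\<close>. Applied to the mean of \<phi>, it shows that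
  \<open>us\<close> is small.\<close>

lemma integral_phi_le:
  assumes "\<eta> > 0" "0 \<le> a" "a \<le> R"
  shows "integral {0..R} (\<lambda>s. s ^ (N - 1) * \<phi> s)
     \<le> \<phi> a * J + (2 * \<eta> / q * (B * J / A) + R ^ (N - 1) / (2 * q * \<eta>) * (R - a))"
proof -
  let ?f = "\<lambda>s. s ^ (N - 1) * \<phi> s" and ?e = "\<lambda>s. s ^ (N - 1) * exp (q * \<phi> s)"
  have cf: "continuous_on {0..R} ?f" and ce: "continuous_on {0..R} ?e"
    and cp: "continuous_on {0..R} (\<lambda>s::real. s ^ (N - 1))"
    by (intro continuous_intros phi_cont)+
  note ii = integrable_continuous_real cont_sub[OF cf] cont_sub[OF ce] cont_sub[OF cp]
  have J: "J = integral {0..R} (\<lambda>s. s ^ (N - 1))"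
    using integral_power_J by (simp add: integral_unique)
  have "integral {0..R} ?f = integral {0..a} ?f + integral {a..R} ?f"
    using assms by (intro Henstock_Kurzweil_Integration.integral_combine[symmetric]
        integrable_continuous_real cf) auto
  also have "integral {0..a} ?f \<le> integral {0..a} (\<lambda>s. \<phi> a * s ^ (N - 1))"
  proof (rule integral_le)
    show "?f integrable_on {0..a}" "(\<lambda>s. \<phi> a * s ^ (N - 1)) integrable_on {0..a}"
      using assms by (auto intro!: ii(1) continuous_intros cont_sub[OF phi_cont])
    show "?f s \<le> \<phi> a * s ^ (N - 1)" if "s \<in> {0..a}" for s
      using that assms phi_mono[of s a] by (auto intro!: mult_right_mono simp: mult.commute)
  qed
  also have "\<dots> = \<phi> a * integral {0..a} (\<lambda>s. s ^ (N - 1))" by simp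
  also have "\<dots> \<le> \<phi> a * J"
    unfolding J using assms phi_nonneg[of a]
    by (intro mult_left_mono integral_subset_le ii) auto
  also have "integral {a..R} ?f \<le> integral {a..R} (\<lambda>s. 2 * \<eta> / q * ?e s + R ^ (N - 1) / (2 * q * \<eta>))"
  proof (rule integral_le)
    show "?f integrable_on {a..R}"
      "(\<lambda>s. 2 * \<eta> / q * ?e s + R ^ (N - 1) / (2 * q * \<eta>)) integrable_on {a..R}"
      using assms q by (auto intro!: ii(1) continuous_intros cont_sub[OF phi_cont])
    fix s assume s: "s \<in> {a..R}"
    define x where "x = exp (q * \<phi> s / 2)"
    have xx: "x * x = exp (q * \<phi> s)" by (simp add: x_def flip: exp_add)
    \<comment> \<open>AM-GM trades the logarithmic growth of \<open>\<phi>\<close> against the bounded mass of \<open>exp (q * \<phi>)\<close>\<close>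
    have "0 \<le> (2 * \<eta> * x - 1)\<^sup>2" by simp
    then have "4 * \<eta> * x \<le> 4 * \<eta> * \<eta> * (x * x) + 1"
      by (simp add: power2_eq_square algebra_simps)
    then have "x \<le> \<eta> * (x * x) + 1 / (4 * \<eta>)"
      using assms by (simp add: field_simps)
    moreover have "q * \<phi> s / 2 \<le> x" unfolding x_def using exp_ge_add_one_self[of "q * \<phi> s / 2"] by linarith
    ultimately have "q * \<phi> s / 2 \<le> \<eta> * exp (q * \<phi> s) + 1 / (4 * \<eta>)" by (simp add: xx)
    then have "\<phi> s \<le> (\<eta> * exp (q * \<phi> s) + 1 / (4 * \<eta>)) / (q / 2)"
      using q by (subst pos_le_divide_eq) (auto simp: mult.commute)
    also have "\<dots> = 2 * \<eta> / q * exp (q * \<phi> s) + 1 / (2 * q * \<eta>)"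
      using q assms by (simp add: field_simps)
    finally have "s ^ (N - 1) * \<phi> s \<le> s ^ (N - 1) * (2 * \<eta> / q * exp (q * \<phi> s) + 1 / (2 * q * \<eta>))"
      using s assms by (intro mult_left_mono) auto
    also have "\<dots> = 2 * \<eta> / q * ?e s + s ^ (N - 1) * (1 / (2 * q * \<eta>))" by (simp add: algebra_simps)
    also have "s ^ (N - 1) * (1 / (2 * q * \<eta>)) \<le> R ^ (N - 1) * (1 / (2 * q * \<eta>))"
      using s assms q by (intro mult_right_mono power_mono) auto
    finally show "?f s \<le> 2 * \<eta> / q * ?e s + R ^ (N - 1) / (2 * q * \<eta>)" by simp
  qed
  also have "\<dots> = 2 * \<eta> / q * integral {a..R} ?e + R ^ (N - 1) / (2 * q * \<eta>) * (R - a)"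
    using assms q by (subst integral_add)
      (auto intro!: ii(1) continuous_intros cont_sub[OF phi_cont])
  also have "2 * \<eta> / q * integral {a..R} ?e \<le> 2 * \<eta> / q * (B * J / A)"
  proof (rule mult_left_mono)
    have "integral {a..R} ?e \<le> integral {0..R} ?e"
      using assms by (intro integral_subset_le ii) auto
    then show "integral {a..R} ?e \<le> B * J / A" using mass by simp
  qed (use assms q in simp)
  finally show ?thesis by simp
qed

end

section \<open>Limits in the boundary layer\<close>

lemma tendsto_eventually_eq:
  assumes "(f \<longlongrightarrow> a) F" "\<forall>\<^sub>F x in F. f x = g x" "a = b"
  shows "(g \<longlongrightarrow> b) F"
  using assms tendsto_cong by blast

text \<open>The weights \<open>a\<close> and \<open>b\<close> may have no limiting ratio, so there
  need be no dominant term to divide by. Instead each of \<open>a x * u0\<close> and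
  \<open>b x * v0\<close> is at most the denominator, and the error is bounded by the sum of the two
  relative errors.\<close>

lemma tendsto_weighted_ratio:
  fixes u v a b :: "'a \<Rightarrow> real"
  assumes "(u \<longlongrightarrow> u0) F" "(v \<longlongrightarrow> v0) F" "u0 > 0" "v0 > 0"
    and "\<forall>\<^sub>F x in F. a x > 0" "\<forall>\<^sub>F x in F. b x \<ge> 0"
  shows "((\<lambda>x. (a x * u x + b x * v x) / (a x * u0 + b x * v0)) \<longlongrightarrow> 1) F"
proof -
  have "((\<lambda>x. (a x * u x + b x * v x) / (a x * u0 + b x * v0) - 1) \<longlongrightarrow> 0) F"
  proof (rule Lim_null_comparison)
    show "((\<lambda>x. \<bar>u x - u0\<bar> / u0 + \<bar>v x - v0\<bar> / v0) \<longlongrightarrow> 0) F"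
      using assms by (auto intro!: tendsto_eq_intros)
    show "\<forall>\<^sub>F x in F. norm ((a x * u x + b x * v x) / (a x * u0 + b x * v0) - 1)
        \<le> \<bar>u x - u0\<bar> / u0 + \<bar>v x - v0\<bar> / v0"
      using assms(5,6)
    proof eventually_elim
      case (elim x)
      define D where "D = a x * u0 + b x * v0"
      have D: "D > 0" "a x * u0 \<le> D" "b x * v0 \<le> D"
        using elim assms by (auto simp: D_def intro: add_pos_nonneg)
      have "(a x * u x + b x * v x) / D - 1 = (a x * (u x - u0) + b x * (v x - v0)) / D"
        using D(1) by (simp add: D_def field_simps)
      also have "\<bar>\<dots>\<bar> \<le> (a x * \<bar>u x - u0\<bar> + b x * \<bar>v x - v0\<bar>) / D"
        unfolding abs_divide using D(1) elim
        by (auto intro!: divide_right_mono order_trans[OF abs_triangle_ineq] simp: abs_mult)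
      also have "\<dots> = a x * \<bar>u x - u0\<bar> / D + b x * \<bar>v x - v0\<bar> / D" by (simp add: add_divide_distrib)
      also have "a x * \<bar>u x - u0\<bar> / D \<le> \<bar>u x - u0\<bar> / u0"
        using D assms(3) mult_right_mono[OF D(2), of "\<bar>u x - u0\<bar>"] by (simp add: field_simps)
      also have "b x * \<bar>v x - v0\<bar> / D \<le> \<bar>v x - v0\<bar> / v0"
        using D assms(4) mult_right_mono[OF D(3), of "\<bar>v x - v0\<bar>"] by (simp add: field_simps)
      finally show ?case by (simp add: D_def)
    qed
  qed
  then show ?thesis by (simp add: LIM_zero_iff)
qed

text \<open>Nothing is assumed about how \<open>us\<close> and \<open>c\<close> depend on
  \<epsilon>. They are controlled through \<open>mean\<close>, the zero-mean condition on
  \<open>U\<close>, and \<open>c_us\<close>, which expresses the Jensen bound on the coefficient of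
  \<open>exp (p * U)\<close>.\<close>

locale layer_family = layer_data +
  fixes us c :: "real \<Rightarrow> real" and \<phi> \<phi>' :: "real \<Rightarrow> real \<Rightarrow> real"
  assumes layer: "\<epsilon> > 0 \<Longrightarrow> layer N R A B p q g0 g1 g \<epsilon> (c \<epsilon>) (\<phi> \<epsilon>) (\<phi>' \<epsilon>)"
    and us_nonneg: "\<epsilon> > 0 \<Longrightarrow> 0 \<le> us \<epsilon>"
    and c_us: "\<epsilon> > 0 \<Longrightarrow> c \<epsilon> \<le> A * exp (p * us \<epsilon>)"
    and mean: "\<epsilon> > 0 \<Longrightarrow> integral {0..R} (\<lambda>s. s ^ (N - 1) * \<phi> \<epsilon> s) = us \<epsilon> * J"
begin

text \<open>The quantity \<open>layer.Y\<close> with \<epsilon> as an argument; its defining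
  equation holds for every \<epsilon>, without the assumptions of \<open>layer\<close>.\<close>

definition "Y \<epsilon> r = exp (- q * \<phi> \<epsilon> r / 2)"
text \<open>The limit of \<open>-\<epsilon> Y'\<close> in the layer, as the model equation with
  \<open>c = A\<close> and \<open>g = g R\<close> predicts.\<close>

definition "\<sigma> = sqrt (q * A / (2 * g R))"

lemma \<sigma>: "\<sigma> > 0" using q A gR by (simp add: \<sigma>_def)

lemma pos_eventually: "\<forall>\<^sub>F \<epsilon> in at_right (0::real). \<epsilon> > 0"
  by (rule eventually_at_right_less)

lemma layer_Y: "\<epsilon> > 0 \<Longrightarrow> layer.Y q (\<phi> \<epsilon>) = Y \<epsilon>"
  by (rule ext) (simp add: layer.Y_def[OF layer] Y_def)

lemma Y_pow2: "(Y \<epsilon> x)\<^sup>2 * exp (q * \<phi> \<epsilon> x) = 1"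
  by (simp add: Y_def power2_eq_square flip: exp_add)

lemma us_le:
  assumes "\<epsilon> > 0" "\<eta> > 0" "\<delta> > 0" "\<delta> \<le> R / 4"
  shows "us \<epsilon> \<le> 4 * C1 / (q * K) * (\<epsilon>\<^sup>2 / \<delta> ^ 3) + (2 / q * (B * J / A) * \<eta> + R ^ (N - 1) / q * (\<delta> / \<eta>)) / J"
proof -
  note layer = layer[OF assms(1)]
  have "us \<epsilon> * J \<le> \<phi> \<epsilon> (R - 2 * \<delta>) * J + (2 * \<eta> / q * (B * J / A) + R ^ (N - 1) / (2 * q * \<eta>) * (R - (R - 2 * \<delta>)))"
    unfolding mean[OF assms(1), symmetric] using assms R by (intro layer.integral_phi_le[OF layer]) auto
  also have "\<phi> \<epsilon> (R - 2 * \<delta>) * J \<le> 4 * C1 / (q * K) * (\<epsilon>\<^sup>2 / \<delta> ^ 3) * J"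
    using assms J by (intro mult_right_mono layer.phi_interior_le[OF layer]) auto
  finally have "us \<epsilon> \<le> (4 * C1 / (q * K) * (\<epsilon>\<^sup>2 / \<delta> ^ 3) * J +
      (2 * \<eta> / q * (B * J / A) + R ^ (N - 1) / (2 * q * \<eta>) * (R - (R - 2 * \<delta>)))) / J"
    using J by (subst pos_le_divide_eq) auto
  also have "\<dots> = 4 * C1 / (q * K) * (\<epsilon>\<^sup>2 / \<delta> ^ 3) +
      (2 * \<eta> / q * (B * J / A) + R ^ (N - 1) / (2 * q * \<eta>) * (R - (R - 2 * \<delta>))) / J"
    using J by (simp add: add_divide_distrib)
  also have "2 * \<eta> / q * (B * J / A) + R ^ (N - 1) / (2 * q * \<eta>) * (R - (R - 2 * \<delta>))
     = 2 / q * (B * J / A) * \<eta> + R ^ (N - 1) / q * (\<delta> / \<eta>)"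
    using assms q A by (simp add: field_simps)
  finally show ?thesis .
qed

lemma us_tendsto: "(us \<longlongrightarrow> 0) (at_right 0)"
proof (rule tendsto_sandwich)
  \<comment> \<open>\<open>us_le\<close> is used with \<delta> equal to \<epsilon> to the power 1/2
    and \<eta> to the power 1/4: the three errors \<open>\<epsilon>\<^sup>2 / \<delta> ^ 3\<close>,
    \<eta> and \<open>\<delta> / \<eta>\<close> all tend to 0.\<close>
  let ?b = "\<lambda>\<epsilon>::real. 4 * C1 / (q * K) * (\<epsilon>\<^sup>2 / (\<epsilon> powr (1/2)) ^ 3)
     + (2 / q * (B * J / A) * \<epsilon> powr (1/4) + R ^ (N - 1) / q * (\<epsilon> powr (1/2) / \<epsilon> powr (1/4))) / J"
  show "\<forall>\<^sub>F \<epsilon> in at_right 0. 0 \<le> us \<epsilon>"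
    using pos_eventually by eventually_elim (rule us_nonneg)
  have "((\<lambda>\<epsilon>::real. \<epsilon> powr (1/2)) \<longlongrightarrow> 0) (at_right 0)" by real_asymp
  then have "\<forall>\<^sub>F \<epsilon>::real in at_right 0. \<epsilon> powr (1/2) < R / 4"
    using R by (intro order_tendstoD) auto
  then show "\<forall>\<^sub>F \<epsilon> in at_right 0. us \<epsilon> \<le> ?b \<epsilon>"
    using pos_eventually by eventually_elim (rule us_le, auto)
  have "((\<lambda>\<epsilon>::real. \<epsilon>\<^sup>2 / (\<epsilon> powr (1/2)) ^ 3) \<longlongrightarrow> 0) (at_right 0)"
    "((\<lambda>\<epsilon>::real. \<epsilon> powr (1/4)) \<longlongrightarrow> 0) (at_right 0)"
    "((\<lambda>\<epsilon>::real. \<epsilon> powr (1/2) / \<epsilon> powr (1/4)) \<longlongrightarrow> 0) (at_right 0)"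
    by real_asymp+
  then have "(?b \<longlongrightarrow> 4 * C1 / (q * K) * 0 + (2 / q * (B * J / A) * 0 + R ^ (N - 1) / q * 0) / J) (at_right 0)"
    using J by (intro tendsto_intros) auto
  then show "(?b \<longlongrightarrow> 0) (at_right 0)" by simp
qed auto

lemma c_tendsto: "(c \<longlongrightarrow> A) (at_right 0)"
proof (rule tendsto_sandwich)
  show "\<forall>\<^sub>F \<epsilon> in at_right 0. A \<le> c \<epsilon>"
    using pos_eventually by eventually_elim (rule layer.c_ge[OF layer])
  show "\<forall>\<^sub>F \<epsilon> in at_right 0. c \<epsilon> \<le> A * exp (p * us \<epsilon>)"
    using pos_eventually by eventually_elim (rule c_us)
  have "((\<lambda>\<epsilon>. A * exp (p * us \<epsilon>)) \<longlongrightarrow> A * exp (p * 0)) (at_right 0)"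
    by (intro tendsto_intros us_tendsto)
  then show "((\<lambda>\<epsilon>. A * exp (p * us \<epsilon>)) \<longlongrightarrow> A) (at_right 0)" by simp
qed auto

section \<open>Limits along paths with \<open>R - r\<close> small against \<epsilon>\<close>

context
  fixes r :: "real \<Rightarrow> real"
  assumes close: "((\<lambda>\<epsilon>. (R - r \<epsilon>) / \<epsilon>) \<longlongrightarrow> 0) (at_right 0)"
    and r_le: "\<forall>\<^sub>F \<epsilon> in at_right 0. r \<epsilon> \<le> R"
begin

lemma r_tendsto: "(r \<longlongrightarrow> R) (at_right 0)"
proof -
  have "((\<lambda>\<epsilon>. (R - r \<epsilon>) / \<epsilon> * \<epsilon>) \<longlongrightarrow> 0 * 0) (at_right 0)"
    by (intro tendsto_intros close)
  moreover have "\<forall>\<^sub>F \<epsilon> in at_right 0. (R - r \<epsilon>) / \<epsilon> * \<epsilon> = R - r \<epsilon>"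
    using pos_eventually by eventually_elim simp
  ultimately have "((\<lambda>\<epsilon>. R - r \<epsilon>) \<longlongrightarrow> 0) (at_right 0)" by (simp add: tendsto_cong)
  then have "((\<lambda>\<epsilon>. R - (R - r \<epsilon>)) \<longlongrightarrow> R - 0) (at_right 0)" by (intro tendsto_intros)
  then show ?thesis by simp
qed

lemma r_ge: "x < R \<Longrightarrow> \<forall>\<^sub>F \<epsilon> in at_right 0. x < r \<epsilon>"
  by (rule order_tendstoD[OF r_tendsto])

lemma Y_tendsto_0: "((\<lambda>\<epsilon>. Y \<epsilon> (r \<epsilon>)) \<longlongrightarrow> 0) (at_right 0)"
proof (rule tendsto_sandwich)
  have half: "R / 2 < R" using R by simp
  show "\<forall>\<^sub>F \<epsilon> in at_right 0. 0 \<le> Y \<epsilon> (r \<epsilon>)" by (simp add: Y_def)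
  show "\<forall>\<^sub>F \<epsilon> in at_right 0. Y \<epsilon> (r \<epsilon>) \<le> C2 * \<epsilon> / C0 + q * C2 / 2 * ((R - r \<epsilon>) / \<epsilon>)"
    using pos_eventually r_le r_ge[OF half]
  proof eventually_elim
    case (elim \<epsilon>)
    show ?case using layer.Y_le[OF layer[OF elim(1)], of "r \<epsilon>"] elim R layer_Y by auto
  qed
  have "((\<lambda>\<epsilon>. C2 * \<epsilon> / C0 + q * C2 / 2 * ((R - r \<epsilon>) / \<epsilon>)) \<longlongrightarrow> C2 * 0 / C0 + q * C2 / 2 * 0) (at_right 0)"
    using C0 by (intro tendsto_intros close) auto
  then show "((\<lambda>\<epsilon>. C2 * \<epsilon> / C0 + q * C2 / 2 * ((R - r \<epsilon>) / \<epsilon>)) \<longlongrightarrow> 0) (at_right 0)" by simp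
qed auto

lemma Y2_exp_tendsto: "((\<lambda>\<epsilon>. (Y \<epsilon> (r \<epsilon>))\<^sup>2 * exp (- (p * \<phi> \<epsilon> (r \<epsilon>)))) \<longlongrightarrow> 0) (at_right 0)"
proof (rule tendsto_sandwich)
  show "\<forall>\<^sub>F \<epsilon> in at_right 0. 0 \<le> (Y \<epsilon> (r \<epsilon>))\<^sup>2 * exp (- (p * \<phi> \<epsilon> (r \<epsilon>)))" by simp
  show "\<forall>\<^sub>F \<epsilon> in at_right 0. (Y \<epsilon> (r \<epsilon>))\<^sup>2 * exp (- (p * \<phi> \<epsilon> (r \<epsilon>))) \<le> (Y \<epsilon> (r \<epsilon>))\<^sup>2"
    using pos_eventually r_le r_ge[of 0, OF R]
  proof eventually_elim
    case (elim \<epsilon>)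
    then have "\<phi> \<epsilon> (r \<epsilon>) \<ge> 0" by (intro layer.phi_nonneg[OF layer]) auto
    then show ?case using p by (intro mult_left_le) auto
  qed
  show "((\<lambda>\<epsilon>. (Y \<epsilon> (r \<epsilon>))\<^sup>2) \<longlongrightarrow> 0) (at_right 0)"
    using tendsto_power[OF Y_tendsto_0, of 2] by simp
qed auto

text \<open>Multiplication by \<open>Y\<^sup>2\<close> turns the leading exponential of
  \<open>P\<close> into exactly 1; all other terms carry a factor that vanishes with
  \<open>Y\<close>.\<close>

lemma PY_tendsto: "((\<lambda>\<epsilon>. P (\<phi> \<epsilon> (r \<epsilon>)) * (Y \<epsilon> (r \<epsilon>))\<^sup>2) \<longlongrightarrow> 1 / q) (at_right 0)"
proof -
  have "((\<lambda>\<epsilon>. (1 - (Y \<epsilon> (r \<epsilon>))\<^sup>2) / q + ((Y \<epsilon> (r \<epsilon>))\<^sup>2 * exp (- (p * \<phi> \<epsilon> (r \<epsilon>))) - (Y \<epsilon> (r \<epsilon>))\<^sup>2) / p)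
     \<longlongrightarrow> (1 - 0\<^sup>2) / q + (0 - 0\<^sup>2) / p) (at_right 0)"
    using p q by (intro tendsto_intros Y_tendsto_0 Y2_exp_tendsto) auto
  moreover have "(1 - (Y \<epsilon> x)\<^sup>2) / q + ((Y \<epsilon> x)\<^sup>2 * exp (- (p * \<phi> \<epsilon> x)) - (Y \<epsilon> x)\<^sup>2) / p
     = P (\<phi> \<epsilon> x) * (Y \<epsilon> x)\<^sup>2" for \<epsilon> x
    unfolding Y_pow2[of \<epsilon> x, symmetric] by (simp add: P_def algebra_simps diff_divide_distrib add_divide_distrib)
  ultimately show ?thesis by simp
qed

lemma FY_tendsto: "((\<lambda>\<epsilon>. F (\<phi> \<epsilon> (r \<epsilon>)) * (Y \<epsilon> (r \<epsilon>))\<^sup>2) \<longlongrightarrow> 1) (at_right 0)"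
proof -
  have "((\<lambda>\<epsilon>. 1 - (Y \<epsilon> (r \<epsilon>))\<^sup>2 * exp (- (p * \<phi> \<epsilon> (r \<epsilon>)))) \<longlongrightarrow> 1 - 0) (at_right 0)"
    by (intro tendsto_intros Y2_exp_tendsto)
  moreover have "1 - (Y \<epsilon> x)\<^sup>2 * exp (- (p * \<phi> \<epsilon> x)) = F (\<phi> \<epsilon> x) * (Y \<epsilon> x)\<^sup>2" for \<epsilon> x
    unfolding Y_pow2[of \<epsilon> x, symmetric] by (simp add: F_def algebra_simps)
  ultimately show ?thesis by simp
qed

text \<open>By \<open>EY\<close> the expression is the energy times \<open>Y\<^sup>2\<close>.
  Freezing \<open>G\<close> near \<open>R\<close> gives bounds arbitrarily close to
  \<open>A * G R / q\<close> from either side, and the limit follows from the order characterisation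
  without a rate.\<close>

lemma EY_tendsto:
  "((\<lambda>\<epsilon>. (r \<epsilon> ^ (N - 1) * g (r \<epsilon>))\<^sup>2 / 2 * (\<epsilon> * \<phi>' \<epsilon> (r \<epsilon>) * Y \<epsilon> (r \<epsilon>))\<^sup>2) \<longlongrightarrow> A * G R / q) (at_right 0)"
    (is "(?X \<longlongrightarrow> _) _")
proof (rule order_tendstoI)
  have X: "?X \<epsilon> = layer.E N g \<epsilon> (\<phi>' \<epsilon>) (r \<epsilon>) * (Y \<epsilon> (r \<epsilon>))\<^sup>2" if "\<epsilon> > 0" for \<epsilon>
    using layer.EY[OF layer[OF that], of "r \<epsilon>"] layer_Y[OF that] by simp
  have GR: "G R > 0" using R gR by (simp add: G_def)
  have Y2: "((\<lambda>\<epsilon>. L * (Y \<epsilon> (r \<epsilon>))\<^sup>2) \<longlongrightarrow> 0) (at_right 0)" for L :: real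
    using tendsto_mult_left[OF tendsto_power[OF Y_tendsto_0, of 2], of L] by simp
  {
    fix a assume a: "a < A * G R / q"
    \<comment> \<open>\<open>x\<close> is the value of \<open>G\<close> at which
      \<open>A * G / q\<close> equals \<open>a\<close>. The constant \<open>m\<close> lies strictly
      between \<open>x\<close> and \<open>G R\<close>; the maximum with 0 is there because
      \<open>a\<close> may be negative while the energy bound asks for
      \<open>0 \<le> m\<close>.\<close>
    define x where "x = a * q / A"
    define m where "m = max 0 ((x + G R) / 2)"
    have x: "x < G R" using a A q by (simp add: x_def field_simps)
    then have m: "0 \<le> m" "m < G R" using GR by (auto simp: m_def)
    have am: "a < A * m / q"
    proof (cases "a \<ge> 0")
      case True
      have "x < (x + G R) / 2" using x by (rule field_less_half_sum)
      then have "x < m" unfolding m_def less_max_iff_disj ..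
      then show ?thesis using A q by (simp add: x_def field_simps)
    next
      case False
      have "0 \<le> A * m / q" using A q m by auto
      then show ?thesis using False by simp
    qed
    obtain \<delta> where \<delta>: "0 < \<delta>" "\<delta> \<le> R / 2" "\<And>s. s \<in> {R-\<delta>..R} \<Longrightarrow> G s \<in> {m<..}"
      using G_near_R[of "{m<..}"] m by auto
    \<comment> \<open>\<delta>, and with it \<open>L\<close>, is fixed before \<epsilon> tends to 0,
      so the starting term \<open>L * Y\<^sup>2\<close> vanishes in the limit.\<close>
    define L where "L = C1 / (q * \<delta>)"
    have "((\<lambda>\<epsilon>. c \<epsilon> * m * (P (\<phi> \<epsilon> (r \<epsilon>)) * (Y \<epsilon> (r \<epsilon>))\<^sup>2 - L * (Y \<epsilon> (r \<epsilon>))\<^sup>2)) \<longlongrightarrow> A * m * (1 / q - 0)) (at_right 0)"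
      by (intro tendsto_intros c_tendsto PY_tendsto Y2)
    then have "\<forall>\<^sub>F \<epsilon> in at_right 0. a < c \<epsilon> * m * (P (\<phi> \<epsilon> (r \<epsilon>)) * (Y \<epsilon> (r \<epsilon>))\<^sup>2 - L * (Y \<epsilon> (r \<epsilon>))\<^sup>2)"
      using am by (intro order_tendstoD) auto
    moreover have "\<forall>\<^sub>F \<epsilon> in at_right 0. R - \<delta> < r \<epsilon>" using \<delta> by (intro r_ge) auto
    ultimately show "\<forall>\<^sub>F \<epsilon> in at_right 0. a < ?X \<epsilon>"
      using pos_eventually r_le
    proof eventually_elim
      case (elim \<epsilon>)
      have "c \<epsilon> * m * (P (\<phi> \<epsilon> (r \<epsilon>)) - L) \<le> layer.E N g \<epsilon> (\<phi>' \<epsilon>) (r \<epsilon>)"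
        unfolding L_def
        by (rule layer.energy_bounds(1)[OF layer, where M = Gmax])
          (use elim \<delta> m R in \<open>auto intro: less_imp_le layer.G_le[OF layer]\<close>)
      then have "c \<epsilon> * m * (P (\<phi> \<epsilon> (r \<epsilon>)) - L) * (Y \<epsilon> (r \<epsilon>))\<^sup>2 \<le> ?X \<epsilon>"
        unfolding X[OF elim(3)] by (intro mult_right_mono) auto
      then show ?case using elim by (simp add: algebra_simps)
    qed
  }
  {
    fix a assume a: "A * G R / q < a"
    define x where "x = a * q / A"
    define M where "M = (x + G R) / 2"
    have "G R < x" using a A q by (simp add: x_def field_simps)
    then have M: "G R < M" "M < x" by (auto simp: M_def)
    have am: "A * M / q < a" using M A q by (simp add: x_def field_simps)
    obtain \<delta> where \<delta>: "0 < \<delta>" "\<delta> \<le> R / 2" "\<And>s. s \<in> {R-\<delta>..R} \<Longrightarrow> G s \<in> {..<M}"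
      using G_near_R[of "{..<M}"] M by auto
    define L where "L = C1 / (q * \<delta>)"
    have "((\<lambda>\<epsilon>. c \<epsilon> * M * (P (\<phi> \<epsilon> (r \<epsilon>)) * (Y \<epsilon> (r \<epsilon>))\<^sup>2) + c \<epsilon> * Gmax * (L * (Y \<epsilon> (r \<epsilon>))\<^sup>2))
       \<longlongrightarrow> A * M * (1 / q) + A * Gmax * 0) (at_right 0)"
      by (intro tendsto_intros c_tendsto PY_tendsto Y2)
    then have "\<forall>\<^sub>F \<epsilon> in at_right 0. c \<epsilon> * M * (P (\<phi> \<epsilon> (r \<epsilon>)) * (Y \<epsilon> (r \<epsilon>))\<^sup>2) + c \<epsilon> * Gmax * (L * (Y \<epsilon> (r \<epsilon>))\<^sup>2) < a"
      using am by (intro order_tendstoD) auto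
    moreover have "\<forall>\<^sub>F \<epsilon> in at_right 0. R - \<delta> < r \<epsilon>" using \<delta> by (intro r_ge) auto
    ultimately show "\<forall>\<^sub>F \<epsilon> in at_right 0. ?X \<epsilon> < a"
      using pos_eventually r_le
    proof eventually_elim
      case (elim \<epsilon>)
      have G0: "0 \<le> G s" if "s \<in> {R - \<delta>..R}" for s
        unfolding G_def using that \<delta> R g0 g_ge[of s] by auto
      have "layer.E N g \<epsilon> (\<phi>' \<epsilon>) (r \<epsilon>) \<le> c \<epsilon> * M * P (\<phi> \<epsilon> (r \<epsilon>)) + c \<epsilon> * Gmax * L"
        unfolding L_def
        by (rule layer.energy_bounds(2)[OF layer, where m = 0])
          (use elim \<delta> R G0 in \<open>auto intro: less_imp_le\<close>)
      then have "?X \<epsilon> \<le> (c \<epsilon> * M * P (\<phi> \<epsilon> (r \<epsilon>)) + c \<epsilon> * Gmax * L) * (Y \<epsilon> (r \<epsilon>))\<^sup>2"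
        unfolding X[OF elim(3)] by (intro mult_right_mono) auto
      then show ?case using elim by (simp add: algebra_simps)
    qed
  }
qed

lemma g_tendsto: "((\<lambda>\<epsilon>. g (r \<epsilon>)) \<longlongrightarrow> g R) (at_right 0)"
proof (rule continuous_on_tendsto_compose[OF g_cont r_tendsto])
  show "\<forall>\<^sub>F \<epsilon> in at_right 0. r \<epsilon> \<in> {0..R}"
    using r_le r_ge[of 0, OF R] by eventually_elim auto
qed (use R in auto)

text \<open>Divides the limiting energy by the converging weight and takes the square root, whose
  sign is settled by \<open>\<phi>' \<ge> 0\<close>. Up to the factor \<open>q / 2\<close> this is
  the limit of \<open>-\<epsilon> Y'\<close>.\<close>

lemma slope_tendsto: "((\<lambda>\<epsilon>. \<epsilon> * \<phi>' \<epsilon> (r \<epsilon>) * Y \<epsilon> (r \<epsilon>)) \<longlongrightarrow> 2 * \<sigma> / q) (at_right 0)"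
proof -
  let ?X = "\<lambda>\<epsilon>. (r \<epsilon> ^ (N - 1) * g (r \<epsilon>))\<^sup>2 / 2 * (\<epsilon> * \<phi>' \<epsilon> (r \<epsilon>) * Y \<epsilon> (r \<epsilon>))\<^sup>2"
  have "((\<lambda>\<epsilon>. sqrt (?X \<epsilon> / ((r \<epsilon> ^ (N - 1) * g (r \<epsilon>))\<^sup>2 / 2))) \<longlongrightarrow>
      sqrt (A * G R / q / ((R ^ (N - 1) * g R)\<^sup>2 / 2))) (at_right 0)"
    using R gR by (intro tendsto_intros EY_tendsto r_tendsto g_tendsto) auto
  also have "A * G R / q / ((R ^ (N - 1) * g R)\<^sup>2 / 2) = (2 * \<sigma> / q)\<^sup>2"
  proof -
    have "R ^ (2 * N - 2) = R ^ (N - 1) * R ^ (N - 1)"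
      unfolding power_add[symmetric] by (rule arg_cong[where f = "power R"]) simp
    moreover have "\<sigma>\<^sup>2 = q * A / (2 * g R)" using q A gR by (simp add: \<sigma>_def)
    ultimately show ?thesis using R q gR
      by (simp add: G_def power_divide power_mult_distrib) (simp add: power2_eq_square ac_simps)
  qed
  also have "sqrt ((2 * \<sigma> / q)\<^sup>2) = 2 * \<sigma> / q" using \<sigma> q by simp
  finally show ?thesis
  proof (rule Lim_transform_eventually)
    show "\<forall>\<^sub>F \<epsilon> in at_right 0. sqrt (?X \<epsilon> / ((r \<epsilon> ^ (N - 1) * g (r \<epsilon>))\<^sup>2 / 2)) = \<epsilon> * \<phi>' \<epsilon> (r \<epsilon>) * Y \<epsilon> (r \<epsilon>)"
      using pos_eventually r_le r_ge[of 0, OF R]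
    proof eventually_elim
      case (elim \<epsilon>)
      have "r \<epsilon> ^ (N - 1) * g (r \<epsilon>) \<noteq> 0" using elim g_ge[of "r \<epsilon>"] g0 by auto
      then have "?X \<epsilon> / ((r \<epsilon> ^ (N - 1) * g (r \<epsilon>))\<^sup>2 / 2) = (\<epsilon> * \<phi>' \<epsilon> (r \<epsilon>) * Y \<epsilon> (r \<epsilon>))\<^sup>2"
        by (simp del: mult_eq_0_iff)
      moreover have "\<epsilon> * \<phi>' \<epsilon> (r \<epsilon>) * Y \<epsilon> (r \<epsilon>) \<ge> 0"
        using elim layer.phi'_nonneg[OF layer, of \<epsilon> "r \<epsilon>"] by (simp add: Y_def)
      ultimately show ?case by simp
    qed
  qed
qed

end

text \<open>Uses \<open>slope_tendsto\<close> on the constant path \<open>R\<close>, which the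
  non-strict bound on \<open>r\<close> admits. There
  \<open>\<epsilon> * \<phi>' \<epsilon> R\<close> equals \<open>C0 / \<epsilon>\<close>, so a limit
  of slopes yields the boundary value.\<close>

lemma Y_R_tendsto: "((\<lambda>\<epsilon>. Y \<epsilon> R / \<epsilon>) \<longlongrightarrow> 2 * \<sigma> / (q * C0)) (at_right 0)"
proof -
  have "((\<lambda>\<epsilon>. \<epsilon> * \<phi>' \<epsilon> R * Y \<epsilon> R / C0) \<longlongrightarrow> 2 * \<sigma> / q / C0) (at_right 0)"
    using C0 by (intro tendsto_divide slope_tendsto) auto
  moreover have "\<forall>\<^sub>F \<epsilon> in at_right 0. \<epsilon> * \<phi>' \<epsilon> R * Y \<epsilon> R / C0 = Y \<epsilon> R / \<epsilon>"
    using pos_eventually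
  proof eventually_elim
    case (elim \<epsilon>)
    show ?case using layer.phi'_R[OF layer[OF elim]] elim C0 by (simp add: power2_eq_square)
  qed
  ultimately show ?thesis by (rule tendsto_eventually_eq) simp
qed

lemma Y_mean_value:
  assumes "\<epsilon> > 0" "0 < r" "r \<le> R"
  obtains s where "r \<le> s" "s \<le> R" "Y \<epsilon> r = Y \<epsilon> R + (R - r) * (q / 2 * (\<phi>' \<epsilon> s * Y \<epsilon> s))"
proof (cases "r = R")
  case False
  have "continuous_on {r..R} (Y \<epsilon>)"
    using layer.cont_sub[OF layer layer.Y_cont[OF layer], of \<epsilon> \<epsilon> r R] assms layer_Y by simp
  moreover have "(Y \<epsilon> has_real_derivative - (q / 2) * (\<phi>' \<epsilon> x * Y \<epsilon> x)) (at x)" if "r < x" "x < R" for x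
    using layer.Y_deriv[OF layer[OF assms(1)], of x] that assms layer_Y by auto
  ultimately obtain z where "r < z" "z < R" "Y \<epsilon> R - Y \<epsilon> r = (R - r) * (- (q / 2) * (\<phi>' \<epsilon> z * Y \<epsilon> z))"
    using False assms by (rule_tac MVT_on[of r R "Y \<epsilon>"]) auto
  then show ?thesis by (intro that[of z]) auto
qed (use that in simp)

definition "T r \<epsilon> = \<sigma> * (2 * \<epsilon> / (q * C0) + (R - r \<epsilon>) / \<epsilon>)"

context
  fixes r :: "real \<Rightarrow> real"
  assumes close: "((\<lambda>\<epsilon>. (R - r \<epsilon>) / \<epsilon>) \<longlongrightarrow> 0) (at_right 0)"
    and r_le: "\<forall>\<^sub>F \<epsilon> in at_right 0. r \<epsilon> \<le> R"
begin

text \<open>The mean value point lies between \<open>r \<epsilon>\<close> and \<open>R\<close>,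
  hence is again a path to which \<open>slope_tendsto\<close> applies. The boundary value and the
  increment are then compared jointly, since either may dominate.\<close>

lemma Y_ratio_tendsto: "((\<lambda>\<epsilon>. Y \<epsilon> (r \<epsilon>) / T r \<epsilon>) \<longlongrightarrow> 1) (at_right 0)"
proof -
  \<comment> \<open>The point \<open>s \<epsilon>\<close> is chosen only where the mean value
    theorem applies; elsewhere it is arbitrary, harmless because \<open>good\<close> holds
    eventually.\<close>
  define good where "good \<epsilon> \<longleftrightarrow> \<epsilon> > 0 \<and> 0 < r \<epsilon> \<and> r \<epsilon> \<le> R" for \<epsilon>
  have good: "\<forall>\<^sub>F \<epsilon> in at_right 0. good \<epsilon>"
    using pos_eventually r_le r_ge[OF close r_le R] by eventually_elim (simp add: good_def)
  have "\<forall>\<epsilon>. \<exists>s. good \<epsilon> \<longrightarrow> r \<epsilon> \<le> s \<and> s \<le> R \<and>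
      Y \<epsilon> (r \<epsilon>) = Y \<epsilon> R + (R - r \<epsilon>) * (q / 2 * (\<phi>' \<epsilon> s * Y \<epsilon> s))"
    unfolding good_def by (metis Y_mean_value)
  then obtain s where s: "\<And>\<epsilon>. good \<epsilon> \<Longrightarrow> r \<epsilon> \<le> s \<epsilon> \<and> s \<epsilon> \<le> R \<and>
      Y \<epsilon> (r \<epsilon>) = Y \<epsilon> R + (R - r \<epsilon>) * (q / 2 * (\<phi>' \<epsilon> (s \<epsilon>) * Y \<epsilon> (s \<epsilon>)))"
    by metis
  have s_close: "((\<lambda>\<epsilon>. (R - s \<epsilon>) / \<epsilon>) \<longlongrightarrow> 0) (at_right 0)"
  proof (rule tendsto_sandwich[OF _ _ _ close])
    show "\<forall>\<^sub>F \<epsilon> in at_right 0. 0 \<le> (R - s \<epsilon>) / \<epsilon>"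
      using good by eventually_elim (use s in \<open>auto simp: good_def\<close>)
    show "\<forall>\<^sub>F \<epsilon> in at_right 0. (R - s \<epsilon>) / \<epsilon> \<le> (R - r \<epsilon>) / \<epsilon>"
      using good by eventually_elim (use s in \<open>auto simp: good_def intro!: divide_right_mono\<close>)
  qed auto
  have s_le: "\<forall>\<^sub>F \<epsilon> in at_right 0. s \<epsilon> \<le> R"
    using good by eventually_elim (use s in auto)
  have "((\<lambda>\<epsilon>. q / 2 * (\<epsilon> * \<phi>' \<epsilon> (s \<epsilon>) * Y \<epsilon> (s \<epsilon>))) \<longlongrightarrow> q / 2 * (2 * \<sigma> / q)) (at_right 0)"
    by (intro tendsto_mult_left slope_tendsto[OF s_close s_le])
  then have v: "((\<lambda>\<epsilon>. q / 2 * (\<epsilon> * \<phi>' \<epsilon> (s \<epsilon>) * Y \<epsilon> (s \<epsilon>))) \<longlongrightarrow> \<sigma>) (at_right 0)"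
    using q by simp
  have "((\<lambda>\<epsilon>. (\<epsilon> * (Y \<epsilon> R / \<epsilon>) + (R - r \<epsilon>) / \<epsilon> * (q / 2 * (\<epsilon> * \<phi>' \<epsilon> (s \<epsilon>) * Y \<epsilon> (s \<epsilon>)))) /
      (\<epsilon> * (2 * \<sigma> / (q * C0)) + (R - r \<epsilon>) / \<epsilon> * \<sigma>)) \<longlongrightarrow> 1) (at_right 0)"
  proof (rule tendsto_weighted_ratio[OF Y_R_tendsto v])
    show "\<forall>\<^sub>F \<epsilon> in at_right 0. 0 \<le> (R - r \<epsilon>) / \<epsilon>"
      using good by eventually_elim (auto simp: good_def)
  qed (use \<sigma> q C0 pos_eventually in auto)
  moreover have "\<forall>\<^sub>F \<epsilon> in at_right 0.
     (\<epsilon> * (Y \<epsilon> R / \<epsilon>) + (R - r \<epsilon>) / \<epsilon> * (q / 2 * (\<epsilon> * \<phi>' \<epsilon> (s \<epsilon>) * Y \<epsilon> (s \<epsilon>)))) /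
      (\<epsilon> * (2 * \<sigma> / (q * C0)) + (R - r \<epsilon>) / \<epsilon> * \<sigma>) = Y \<epsilon> (r \<epsilon>) / T r \<epsilon>"
    using good
  proof eventually_elim
    case (elim \<epsilon>)
    have "\<epsilon> > 0" using elim by (simp add: good_def)
    then have "\<epsilon> * (Y \<epsilon> R / \<epsilon>) + (R - r \<epsilon>) / \<epsilon> * (q / 2 * (\<epsilon> * \<phi>' \<epsilon> (s \<epsilon>) * Y \<epsilon> (s \<epsilon>))) = Y \<epsilon> (r \<epsilon>)"
      using s[OF elim] by simp
    moreover have "\<epsilon> * (2 * \<sigma> / (q * C0)) + (R - r \<epsilon>) / \<epsilon> * \<sigma> = T r \<epsilon>"
      by (simp add: T_def algebra_simps)
    ultimately show ?case by simp
  qed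
  ultimately show ?thesis by (rule tendsto_eventually_eq) simp
qed

text \<open>\<open>T r\<close> enters only up to asymptotic equivalence, so each regime may substitute its leading term \<open>t\<close>.\<close>

lemma boundary_asymptotics:
  fixes t :: "real \<Rightarrow> real"
  assumes t: "((\<lambda>\<epsilon>. T r \<epsilon> / t \<epsilon>) \<longlongrightarrow> 1) (at_right 0)" and t_pos: "\<forall>\<^sub>F \<epsilon> in at_right 0. t \<epsilon> > 0"
  shows "((\<lambda>\<epsilon>. us \<epsilon> - \<phi> \<epsilon> (r \<epsilon>) - 2 / q * ln (t \<epsilon>)) \<longlongrightarrow> 0) (at_right 0)"
    and "((\<lambda>\<epsilon>. \<epsilon> * \<phi>' \<epsilon> (r \<epsilon>) * t \<epsilon>) \<longlongrightarrow> 2 * \<sigma> / q) (at_right 0)"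
    and "((\<lambda>\<epsilon>. c \<epsilon> * F (\<phi> \<epsilon> (r \<epsilon>)) * (t \<epsilon>)\<^sup>2) \<longlongrightarrow> A) (at_right 0)"
proof -
  have T_pos: "\<forall>\<^sub>F \<epsilon> in at_right 0. T r \<epsilon> > 0"
    using pos_eventually r_le
    by eventually_elim (use \<sigma> q C0 in \<open>auto simp: T_def intro!: mult_pos_pos add_pos_nonneg divide_pos_pos\<close>)
  have "((\<lambda>\<epsilon>. Y \<epsilon> (r \<epsilon>) / T r \<epsilon> * (T r \<epsilon> / t \<epsilon>)) \<longlongrightarrow> 1 * 1) (at_right 0)"
    by (intro tendsto_mult Y_ratio_tendsto t)
  moreover have "\<forall>\<^sub>F \<epsilon> in at_right 0. Y \<epsilon> (r \<epsilon>) / T r \<epsilon> * (T r \<epsilon> / t \<epsilon>) = Y \<epsilon> (r \<epsilon>) / t \<epsilon>"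
    using T_pos by eventually_elim simp
  ultimately have Yt: "((\<lambda>\<epsilon>. Y \<epsilon> (r \<epsilon>) / t \<epsilon>) \<longlongrightarrow> 1) (at_right 0)" by (rule tendsto_eventually_eq) simp
  \<comment> \<open>Since \<phi> is \<open>- (2 / q) * ln Y\<close>, the difference to be estimated
    is \<open>us\<close> plus a multiple of the logarithm of a ratio tending to 1.\<close>
  have "((\<lambda>\<epsilon>. us \<epsilon> + 2 / q * ln (Y \<epsilon> (r \<epsilon>) / t \<epsilon>)) \<longlongrightarrow> 0 + 2 / q * ln 1) (at_right 0)"
    by (intro tendsto_intros us_tendsto Yt) auto
  moreover have "\<forall>\<^sub>F \<epsilon> in at_right 0. us \<epsilon> + 2 / q * ln (Y \<epsilon> (r \<epsilon>) / t \<epsilon>) = us \<epsilon> - \<phi> \<epsilon> (r \<epsilon>) - 2 / q * ln (t \<epsilon>)"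
    using t_pos
  proof eventually_elim
    case (elim \<epsilon>)
    have "ln (Y \<epsilon> (r \<epsilon>) / t \<epsilon>) = - q * \<phi> \<epsilon> (r \<epsilon>) / 2 - ln (t \<epsilon>)"
      using elim by (subst ln_div) (auto simp: Y_def)
    then show ?case using q by (simp add: right_diff_distrib)
  qed
  ultimately show "((\<lambda>\<epsilon>. us \<epsilon> - \<phi> \<epsilon> (r \<epsilon>) - 2 / q * ln (t \<epsilon>)) \<longlongrightarrow> 0) (at_right 0)"
    by (rule tendsto_eventually_eq) simp
  have "((\<lambda>\<epsilon>. \<epsilon> * \<phi>' \<epsilon> (r \<epsilon>) * Y \<epsilon> (r \<epsilon>) / (Y \<epsilon> (r \<epsilon>) / t \<epsilon>)) \<longlongrightarrow> 2 * \<sigma> / q / 1) (at_right 0)"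
    by (intro tendsto_divide slope_tendsto[OF close r_le] Yt) auto
  then show "((\<lambda>\<epsilon>. \<epsilon> * \<phi>' \<epsilon> (r \<epsilon>) * t \<epsilon>) \<longlongrightarrow> 2 * \<sigma> / q) (at_right 0)"
    by (simp add: Y_def mult.assoc)
  have "((\<lambda>\<epsilon>. c \<epsilon> * (F (\<phi> \<epsilon> (r \<epsilon>)) * (Y \<epsilon> (r \<epsilon>))\<^sup>2) / (Y \<epsilon> (r \<epsilon>) / t \<epsilon>)\<^sup>2) \<longlongrightarrow> A * 1 / 1\<^sup>2) (at_right 0)"
    by (intro tendsto_intros FY_tendsto[OF close r_le] Yt c_tendsto) auto
  then show "((\<lambda>\<epsilon>. c \<epsilon> * F (\<phi> \<epsilon> (r \<epsilon>)) * (t \<epsilon>)\<^sup>2) \<longlongrightarrow> A) (at_right 0)"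
    by (simp add: Y_def power_divide mult.assoc)
qed

section \<open>The two regimes of \<open>(R - r) / \<epsilon>\<^sup>2\<close>\<close>

text \<open>The quotient of the two terms of \<open>T\<close> is a multiple of
  \<open>(R - r) / \<epsilon>\<^sup>2\<close>. When this diverges the boundary value is negligible,
  so the result does not see \<open>C0\<close>.\<close>

lemma intermediate_layer:
  assumes far: "filterlim (\<lambda>\<epsilon>. (R - r \<epsilon>) / \<epsilon>\<^sup>2) at_top (at_right 0)"
  shows "((\<lambda>\<epsilon>. us \<epsilon> - \<phi> \<epsilon> (r \<epsilon>) - 2 / q * ln (\<sigma> * ((R - r \<epsilon>) / \<epsilon>))) \<longlongrightarrow> 0) (at_right 0)"
    and "((\<lambda>\<epsilon>. - \<phi>' \<epsilon> (r \<epsilon>) / (- 2 / (q * (R - r \<epsilon>)))) \<longlongrightarrow> 1) (at_right 0)"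
    and "((\<lambda>\<epsilon>. c \<epsilon> * F (\<phi> \<epsilon> (r \<epsilon>)) / (2 * g R / q * (\<epsilon> / (R - r \<epsilon>))\<^sup>2)) \<longlongrightarrow> 1) (at_right 0)"
proof -
  let ?t = "\<lambda>\<epsilon>. \<sigma> * ((R - r \<epsilon>) / \<epsilon>)"
  \<comment> \<open>Divergence of the quotient forces \<open>r \<epsilon> < R\<close>, which makes
    the divisions by \<open>R - r \<epsilon>\<close> legitimate.\<close>
  have lt: "\<forall>\<^sub>F \<epsilon> in at_right 0. \<epsilon> > 0 \<and> r \<epsilon> < R"
    using pos_eventually filterlim_at_top_dense[THEN iffD1, OF far, rule_format, of 0]
    by eventually_elim (simp add: zero_less_divide_iff)
  have t_pos: "\<forall>\<^sub>F \<epsilon> in at_right 0. ?t \<epsilon> > 0"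
    using lt by eventually_elim (use \<sigma> in auto)
  have "((\<lambda>\<epsilon>. 2 / (q * C0) * inverse ((R - r \<epsilon>) / \<epsilon>\<^sup>2) + 1) \<longlongrightarrow> 2 / (q * C0) * 0 + 1) (at_right 0)"
    by (intro tendsto_intros tendsto_inverse_0_at_top far)
  moreover have "\<forall>\<^sub>F \<epsilon> in at_right 0. 2 / (q * C0) * inverse ((R - r \<epsilon>) / \<epsilon>\<^sup>2) + 1 = T r \<epsilon> / ?t \<epsilon>"
    using lt
  proof eventually_elim
    case (elim \<epsilon>)
    define x where "x = R - r \<epsilon>"
    have "x \<noteq> 0" "\<epsilon> \<noteq> 0" using elim by (auto simp: x_def)
    then show ?case unfolding T_def x_def[symmetric]
      using \<sigma> q C0 by (simp add: field_simps power2_eq_square)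
  qed
  ultimately have t: "((\<lambda>\<epsilon>. T r \<epsilon> / ?t \<epsilon>) \<longlongrightarrow> 1) (at_right 0)" by (rule tendsto_eventually_eq) simp
  note * = boundary_asymptotics[OF t t_pos]
  show "((\<lambda>\<epsilon>. us \<epsilon> - \<phi> \<epsilon> (r \<epsilon>) - 2 / q * ln (?t \<epsilon>)) \<longlongrightarrow> 0) (at_right 0)" by (rule *(1))
  have "((\<lambda>\<epsilon>. \<epsilon> * \<phi>' \<epsilon> (r \<epsilon>) * ?t \<epsilon> / (2 * \<sigma> / q)) \<longlongrightarrow> (2 * \<sigma> / q) / (2 * \<sigma> / q)) (at_right 0)"
    using \<sigma> q by (intro tendsto_divide *(2) tendsto_const) auto
  moreover have "\<forall>\<^sub>F \<epsilon> in at_right 0. \<epsilon> * \<phi>' \<epsilon> (r \<epsilon>) * ?t \<epsilon> / (2 * \<sigma> / q) = - \<phi>' \<epsilon> (r \<epsilon>) / (- 2 / (q * (R - r \<epsilon>)))"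
    using lt
  proof eventually_elim
    case (elim \<epsilon>)
    define x where "x = R - r \<epsilon>"
    have "x \<noteq> 0" "\<epsilon> \<noteq> 0" using elim by (auto simp: x_def)
    then show ?case unfolding x_def[symmetric]
      using \<sigma> q by (simp add: field_simps)
  qed
  ultimately show "((\<lambda>\<epsilon>. - \<phi>' \<epsilon> (r \<epsilon>) / (- 2 / (q * (R - r \<epsilon>)))) \<longlongrightarrow> 1) (at_right 0)"
    by (rule tendsto_eventually_eq) (use \<sigma> q in simp)
  have \<sigma>2: "\<sigma>\<^sup>2 = q * A / (2 * g R)" using q A gR by (simp add: \<sigma>_def)
  have "((\<lambda>\<epsilon>. c \<epsilon> * F (\<phi> \<epsilon> (r \<epsilon>)) * (?t \<epsilon>)\<^sup>2 / A) \<longlongrightarrow> A / A) (at_right 0)"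
    using A by (intro tendsto_divide *(3) tendsto_const) auto
  moreover have "\<forall>\<^sub>F \<epsilon> in at_right 0. c \<epsilon> * F (\<phi> \<epsilon> (r \<epsilon>)) * (?t \<epsilon>)\<^sup>2 / A
      = c \<epsilon> * F (\<phi> \<epsilon> (r \<epsilon>)) / (2 * g R / q * (\<epsilon> / (R - r \<epsilon>))\<^sup>2)"
    using lt
  proof eventually_elim
    case (elim \<epsilon>)
    define x X where "x = R - r \<epsilon>" and "X = c \<epsilon> * F (\<phi> \<epsilon> (r \<epsilon>))"
    have "x \<noteq> 0" "\<epsilon> \<noteq> 0" using elim by (auto simp: x_def)
    then show ?case unfolding power_mult_distrib \<sigma>2 power_divide x_def[symmetric] X_def[symmetric]
      using q A gR by (simp add: field_simps)
  qed
  ultimately show "((\<lambda>\<epsilon>. c \<epsilon> * F (\<phi> \<epsilon> (r \<epsilon>)) / (2 * g R / q * (\<epsilon> / (R - r \<epsilon>))\<^sup>2)) \<longlongrightarrow> 1) (at_right 0)"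
    by (rule tendsto_eventually_eq) (use A in simp)
qed

text \<open>Here the boundary value dominates \<open>T\<close>: the asymptotics coincide with those
  at \<open>R\<close> itself and the position of \<open>r\<close> disappears from them.\<close>

lemma inner_layer:
  assumes near: "((\<lambda>\<epsilon>. (R - r \<epsilon>) / \<epsilon>\<^sup>2) \<longlongrightarrow> 0) (at_right 0)"
  shows "((\<lambda>\<epsilon>. us \<epsilon> - \<phi> \<epsilon> (r \<epsilon>) - 2 / q * ln (2 * \<sigma> / (q * C0) * \<epsilon>)) \<longlongrightarrow> 0) (at_right 0)"
    and "((\<lambda>\<epsilon>. - \<phi>' \<epsilon> (r \<epsilon>) / (- C0 / \<epsilon>\<^sup>2)) \<longlongrightarrow> 1) (at_right 0)"
    and "((\<lambda>\<epsilon>. c \<epsilon> * F (\<phi> \<epsilon> (r \<epsilon>)) / (q * g R * C0\<^sup>2 / (2 * \<epsilon>\<^sup>2))) \<longlongrightarrow> 1) (at_right 0)"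
proof -
  let ?t = "\<lambda>\<epsilon>. 2 * \<sigma> / (q * C0) * \<epsilon>"
  have t_pos: "\<forall>\<^sub>F \<epsilon> in at_right 0. ?t \<epsilon> > 0"
    using pos_eventually by eventually_elim (use \<sigma> q C0 in auto)
  have "((\<lambda>\<epsilon>. 1 + q * C0 / 2 * ((R - r \<epsilon>) / \<epsilon>\<^sup>2)) \<longlongrightarrow> 1 + q * C0 / 2 * 0) (at_right 0)"
    by (intro tendsto_intros near)
  moreover have "\<forall>\<^sub>F \<epsilon> in at_right 0. 1 + q * C0 / 2 * ((R - r \<epsilon>) / \<epsilon>\<^sup>2) = T r \<epsilon> / ?t \<epsilon>"
    using pos_eventually
  proof eventually_elim
    case (elim \<epsilon>)
    define x where "x = R - r \<epsilon>"
    show ?case unfolding T_def x_def[symmetric]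
      using elim \<sigma> q C0 by (simp add: field_simps power2_eq_square)
  qed
  ultimately have t: "((\<lambda>\<epsilon>. T r \<epsilon> / ?t \<epsilon>) \<longlongrightarrow> 1) (at_right 0)" by (rule tendsto_eventually_eq) simp
  note * = boundary_asymptotics[OF t t_pos]
  show "((\<lambda>\<epsilon>. us \<epsilon> - \<phi> \<epsilon> (r \<epsilon>) - 2 / q * ln (?t \<epsilon>)) \<longlongrightarrow> 0) (at_right 0)" by (rule *(1))
  have "((\<lambda>\<epsilon>. \<epsilon> * \<phi>' \<epsilon> (r \<epsilon>) * ?t \<epsilon> / (2 * \<sigma> / q)) \<longlongrightarrow> (2 * \<sigma> / q) / (2 * \<sigma> / q)) (at_right 0)"
    using \<sigma> q by (intro tendsto_divide *(2) tendsto_const) auto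
  moreover have "\<forall>\<^sub>F \<epsilon> in at_right 0. \<epsilon> * \<phi>' \<epsilon> (r \<epsilon>) * ?t \<epsilon> / (2 * \<sigma> / q) = - \<phi>' \<epsilon> (r \<epsilon>) / (- C0 / \<epsilon>\<^sup>2)"
    using pos_eventually by eventually_elim (use \<sigma> q C0 in \<open>simp add: field_simps power2_eq_square\<close>)
  ultimately show "((\<lambda>\<epsilon>. - \<phi>' \<epsilon> (r \<epsilon>) / (- C0 / \<epsilon>\<^sup>2)) \<longlongrightarrow> 1) (at_right 0)"
    by (rule tendsto_eventually_eq) (use \<sigma> q in simp)
  have \<sigma>2: "\<sigma>\<^sup>2 = q * A / (2 * g R)" using q A gR by (simp add: \<sigma>_def)
  have "((\<lambda>\<epsilon>. c \<epsilon> * F (\<phi> \<epsilon> (r \<epsilon>)) * (?t \<epsilon>)\<^sup>2 / A) \<longlongrightarrow> A / A) (at_right 0)"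
    using A by (intro tendsto_divide *(3) tendsto_const) auto
  moreover have "\<forall>\<^sub>F \<epsilon> in at_right 0. c \<epsilon> * F (\<phi> \<epsilon> (r \<epsilon>)) * (?t \<epsilon>)\<^sup>2 / A
      = c \<epsilon> * F (\<phi> \<epsilon> (r \<epsilon>)) / (q * g R * C0\<^sup>2 / (2 * \<epsilon>\<^sup>2))"
    using pos_eventually
  proof eventually_elim
    case (elim \<epsilon>)
    define X where "X = c \<epsilon> * F (\<phi> \<epsilon> (r \<epsilon>))"
    show ?case unfolding power_mult_distrib \<sigma>2 power_divide X_def[symmetric]
      using elim q A gR C0 by (simp add: field_simps power2_eq_square)
  qed
  ultimately show "((\<lambda>\<epsilon>. c \<epsilon> * F (\<phi> \<epsilon> (r \<epsilon>)) / (q * g R * C0\<^sup>2 / (2 * \<epsilon>\<^sup>2))) \<longlongrightarrow> 1) (at_right 0)"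
    by (rule tendsto_eventually_eq) (use A in simp)
qed

end

end

section \<open>Exponential decay outside the boundary layer\<close>

context layer
begin

lemma W_ge_phi':
  assumes "R / 2 \<le> r" "r \<le> R"
  shows "(R / 2) ^ (N - 1) * g0 * \<phi>' r \<le> W r"
  unfolding W_def using assms R g0 g_ge[of r] phi'_nonneg[of r]
  by (intro mult_right_mono mult_mono power_mono) auto

text \<open>Halving is iterated over at most half of the distance to \<open>R\<close>, which leaves
  room for the crude bound \<open>phi_le\<close> at the far end. That bound costs only a factor
  \<open>1 / \<epsilon>\<close> against the exponential gain.\<close>

lemma interior_decay:
  assumes "R / 2 \<le> r" "R - r \<ge> 4 * (\<epsilon> / sqrt K)" "R - r \<ge> \<epsilon>"
  defines "e \<equiv> exp (- (ln 2 * sqrt K / 4 * ((R - r) / \<epsilon>)))"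
  shows "\<phi> r \<le> 8 * C1 / q * (e / \<epsilon>)"
    and "\<phi>' r \<le> 8 * C1 / q * sqrt K * (R ^ (N - 1) * g1) / ((R / 2) ^ (N - 1) * g0) * (e / \<epsilon>\<^sup>2)"
proof -
  define h where "h = \<epsilon> / sqrt K"
  define D where "D = R - r"
  have h: "h > 0" using eps K by (simp add: h_def)
  \<comment> \<open>Each halving consumes \<open>2 * h\<close>, so \<open>D / (4 * h)\<close> of
    them fit into half of the distance.\<close>
  define n where "n = nat \<lfloor>D / (4 * h)\<rfloor>"
  have D: "D > 0" "D \<ge> 4 * h" "D \<ge> \<epsilon>" "r = R - D" using assms h by (auto simp: D_def h_def)
  have n: "real n \<le> D / (4 * h)" "D / (4 * h) < real n + 1"
    using D h unfolding n_def by (auto simp: of_nat_nat)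
  define m where "m = 2 * real n * h"
  have m: "0 \<le> m" "m \<le> D / 2" using n h by (auto simp: m_def field_simps)
  \<comment> \<open>Rounding down loses less than one halving, hence the factor 2.\<close>
  have e: "1 / 2 ^ n \<le> 2 * e"
  proof -
    have k: "ln 2 * sqrt K / 4 * (D / \<epsilon>) = ln 2 * (D / (4 * h))"
      using K eps by (simp add: h_def)
    have "ln 2 * (D / (4 * h)) \<le> ln 2 * (real n + 1)" using n by (intro mult_left_mono) auto
    then have "exp (- (ln 2 * (real n + 1))) \<le> e"
      unfolding e_def D_def[symmetric] k by simp
    moreover have "exp (ln 2 * (real n + 1)) = 2 ^ n * (2 :: real)"
      by (simp add: distrib_left exp_add mult.commute[of _ "real n"] exp_of_nat_mult)
    then have "exp (- (ln 2 * (real n + 1))) = 1 / 2 ^ n / (2 :: real)"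
      unfolding exp_minus by (simp add: inverse_eq_divide)
    ultimately show ?thesis by simp
  qed
  \<comment> \<open>The bound is proved at \<open>r + h\<close> rather than \<open>r\<close>: it
    then also controls the increment of \<phi> over \<open>{r..r + h}\<close>, and through
    \<open>W_step_upper\<close> the flux at \<open>r\<close>.\<close>
  have "\<phi> (r + h) \<le> \<phi> (r + h + m) / 2 ^ n"
    unfolding m_def using assms(1) D m h
    by (intro phi_halving) (auto simp: h_def[symmetric] m_def[symmetric])
  also have "\<dots> \<le> (C1 / (q * (R - (r + h + m)))) / 2 ^ n"
    using assms(1) D m h by (intro divide_right_mono phi_le) auto
  \<comment> \<open>The remaining distance to \<open>R\<close> is \<open>D - h - m\<close>, at least
    \<open>D / 4\<close> and hence at least \<open>\<epsilon> / 4\<close>.\<close>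
  also have "\<dots> \<le> (C1 / (q * (\<epsilon> / 4))) / 2 ^ n"
    using D m h eps q C1 by (intro divide_right_mono divide_left_mono mult_left_mono mult_pos_pos) auto
  also have "\<dots> = 4 * C1 / (q * \<epsilon>) * (1 / 2 ^ n)" using q eps by (simp add: field_simps)
  also have "\<dots> \<le> 4 * C1 / (q * \<epsilon>) * (2 * e)" using e C1 q eps by (intro mult_left_mono) auto
  also have "\<dots> = 8 * C1 / q * (e / \<epsilon>)" by simp
  finally have *: "\<phi> (r + h) \<le> 8 * C1 / q * (e / \<epsilon>)" .
  have r: "0 < r" "r + h \<le> R" using assms R D h by auto
  show "\<phi> r \<le> 8 * C1 / q * (e / \<epsilon>)" using * phi_mono[of r "r + h"] r h by simp
  define d where "d = R ^ (N - 1) * g1"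
  define d0 where "d0 = (R / 2) ^ (N - 1) * g0"
  have d: "d > 0" "d0 > 0" using R g1 g0 by (auto simp: d_def d0_def)
  have "h * W r / d \<le> \<phi> (r + h) - \<phi> r" unfolding d_def using r h by (intro W_step_upper) auto
  also have "\<dots> \<le> 8 * C1 / q * (e / \<epsilon>)" using * phi_nonneg[of r] r h by simp
  finally have "W r * h \<le> 8 * C1 / q * (e / \<epsilon>) * d"
    using d by (simp only: pos_divide_le_eq mult.commute[of h])
  then have "W r \<le> 8 * C1 / q * (e / \<epsilon>) * d / h" using h by (simp only: pos_le_divide_eq)
  moreover have "d0 * \<phi>' r \<le> W r" unfolding d0_def using assms r h by (intro W_ge_phi') auto
  ultimately have "d0 * \<phi>' r \<le> 8 * C1 / q * (e / \<epsilon>) * d / h" by simp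
  then have "\<phi>' r \<le> 8 * C1 / q * (e / \<epsilon>) * d / h / d0"
    using d by (subst pos_le_divide_eq) (auto simp: mult.commute)
  also have "\<dots> = 8 * C1 / q * sqrt K * d / d0 * (e / \<epsilon>\<^sup>2)"
    by (simp add: h_def power2_eq_square ac_simps)
  finally show "\<phi>' r \<le> 8 * C1 / q * sqrt K * (R ^ (N - 1) * g1) / ((R / 2) ^ (N - 1) * g0) * (e / \<epsilon>\<^sup>2)"
    unfolding d_def d0_def .
qed

end

context layer_family
begin

lemma outer_region:
  assumes half: "\<forall>\<^sub>F \<epsilon> in at_right 0. R / 2 \<le> r \<epsilon>"
    and far: "filterlim (\<lambda>\<epsilon>. (R - r \<epsilon>) / \<epsilon>) at_top (at_right 0)"
    and decay: "\<And>k. k > 0 \<Longrightarrow> ((\<lambda>\<epsilon>. exp (- (k * ((R - r \<epsilon>) / \<epsilon>))) / \<epsilon>\<^sup>2) \<longlongrightarrow> 0) (at_right 0)"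
  shows "((\<lambda>\<epsilon>. us \<epsilon> - \<phi> \<epsilon> (r \<epsilon>)) \<longlongrightarrow> 0) (at_right 0)"
    and "((\<lambda>\<epsilon>. \<phi>' \<epsilon> (r \<epsilon>)) \<longlongrightarrow> 0) (at_right 0)"
proof -
  define k where "k = ln 2 * sqrt K / 4"
  have k: "k > 0" using K by (simp add: k_def)
  define e where "e \<epsilon> = exp (- (k * ((R - r \<epsilon>) / \<epsilon>)))" for \<epsilon>
  define M where "M = 8 * C1 / q * sqrt K * (R ^ (N - 1) * g1) / ((R / 2) ^ (N - 1) * g0)"
  have e2: "((\<lambda>\<epsilon>. e \<epsilon> / \<epsilon>\<^sup>2) \<longlongrightarrow> 0) (at_right 0)" unfolding e_def using decay[OF k] .
  have "((\<lambda>\<epsilon>. e \<epsilon> / \<epsilon>\<^sup>2 * \<epsilon>) \<longlongrightarrow> 0 * 0) (at_right 0)" by (intro tendsto_intros e2)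
  moreover have "\<forall>\<^sub>F \<epsilon> in at_right 0. e \<epsilon> / \<epsilon>\<^sup>2 * \<epsilon> = e \<epsilon> / \<epsilon>"
    using pos_eventually by eventually_elim (simp add: power2_eq_square)
  ultimately have e1: "((\<lambda>\<epsilon>. e \<epsilon> / \<epsilon>) \<longlongrightarrow> 0) (at_right 0)"
    by (rule tendsto_eventually_eq) simp
  have good: "\<forall>\<^sub>F \<epsilon> in at_right 0. \<epsilon> > 0 \<and> R / 2 \<le> r \<epsilon> \<and> R - r \<epsilon> \<ge> 4 * (\<epsilon> / sqrt K) \<and> R - r \<epsilon> \<ge> \<epsilon>"
    using pos_eventually half filterlim_at_top[THEN iffD1, OF far, rule_format, of "4 / sqrt K"]
      filterlim_at_top[THEN iffD1, OF far, rule_format, of 1]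
    by eventually_elim (simp add: pos_le_divide_eq)
  have "((\<lambda>\<epsilon>. \<phi> \<epsilon> (r \<epsilon>)) \<longlongrightarrow> 0) (at_right 0)"
  proof (rule tendsto_sandwich)
    show "\<forall>\<^sub>F \<epsilon> in at_right 0. 0 \<le> \<phi> \<epsilon> (r \<epsilon>)"
      using good
    proof eventually_elim
      case (elim \<epsilon>)
      then show ?case using R by (intro layer.phi_nonneg[OF layer]) auto
    qed
    show "\<forall>\<^sub>F \<epsilon> in at_right 0. \<phi> \<epsilon> (r \<epsilon>) \<le> 8 * C1 / q * (e \<epsilon> / \<epsilon>)"
      using good
    proof eventually_elim
      case (elim \<epsilon>)
      then show ?case unfolding e_def k_def by (intro layer.interior_decay(1)[OF layer]) auto
    qed
    show "((\<lambda>\<epsilon>. 8 * C1 / q * (e \<epsilon> / \<epsilon>)) \<longlongrightarrow> 0) (at_right 0)"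
      using tendsto_mult_left[OF e1, of "8 * C1 / q"] by simp
  qed simp
  then have "((\<lambda>\<epsilon>. us \<epsilon> - \<phi> \<epsilon> (r \<epsilon>)) \<longlongrightarrow> 0 - 0) (at_right 0)" by (intro tendsto_diff us_tendsto)
  then show "((\<lambda>\<epsilon>. us \<epsilon> - \<phi> \<epsilon> (r \<epsilon>)) \<longlongrightarrow> 0) (at_right 0)" by simp
  show "((\<lambda>\<epsilon>. \<phi>' \<epsilon> (r \<epsilon>)) \<longlongrightarrow> 0) (at_right 0)"
  proof (rule tendsto_sandwich)
    show "\<forall>\<^sub>F \<epsilon> in at_right 0. 0 \<le> \<phi>' \<epsilon> (r \<epsilon>)"
      using good
    proof eventually_elim
      case (elim \<epsilon>)
      then show ?case using R by (intro layer.phi'_nonneg[OF layer]) auto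
    qed
    show "\<forall>\<^sub>F \<epsilon> in at_right 0. \<phi>' \<epsilon> (r \<epsilon>) \<le> M * (e \<epsilon> / \<epsilon>\<^sup>2)"
      using good
    proof eventually_elim
      case (elim \<epsilon>)
      then show ?case unfolding e_def k_def M_def by (intro layer.interior_decay(2)[OF layer]) auto
    qed
    show "((\<lambda>\<epsilon>. M * (e \<epsilon> / \<epsilon>\<^sup>2)) \<longlongrightarrow> 0) (at_right 0)"
      using tendsto_mult_left[OF e2, of M] by simp
  qed simp
qed

end

section \<open>Reduction of the nonlocal problem\<close>

context layer_data
begin

text \<open>Stated for both signs of \<open>x\<close>, since it serves to determine the sign of
  \<phi>.\<close>

lemma F_sign: "F x * x \<ge> 0"
proof (cases "x \<ge> 0")
  case False
  then have "q * x \<le> 0" "0 \<le> - (p * x)" using p q by (auto simp: mult_nonneg_nonpos)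
  then have "exp (q * x) \<le> exp (- (p * x))" by simp
  then have "F x \<le> 0" by (simp add: F_def)
  then show ?thesis using False by (simp add: mult_nonpos_nonpos)
qed (simp add: F_nonneg)

text \<open>Jensen's inequality through the tangent line of \<open>exp\<close> at 0: the linear term
  integrates to zero. It is used with \<open>k\<close> equal to \<open>p\<close> and to
  \<open>- q\<close>.\<close>

lemma weighted_exp_mean_ge:
  assumes "continuous_on {0..R} u" "integral {0..R} (\<lambda>s. s ^ (N - 1) * u s) = 0"
  shows "J \<le> integral {0..R} (\<lambda>s. s ^ (N - 1) * exp (k * u s))"
proof -
  have "((\<lambda>s. s ^ (N - 1) * u s) has_integral 0) {0..R}"
  proof -
    have "(\<lambda>s. s ^ (N - 1) * u s) integrable_on {0..R}"
      by (intro integrable_continuous_real continuous_intros assms(1))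
    from integrable_integral[OF this] show ?thesis unfolding assms(2) .
  qed
  then have "((\<lambda>s. s ^ (N - 1) + k * (s ^ (N - 1) * u s)) has_integral J + k * 0) {0..R}"
    by (intro has_integral_add integral_power_J has_integral_mult_right)
  then have "J = integral {0..R} (\<lambda>s. s ^ (N - 1) + k * (s ^ (N - 1) * u s))"
    by (simp add: integral_unique)
  also have "\<dots> \<le> integral {0..R} (\<lambda>s. s ^ (N - 1) * exp (k * u s))"
  proof (rule integral_le)
    fix s assume "s \<in> {0..R}"
    then have "s ^ (N - 1) * (1 + k * u s) \<le> s ^ (N - 1) * exp (k * u s)"
      by (intro mult_left_mono exp_ge_add_one_self) auto
    then show "s ^ (N - 1) + k * (s ^ (N - 1) * u s) \<le> s ^ (N - 1) * exp (k * u s)"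
      by (simp add: algebra_simps)
  qed (auto intro!: integrable_continuous_real continuous_intros assms)
  finally show ?thesis .
qed

text \<open>Flux times \<phi> vanishes at 0 and has a nonnegative derivative, so \<phi> and
  \<open>\<phi>'\<close> never have opposite signs and \<open>\<phi>\<^sup>2\<close> is
  nondecreasing. The positive slope at \<open>R\<close> then selects the sign.\<close>

lemma shifted_potential_monotone:
  fixes \<phi> \<phi>' :: "real \<Rightarrow> real"
  assumes k: "k > 0"
    and d: "\<And>r. r \<in> {0..R} \<Longrightarrow> (\<phi> has_real_derivative \<phi>' r) (at r within {0..R})"
    and c: "continuous_on {0..R} \<phi>'" and z: "\<phi>' 0 = 0" and R': "\<phi>' R > 0"
    and fl: "\<And>r. r \<in> {0<..<R} \<Longrightarrow> ((\<lambda>r. r ^ (N - 1) * g r * \<phi>' r) has_real_derivative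
          k * r ^ (N - 1) * F (\<phi> r)) (at r)"
    and r: "r \<in> {0..R}"
  shows "\<phi> r \<ge> 0" "\<phi>' r \<ge> 0"
proof -
  define W where "W r = r ^ (N - 1) * g r * \<phi>' r" for r
  have cp: "continuous_on {0..R} \<phi>" by (rule DERIV_continuous_on[OF d])
  have cW: "continuous_on {0..R} W" unfolding W_def by (intro continuous_intros g_cont c)
  have dat: "(\<phi> has_real_derivative \<phi>' x) (at x)" if "0 < x" "x < R" for x
    by (rule has_real_derivative_interior[OF d]) (use that in auto)
  have W0: "W 0 = 0" using N by (simp add: W_def)
  have Wpos: "x ^ (N - 1) * g x > 0" if "0 < x" "x \<le> R" for x
    using that g_ge[of x] g0 by (intro mult_pos_pos) auto
  have WP: "W x * \<phi> x \<ge> 0" if x: "x \<in> {0..R}" for x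
  proof -
    have "W 0 * \<phi> 0 \<le> W x * \<phi> x"
    proof (rule mono_from_deriv[of 0 x "\<lambda>x. W x * \<phi> x"])
      show "continuous_on {0..x} (\<lambda>x. W x * \<phi> x)"
        using x by (intro continuous_intros continuous_on_subset[OF cW] continuous_on_subset[OF cp]) auto
      fix y assume y: "0 < y" "y < x"
      show "((\<lambda>x. W x * \<phi> x) has_real_derivative k * y ^ (N - 1) * F (\<phi> y) * \<phi> y + \<phi>' y * W y) (at y)"
        unfolding W_def using x y by (intro DERIV_mult fl dat) auto
      have "k * y ^ (N - 1) * (F (\<phi> y) * \<phi> y) \<ge> 0"
        using k y by (intro mult_nonneg_nonneg[OF _ F_sign]) auto
      moreover have "\<phi>' y * W y = y ^ (N - 1) * g y * (\<phi>' y)\<^sup>2" by (simp add: W_def power2_eq_square)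
      moreover have "y ^ (N - 1) * g y * (\<phi>' y)\<^sup>2 \<ge> 0" by (rule mult_nonneg_nonneg[OF less_imp_le[OF Wpos]]) (use x y in auto)
      ultimately show "k * y ^ (N - 1) * F (\<phi> y) * \<phi> y + \<phi>' y * W y \<ge> 0"
        by (simp add: mult.assoc)
    qed (use x in simp)
    then show ?thesis by (simp add: W0)
  qed
  have prod: "\<phi>' x * \<phi> x \<ge> 0" if x: "0 < x" "x \<le> R" for x
  proof -
    have "0 \<le> (x ^ (N - 1) * g x) * (\<phi>' x * \<phi> x)"
      using WP[of x] x unfolding W_def by (simp add: mult.assoc)
    then show ?thesis using mult_pos_neg[OF Wpos[OF x]] not_le by blast
  qed
  have sq: "(\<phi> x)\<^sup>2 \<le> (\<phi> y)\<^sup>2" if xy: "0 \<le> x" "x \<le> y" "y \<le> R" for x y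
  proof (rule mono_from_deriv[of x y "\<lambda>x. (\<phi> x)\<^sup>2"])
    show "continuous_on {x..y} (\<lambda>x. (\<phi> x)\<^sup>2)"
      using xy by (intro continuous_intros continuous_on_subset[OF cp]) auto
    fix z assume z: "x < z" "z < y"
    show "((\<lambda>x. (\<phi> x)\<^sup>2) has_real_derivative 2 * (\<phi>' z * \<phi> z)) (at z)"
      using dat[of z] xy z by (auto intro!: derivative_eq_intros)
    show "2 * (\<phi>' z * \<phi> z) \<ge> 0" using prod[of z] xy z by simp
  qed fact
  have PR: "\<phi> R \<ge> 0" using prod[of R] R R' by (simp add: zero_le_mult_iff)
  have P: "\<phi> x \<ge> 0" if x: "x \<in> {0..R}" for x
  proof (rule ccontr)
    assume neg: "\<not> \<phi> x \<ge> 0"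
    \<comment> \<open>A negative value before \<open>R\<close> would force a later zero,
      contradicting that \<open>\<phi>\<^sup>2\<close> cannot decrease.\<close>
    have "\<exists>y. x \<le> y \<and> y \<le> R \<and> \<phi> y = 0"
      using neg PR x by (intro IVT' continuous_on_subset[OF cp]) auto
    then obtain y where y: "x \<le> y" "y \<le> R" "\<phi> y = 0" by blast
    then have "(\<phi> x)\<^sup>2 \<le> 0" using sq[of x y] x by simp
    then show False using neg by simp
  qed
  then show "\<phi> r \<ge> 0" using r by simp
  show "\<phi>' r \<ge> 0"
  \<comment> \<open>At 0 the weight vanishes and the flux says nothing about \<open>\<phi>'\<close>;
    there the symmetry condition is used instead.\<close>
  proof (cases "r = 0")
    case False
    have "W 0 \<le> W r"
    proof (rule mono_from_deriv[of 0 r W])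
      show "continuous_on {0..r} W" using r by (intro continuous_on_subset[OF cW]) auto
      fix y assume y: "0 < y" "y < r"
      show "(W has_real_derivative k * y ^ (N - 1) * F (\<phi> y)) (at y)"
        unfolding W_def using r y by (intro fl) auto
      show "k * y ^ (N - 1) * F (\<phi> y) \<ge> 0"
        using k r y P[of y] by (intro mult_nonneg_nonneg F_nonneg) auto
    qed (use r in simp)
    then have "0 \<le> (r ^ (N - 1) * g r) * \<phi>' r" unfolding W0 unfolding W_def .
    then show ?thesis using mult_pos_neg[OF Wpos[of r], of "\<phi>' r"] r False by (simp add: not_le[symmetric]) (metis not_le)
  qed (simp add: z)
qed

text \<open>The integrals over \<open>U\<close> are treated as unknown numbers, which makes the
  equation local. Only once the sign of \<open>us - U r\<close> is known can it be fed back into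
  those integrals to bound \<open>c\<close> and the mass.\<close>

lemma solution_layer:
  assumes gs: "smooth_on_real {0..R} g" and eps: "\<epsilon> > 0"
    and sol: "solves_Nstar N R g A B p q \<epsilon> U"
  obtains us c U' where "layer N R A B p q g0 g1 g \<epsilon> c (\<lambda>r. us - U r) (\<lambda>r. - U' r)"
    "0 \<le> us" "c \<le> A * exp (p * us)"
    "integral {0..R} (\<lambda>s. s ^ (N - 1) * (us - U s)) = us * J"
    "\<And>r. r \<in> {0<..<R} \<Longrightarrow> deriv U r = U' r"
    "\<And>r. charge_density N R A B p q U r = c * F (us - U r)"
proof -
  have gp: "\<forall>r\<in>{0..R}. g r > 0" using g0 g_ge by (meson less_le_trans)
  obtain U' where cU': "continuous_on {0..R} U'"
    and dU: "\<And>r. r \<in> {0..R} \<Longrightarrow> (U has_real_derivative U' r) (at r within {0..R})"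
    and U'0: "U' 0 = 0" and U'R: "U' R = R * (A - B) / (\<epsilon>\<^sup>2 * real N * g R)"
    and der: "\<And>r. r \<in> {0<..<R} \<Longrightarrow> deriv U r = U' r"
    and fl: "\<And>r. r \<in> {0<..<R} \<Longrightarrow> ((\<lambda>r. r ^ (N-1) * g r * U' r) has_real_derivative
        r ^ (N-1) * rhs_Nstar N R A B p q U r / \<epsilon>\<^sup>2) (at r)"
    by (rule solves_Nstar_flux_form[OF N R gs gp eps sol]) blast
  have cU: "continuous_on {0..R} U" by (rule DERIV_continuous_on[OF dU])
  have mU: "integral {0..R} (\<lambda>s. s ^ (N - 1) * U s) = 0" using sol unfolding solves_Nstar_def by blast
  define Ip where "Ip = integral {0..R} (\<lambda>s. s ^ (N - 1) * exp (p * U s))"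
  define Iq where "Iq = integral {0..R} (\<lambda>s. s ^ (N - 1) * exp (- q * U s))"
  have Ip: "J \<le> Ip" unfolding Ip_def by (rule weighted_exp_mean_ge[OF cU mU])
  have Iq: "J \<le> Iq" unfolding Iq_def by (rule weighted_exp_mean_ge[OF cU mU])
  define a where "a = J * A / Ip"
  define b where "b = J * B / Iq"
  have a: "a > 0" "a \<le> A" using Ip J A by (auto simp: a_def field_simps)
  have b: "b > 0" "b \<le> B" using Iq J A AB by (auto simp: b_def field_simps)
  define us where "us = ln (b / a) / (p + q)"
  define c where "c = a * exp (p * us)"
  have "(p + q) * us = ln (b / a)" using p q by (simp add: us_def)
  then have "exp ((p + q) * us) = b / a" using a b by simp
  then have "exp (p * us) * exp (q * us) = b / a" by (simp add: distrib_right exp_add)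
  then have cb: "c * exp (q * us) = b" using a by (simp add: c_def field_simps)
  have c0: "c > 0" using a by (simp add: c_def)
  have rhs: "rhs_Nstar N R A B p q U r = - (c * F (us - U r))" for r
  proof -
    have "rhs_Nstar N R A B p q U r = a * exp (p * U r) - b * exp (- q * U r)"
      unfolding rhs_Nstar_def a_def b_def Ip_def Iq_def J_def by (simp add: right_diff_distrib ac_simps)
    moreover have "c * exp (- (p * (us - U r))) = a * exp (p * U r)"
      by (simp add: c_def mult.assoc right_diff_distrib flip: exp_add)
    moreover have "c * exp (q * (us - U r)) = b * exp (- q * U r)"
      unfolding cb[symmetric] by (simp add: mult.assoc right_diff_distrib flip: exp_add)
    ultimately show ?thesis by (simp add: F_def right_diff_distrib)
  qed
  have fl': "((\<lambda>r. r ^ (N-1) * g r * - U' r) has_real_derivative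
        c / \<epsilon>\<^sup>2 * r ^ (N - 1) * F (us - U r)) (at r)" if "r \<in> {0<..<R}" for r
    using DERIV_minus[OF fl[OF that]] by (simp add: rhs ac_simps)
  have dp: "((\<lambda>r. us - U r) has_real_derivative - U' r) (at r within {0..R})" if "r \<in> {0..R}" for r
    using dU[OF that] by (auto intro!: derivative_eq_intros)
  have "R * (A - B) = - (R * (B - A))" by algebra
  then have pR: "- U' R = C0 / \<epsilon>\<^sup>2" unfolding U'R C0_def by (simp add: ac_simps)
  have nn: "us - U r \<ge> 0" "- U' r \<ge> 0" if "r \<in> {0..R}" for r
    by (rule shifted_potential_monotone[of "c / \<epsilon>\<^sup>2" "\<lambda>r. us - U r" "\<lambda>r. - U' r"];
        use dp cU' U'0 pR C0 eps c0 fl' that in \<open>auto intro!: continuous_intros simp del: One_nat_def\<close>)+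
  have int: "(\<lambda>s. s ^ (N - 1) * f s) integrable_on {0..R}" if "continuous_on {0..R} f" for f :: "real \<Rightarrow> real"
    using that by (intro integrable_continuous_real continuous_intros)
  have "((\<lambda>s. s ^ (N - 1) * U s) has_integral 0) {0..R}"
    using integrable_integral[OF int[OF cU]] mU by simp
  then have "((\<lambda>s. us * s ^ (N - 1) - s ^ (N - 1) * U s) has_integral us * J - 0) {0..R}"
    by (intro has_integral_diff has_integral_mult_right integral_power_J)
  then have mean: "integral {0..R} (\<lambda>s. s ^ (N - 1) * (us - U s)) = us * J"
    by (intro integral_unique) (simp add: algebra_simps)
  \<comment> \<open>\<open>us\<close> is the weighted mean of the nonnegative function
    \<open>us - U\<close>.\<close>
  have "us * J \<ge> 0" unfolding mean[symmetric] using nn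
    by (intro integral_nonneg int continuous_intros cU) (auto intro!: mult_nonneg_nonneg)
  then have us: "us \<ge> 0" using J by (simp add: zero_le_mult_iff)
  have Jint: "integral {0..R} (\<lambda>s. s ^ (N - 1)) = J" using integral_power_J by (rule integral_unique)
  \<comment> \<open>The bound \<open>U \<le> us\<close> gives
    \<open>Ip \<le> J * exp (p * us)\<close>, which is precisely \<open>A \<le> c\<close>.\<close>
  have "Ip \<le> integral {0..R} (\<lambda>s. s ^ (N - 1) * exp (p * us))"
    unfolding Ip_def using nn(1) p
    by (intro integral_le int continuous_intros cU) (auto intro!: mult_left_mono)
  also have "\<dots> = J * exp (p * us)" using Jint by simp
  finally have "A * Ip \<le> A * (J * exp (p * us))" using A by simp
  then have cA: "A \<le> c" using Ip J by (simp add: c_def a_def field_simps)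
  have "b \<ge> c * 1" unfolding cb[symmetric] using c0 us q by (intro mult_left_mono) auto
  then have cB: "c \<le> B" using b by simp
  have cu: "c \<le> A * exp (p * us)" using a by (simp add: c_def)
  have "integral {0..R} (\<lambda>s. s ^ (N - 1) * exp (q * (us - U s))) = integral {0..R} (\<lambda>s. exp (q * us) * (s ^ (N - 1) * exp (- q * U s)))"
    by (rule arg_cong[where f = "integral {0..R}"]) (auto simp: right_diff_distrib exp_diff exp_minus field_simps)
  also have "\<dots> = exp (q * us) * Iq" by (simp add: Iq_def)
  \<comment> \<open>Since \<open>c * exp (q * us) = b = J * B / Iq\<close>, the unknown
    \<open>Iq\<close> cancels.\<close>
  also have "\<dots> = B * J / c" using cb b c0 Iq J by (simp add: b_def field_simps)
  also have "\<dots> \<le> B * J / A" using cA A AB J by (intro divide_left_mono mult_nonneg_nonneg) auto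
  finally have mass: "integral {0..R} (\<lambda>s. s ^ (N - 1) * exp (q * (us - U s))) \<le> B * J / A" .
  have "layer N R A B p q g0 g1 g \<epsilon> c (\<lambda>r. us - U r) (\<lambda>r. - U' r)"
    by unfold_locales (use eps cA cB dp cU' nn fl' pR mass in \<open>auto intro!: continuous_intros simp del: One_nat_def\<close>)
  then show ?thesis
    by (rule that[OF _ us cu mean der]) (simp_all add: charge_density_def rhs)
qed

end

section \<open>Iterated logarithms\<close>

lemma ln_iterate_at_top: "filterlim ((ln :: real \<Rightarrow> real) ^^ n) at_top at_top"
proof (induction n)
  case 0
  then show ?case by (simp add: filterlim_ident)
next
  case (Suc n)
  then show ?case using filterlim_compose[OF ln_at_top Suc] by (simp add: o_def)
qed

lemma ln_iterate_le: "\<forall>\<^sub>F y in at_top. ((ln :: real \<Rightarrow> real) ^^ n) y \<le> y"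
proof (induction n)
  case (Suc n)
  have "\<forall>\<^sub>F y in at_top. ((ln :: real \<Rightarrow> real) ^^ n) y > 0"
    using filterlim_at_top_dense[THEN iffD1, OF ln_iterate_at_top] by blast
  with Suc show ?case
  proof eventually_elim
    case (elim y)
    then show ?case using ln_bound[of "((ln :: real \<Rightarrow> real) ^^ n) y"] by simp
  qed
qed simp

text \<open>Peeling off the innermost logarithm reduces every iterate to the comparison of
  \<open>ln y\<close> with \<open>y\<close>.\<close>

lemma ln_iterate_over_self:
  assumes "n \<ge> 1"
  shows "((\<lambda>y. ((ln :: real \<Rightarrow> real) ^^ n) y / y) \<longlongrightarrow> 0) at_top"
proof (rule tendsto_sandwich)
  obtain m where m: "n = Suc m" using assms by (cases n) auto
  have "\<forall>\<^sub>F y in at_top. ((ln :: real \<Rightarrow> real) ^^ n) y > 0"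
    using filterlim_at_top_dense[THEN iffD1, OF ln_iterate_at_top] by blast
  then show "\<forall>\<^sub>F y in at_top. 0 \<le> ((ln :: real \<Rightarrow> real) ^^ n) y / y"
    using eventually_gt_at_top[of 0] by eventually_elim simp
  have "\<forall>\<^sub>F y in at_top. ((ln :: real \<Rightarrow> real) ^^ m) (ln y) \<le> ln y"
    using ln_at_top ln_iterate_le[of m] by (rule eventually_compose_filterlim[rotated])
  then show "\<forall>\<^sub>F y in at_top. ((ln :: real \<Rightarrow> real) ^^ n) y / y \<le> ln y / y"
    using eventually_gt_at_top[of 0]
    by eventually_elim (simp add: m funpow_swap1 divide_right_mono)
  show "((\<lambda>y::real. ln y / y) \<longlongrightarrow> 0) at_top" by real_asymp
qed simp

section \<open>Transfer of the limits to the solutions \<open>U\<close>\<close>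

context layer_data
begin

context
  fixes U :: "real \<Rightarrow> real \<Rightarrow> real"
  assumes gs: "smooth_on_real {0..R} g"
    and sol: "\<forall>\<epsilon>>0. solves_Nstar N R g A B p q \<epsilon> (U \<epsilon>)"
begin

text \<open>A choice made separately for each \<epsilon> suffices, since all constants in the
  estimates belong to \<open>layer_data\<close> and are independent of \<epsilon>.\<close>

lemma family_of_solutions:
  obtains us c \<phi> \<phi>' where "layer_family N R A B p q g0 g1 g us c \<phi> \<phi>'"
    "\<And>\<epsilon> r. \<epsilon> > 0 \<Longrightarrow> us \<epsilon> - \<phi> \<epsilon> r = U \<epsilon> r"
    "\<And>\<epsilon> r. \<epsilon> > 0 \<Longrightarrow> r \<in> {0<..<R} \<Longrightarrow> - \<phi>' \<epsilon> r = deriv (U \<epsilon>) r"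
    "\<And>\<epsilon> r. \<epsilon> > 0 \<Longrightarrow> charge_density N R A B p q (U \<epsilon>) r = c \<epsilon> * F (\<phi> \<epsilon> r)"
proof -
  define good where "good \<epsilon> us c U' \<longleftrightarrow>
    layer N R A B p q g0 g1 g \<epsilon> c (\<lambda>r. us - U \<epsilon> r) (\<lambda>r. - U' r) \<and>
    0 \<le> us \<and> c \<le> A * exp (p * us) \<and>
    integral {0..R} (\<lambda>s. s ^ (N - 1) * (us - U \<epsilon> s)) = us * J \<and>
    (\<forall>r\<in>{0<..<R}. deriv (U \<epsilon>) r = U' r) \<and>
    (\<forall>r. charge_density N R A B p q (U \<epsilon>) r = c * F (us - U \<epsilon> r))" for \<epsilon> us c and U' :: "real \<Rightarrow> real"
  have "\<exists>us c U'. \<epsilon> > 0 \<longrightarrow> good \<epsilon> us c U'" for \<epsilon>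
  proof (cases "\<epsilon> > 0")
    case True
    show ?thesis
      by (rule solution_layer[OF gs True sol[rule_format, OF True]]) (auto simp: good_def)
  qed simp
  then obtain us c U' where "\<And>\<epsilon>. \<epsilon> > 0 \<Longrightarrow> good \<epsilon> (us \<epsilon>) (c \<epsilon>) (U' \<epsilon>)" by metis
  note * = this[unfolded good_def]
  show ?thesis
  proof (rule that)
    show "layer_family N R A B p q g0 g1 g us c (\<lambda>\<epsilon> r. us \<epsilon> - U \<epsilon> r) (\<lambda>\<epsilon> r. - U' \<epsilon> r)"
      by (rule layer_family.intro[OF layer_data_axioms layer_family_axioms.intro]) (use * in blast)+
  qed (use * in auto)
qed

lemma intermediate_solution:
  assumes r: "\<forall>\<^sub>F \<epsilon> in at_right 0. r \<epsilon> \<in> {0<..<R}"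
    and close: "((\<lambda>\<epsilon>. (R - r \<epsilon>) / \<epsilon>) \<longlongrightarrow> 0) (at_right 0)"
    and far: "filterlim (\<lambda>\<epsilon>. (R - r \<epsilon>) / \<epsilon>\<^sup>2) at_top (at_right 0)"
  shows "((\<lambda>\<epsilon>. U \<epsilon> (r \<epsilon>) - 2 / q * ln (sqrt (q * A / (2 * g R)) * ((R - r \<epsilon>) / \<epsilon>))) \<longlongrightarrow> 0) (at_right 0)"
    and "((\<lambda>\<epsilon>. deriv (U \<epsilon>) (r \<epsilon>) / (- 2 / (q * (R - r \<epsilon>)))) \<longlongrightarrow> 1) (at_right 0)"
    and "((\<lambda>\<epsilon>. charge_density N R A B p q (U \<epsilon>) (r \<epsilon>) / (2 * g R / q * (\<epsilon> / (R - r \<epsilon>))\<^sup>2)) \<longlongrightarrow> 1) (at_right 0)"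
proof -
  obtain us c \<phi> \<phi>' where fam: "layer_family N R A B p q g0 g1 g us c \<phi> \<phi>'"
    and *: "\<And>\<epsilon> r. \<epsilon> > 0 \<Longrightarrow> us \<epsilon> - \<phi> \<epsilon> r = U \<epsilon> r"
    "\<And>\<epsilon> r. \<epsilon> > 0 \<Longrightarrow> r \<in> {0<..<R} \<Longrightarrow> - \<phi>' \<epsilon> r = deriv (U \<epsilon>) r"
    "\<And>\<epsilon> r. \<epsilon> > 0 \<Longrightarrow> charge_density N R A B p q (U \<epsilon>) r = c \<epsilon> * F (\<phi> \<epsilon> r)"
    using family_of_solutions by blast
  have le: "\<forall>\<^sub>F \<epsilon> in at_right 0. r \<epsilon> \<le> R" using r by eventually_elim auto
  have ev: "\<forall>\<^sub>F \<epsilon> in at_right 0. \<epsilon> > 0 \<and> r \<epsilon> \<in> {0<..<R}"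
    using r eventually_at_right_less[of 0] by eventually_elim auto
  note asy = layer_family.intermediate_layer[OF fam close le far, unfolded layer_family.\<sigma>_def[OF fam]]
  show "((\<lambda>\<epsilon>. U \<epsilon> (r \<epsilon>) - 2 / q * ln (sqrt (q * A / (2 * g R)) * ((R - r \<epsilon>) / \<epsilon>))) \<longlongrightarrow> 0) (at_right 0)"
    by (rule tendsto_eventually_eq[OF asy(1) eventually_mono[OF ev]]) (auto simp: *)
  show "((\<lambda>\<epsilon>. deriv (U \<epsilon>) (r \<epsilon>) / (- 2 / (q * (R - r \<epsilon>)))) \<longlongrightarrow> 1) (at_right 0)"
    by (rule tendsto_eventually_eq[OF asy(2) eventually_mono[OF ev]]) (auto simp: *[symmetric])
  show "((\<lambda>\<epsilon>. charge_density N R A B p q (U \<epsilon>) (r \<epsilon>) / (2 * g R / q * (\<epsilon> / (R - r \<epsilon>))\<^sup>2)) \<longlongrightarrow> 1) (at_right 0)"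
    by (rule tendsto_eventually_eq[OF asy(3) eventually_mono[OF ev]]) (auto simp: *)
qed

lemma inner_solution:
  assumes r: "\<forall>\<^sub>F \<epsilon> in at_right 0. r \<epsilon> \<in> {0<..<R}"
    and near: "((\<lambda>\<epsilon>. (R - r \<epsilon>) / \<epsilon>\<^sup>2) \<longlongrightarrow> 0) (at_right 0)"
  shows "((\<lambda>\<epsilon>. U \<epsilon> (r \<epsilon>) - 2 / q * ln (2 * sqrt (q * A / (2 * g R)) / (q * C0) * \<epsilon>)) \<longlongrightarrow> 0) (at_right 0)"
    and "((\<lambda>\<epsilon>. deriv (U \<epsilon>) (r \<epsilon>) / (- C0 / \<epsilon>\<^sup>2)) \<longlongrightarrow> 1) (at_right 0)"
    and "((\<lambda>\<epsilon>. charge_density N R A B p q (U \<epsilon>) (r \<epsilon>) / (q * g R * C0\<^sup>2 / (2 * \<epsilon>\<^sup>2))) \<longlongrightarrow> 1) (at_right 0)"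
proof -
  obtain us c \<phi> \<phi>' where fam: "layer_family N R A B p q g0 g1 g us c \<phi> \<phi>'"
    and *: "\<And>\<epsilon> r. \<epsilon> > 0 \<Longrightarrow> us \<epsilon> - \<phi> \<epsilon> r = U \<epsilon> r"
    "\<And>\<epsilon> r. \<epsilon> > 0 \<Longrightarrow> r \<in> {0<..<R} \<Longrightarrow> - \<phi>' \<epsilon> r = deriv (U \<epsilon>) r"
    "\<And>\<epsilon> r. \<epsilon> > 0 \<Longrightarrow> charge_density N R A B p q (U \<epsilon>) r = c \<epsilon> * F (\<phi> \<epsilon> r)"
    using family_of_solutions by blast
  have le: "\<forall>\<^sub>F \<epsilon> in at_right 0. r \<epsilon> \<le> R" using r by eventually_elim auto
  have ev: "\<forall>\<^sub>F \<epsilon> in at_right 0. \<epsilon> > 0 \<and> r \<epsilon> \<in> {0<..<R}"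
    using r eventually_at_right_less[of 0] by eventually_elim auto
  have "((\<lambda>\<epsilon>. (R - r \<epsilon>) / \<epsilon>\<^sup>2 * \<epsilon>) \<longlongrightarrow> 0 * 0) (at_right 0)" by (intro tendsto_intros near)
  then have close: "((\<lambda>\<epsilon>. (R - r \<epsilon>) / \<epsilon>) \<longlongrightarrow> 0) (at_right 0)"
    by (rule tendsto_eventually_eq[OF _ eventually_mono[OF ev]]) (auto simp: power2_eq_square)
  note asy = layer_family.inner_layer[OF fam close le near, unfolded layer_family.\<sigma>_def[OF fam]]
  show "((\<lambda>\<epsilon>. U \<epsilon> (r \<epsilon>) - 2 / q * ln (2 * sqrt (q * A / (2 * g R)) / (q * C0) * \<epsilon>)) \<longlongrightarrow> 0) (at_right 0)"
    by (rule tendsto_eventually_eq[OF asy(1) eventually_mono[OF ev]]) (auto simp: *)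
  show "((\<lambda>\<epsilon>. deriv (U \<epsilon>) (r \<epsilon>) / (- C0 / \<epsilon>\<^sup>2)) \<longlongrightarrow> 1) (at_right 0)"
    by (rule tendsto_eventually_eq[OF asy(2) eventually_mono[OF ev]]) (auto simp: *[symmetric])
  show "((\<lambda>\<epsilon>. charge_density N R A B p q (U \<epsilon>) (r \<epsilon>) / (q * g R * C0\<^sup>2 / (2 * \<epsilon>\<^sup>2))) \<longlongrightarrow> 1) (at_right 0)"
    by (rule tendsto_eventually_eq[OF asy(3) eventually_mono[OF ev]]) (auto simp: *)
qed

lemma outer_solution:
  assumes r: "\<forall>\<^sub>F \<epsilon> in at_right 0. R / 2 \<le> r \<epsilon>" "\<forall>\<^sub>F \<epsilon> in at_right 0. r \<epsilon> < R"
    and far: "filterlim (\<lambda>\<epsilon>. (R - r \<epsilon>) / \<epsilon>) at_top (at_right 0)"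
    and decay: "\<And>k. k > 0 \<Longrightarrow> ((\<lambda>\<epsilon>. exp (- (k * ((R - r \<epsilon>) / \<epsilon>))) / \<epsilon>\<^sup>2) \<longlongrightarrow> 0) (at_right 0)"
  shows "((\<lambda>\<epsilon>. U \<epsilon> (r \<epsilon>)) \<longlongrightarrow> 0) (at_right 0)"
    and "((\<lambda>\<epsilon>. deriv (U \<epsilon>) (r \<epsilon>)) \<longlongrightarrow> 0) (at_right 0)"
proof -
  obtain us c \<phi> \<phi>' where fam: "layer_family N R A B p q g0 g1 g us c \<phi> \<phi>'"
    and *: "\<And>\<epsilon> r. \<epsilon> > 0 \<Longrightarrow> us \<epsilon> - \<phi> \<epsilon> r = U \<epsilon> r"
    "\<And>\<epsilon> r. \<epsilon> > 0 \<Longrightarrow> r \<in> {0<..<R} \<Longrightarrow> - \<phi>' \<epsilon> r = deriv (U \<epsilon>) r"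
    "\<And>\<epsilon> r. \<epsilon> > 0 \<Longrightarrow> charge_density N R A B p q (U \<epsilon>) r = c \<epsilon> * F (\<phi> \<epsilon> r)"
    using family_of_solutions by blast
  have ev: "\<forall>\<^sub>F \<epsilon> in at_right 0. \<epsilon> > 0 \<and> r \<epsilon> \<in> {0<..<R}"
    using r eventually_at_right_less[of 0] by eventually_elim (use R in auto)
  note asy = layer_family.outer_region[OF fam r(1) far decay]
  show "((\<lambda>\<epsilon>. U \<epsilon> (r \<epsilon>)) \<longlongrightarrow> 0) (at_right 0)"
    by (rule tendsto_eventually_eq[OF asy(1) eventually_mono[OF ev]]) (auto simp: *)
  have "((\<lambda>\<epsilon>. - \<phi>' \<epsilon> (r \<epsilon>)) \<longlongrightarrow> - 0) (at_right 0)" by (intro tendsto_minus asy(2)) auto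
  then show "((\<lambda>\<epsilon>. deriv (U \<epsilon>) (r \<epsilon>)) \<longlongrightarrow> 0) (at_right 0)"
    by (rule tendsto_eventually_eq[OF _ eventually_mono[OF ev]]) (auto simp: *[symmetric])
qed

text \<open>The distance divided by \<epsilon> is
  \<open>exp (- ((\<beta> \<epsilon> - 1) * ln (1 / \<epsilon>)))\<close>. Hence \<open>top\<close>
  puts the point closer to \<open>R\<close> than order \<epsilon>, while \<open>b1\<close> keeps it
  much farther than order \<open>\<epsilon>\<^sup>2\<close>: the intermediate regime.\<close>

lemma power_position:
  fixes \<beta> :: "real \<Rightarrow> real"
  assumes b1: "(\<beta> \<longlongrightarrow> 1) (at_right 0)"
    and top: "filterlim (\<lambda>\<epsilon>. (\<beta> \<epsilon> - 1) * ln (1 / \<epsilon>)) at_top (at_right 0)"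
  shows "((\<lambda>\<epsilon>. U \<epsilon> (R - \<epsilon> powr \<beta> \<epsilon>) - (- (2 / q) * ((\<beta> \<epsilon> - 1) * ln (1 / \<epsilon>)) + 1 / q * ln (q * A / (2 * g R)))) \<longlongrightarrow> 0) (at_right 0)"
    and "((\<lambda>\<epsilon>. deriv (U \<epsilon>) (R - \<epsilon> powr \<beta> \<epsilon>) / (- (2 / q) * \<epsilon> powr (- \<beta> \<epsilon>))) \<longlongrightarrow> 1) (at_right 0)"
    and "((\<lambda>\<epsilon>. charge_density N R A B p q (U \<epsilon>) (R - \<epsilon> powr \<beta> \<epsilon>) /
        (2 * g R / q * \<epsilon> powr (- 2 * (\<beta> \<epsilon> - 1)))) \<longlongrightarrow> 1) (at_right 0)"
proof -
  note pos = eventually_at_right_less[of "0::real"]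
  have c: "((\<lambda>\<epsilon>. exp (- ((\<beta> \<epsilon> - 1) * ln (1 / \<epsilon>)))) \<longlongrightarrow> 0) (at_right 0)"
    by (rule filterlim_compose[OF exp_at_bot filterlim_compose[OF filterlim_uminus_at_bot_at_top top]])
  have D1: "\<epsilon> powr \<beta> \<epsilon> / \<epsilon> = exp (- ((\<beta> \<epsilon> - 1) * ln (1 / \<epsilon>)))" if "\<epsilon> > 0" for \<epsilon>
  proof -
    have "exp (- ((\<beta> \<epsilon> - 1) * ln (1 / \<epsilon>))) = exp (\<beta> \<epsilon> * ln \<epsilon> - ln \<epsilon>)"
      using that by (simp add: ln_div algebra_simps)
    then show ?thesis using that by (simp add: exp_diff powr_def)
  qed
  have "\<forall>\<^sub>F \<epsilon> in at_right 0. exp (- ((\<beta> \<epsilon> - 1) * ln (1 / \<epsilon>))) = (R - (R - \<epsilon> powr \<beta> \<epsilon>)) / \<epsilon>"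
    using pos by eventually_elim (simp add: D1)
  with c have close: "((\<lambda>\<epsilon>. (R - (R - \<epsilon> powr \<beta> \<epsilon>)) / \<epsilon>) \<longlongrightarrow> 0) (at_right 0)"
    by (rule tendsto_eventually_eq) simp
  have "((\<lambda>\<epsilon>. (R - (R - \<epsilon> powr \<beta> \<epsilon>)) / \<epsilon> * \<epsilon>) \<longlongrightarrow> 0 * 0) (at_right 0)" by (intro tendsto_intros close)
  moreover have "\<forall>\<^sub>F \<epsilon> in at_right 0. (R - (R - \<epsilon> powr \<beta> \<epsilon>)) / \<epsilon> * \<epsilon> = \<epsilon> powr \<beta> \<epsilon>"
    using pos by eventually_elim simp
  ultimately have "((\<lambda>\<epsilon>. \<epsilon> powr \<beta> \<epsilon>) \<longlongrightarrow> 0) (at_right 0)" by (rule tendsto_eventually_eq) simp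
  then have "\<forall>\<^sub>F \<epsilon> in at_right 0. \<epsilon> powr \<beta> \<epsilon> < R" using R by (rule order_tendstoD)
  then have r: "\<forall>\<^sub>F \<epsilon> in at_right 0. R - \<epsilon> powr \<beta> \<epsilon> \<in> {0<..<R}"
    using pos by eventually_elim auto
  \<comment> \<open>Any exponent strictly between 1 and 2 would serve; 3/2 leaves \<epsilon> to the
    power -1/2 as a diverging lower bound.\<close>
  have "\<forall>\<^sub>F \<epsilon> in at_right 0. \<beta> \<epsilon> < 3 / 2" using b1 by (rule order_tendstoD) simp
  moreover have "\<forall>\<^sub>F \<epsilon>::real in at_right 0. \<epsilon> < 1"
    by (rule eventually_at_rightI[of 0 1]) auto
  ultimately have ge: "\<forall>\<^sub>F \<epsilon> in at_right 0. \<epsilon> powr (-(1 / 2)) \<le> (R - (R - \<epsilon> powr \<beta> \<epsilon>)) / \<epsilon>\<^sup>2"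
    using pos
  proof eventually_elim
    case (elim \<epsilon>)
    have "\<epsilon> powr (-(1 / 2)) = \<epsilon> powr (3 / 2) / \<epsilon> powr 2" by (simp flip: powr_diff)
    also have "\<dots> \<le> \<epsilon> powr \<beta> \<epsilon> / \<epsilon> powr 2" using elim by (intro divide_right_mono powr_mono') auto
    finally show ?case using elim by simp
  qed
  have "filterlim (\<lambda>\<epsilon>::real. \<epsilon> powr (-(1 / 2))) at_top (at_right 0)" by real_asymp
  then have far: "filterlim (\<lambda>\<epsilon>. (R - (R - \<epsilon> powr \<beta> \<epsilon>)) / \<epsilon>\<^sup>2) at_top (at_right 0)"
    using ge by (rule filterlim_at_top_mono)
  note asy = intermediate_solution[OF r close far]
  define z where "z = q * A / (2 * g R)"
  have z: "z > 0" using q A gR by (simp add: z_def)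
  show "((\<lambda>\<epsilon>. U \<epsilon> (R - \<epsilon> powr \<beta> \<epsilon>) - (- (2 / q) * ((\<beta> \<epsilon> - 1) * ln (1 / \<epsilon>)) + 1 / q * ln (q * A / (2 * g R)))) \<longlongrightarrow> 0) (at_right 0)"
  proof (rule tendsto_eventually_eq[OF asy(1) eventually_mono[OF pos]])
    fix \<epsilon> :: real assume e: "0 < \<epsilon>"
    define h where "h = (\<beta> \<epsilon> - 1) * ln (1 / \<epsilon>)"
    have "(R - (R - \<epsilon> powr \<beta> \<epsilon>)) / \<epsilon> = exp (- h)" using D1[OF e] by (simp add: h_def)
    then have "ln (sqrt z * ((R - (R - \<epsilon> powr \<beta> \<epsilon>)) / \<epsilon>)) = ln z / 2 - h"
      using z by (simp only: ln_mult_pos real_sqrt_gt_zero exp_gt_zero ln_sqrt ln_exp)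
    moreover have "2 / q * (ln z / 2 - h) = - (2 / q) * h + 1 / q * ln z"
      by (simp add: algebra_simps)
    ultimately have "2 / q * ln (sqrt z * ((R - (R - \<epsilon> powr \<beta> \<epsilon>)) / \<epsilon>)) = - (2 / q) * h + 1 / q * ln z"
      by (simp only:)
    then show "U \<epsilon> (R - \<epsilon> powr \<beta> \<epsilon>) - 2 / q * ln (sqrt (q * A / (2 * g R)) * ((R - (R - \<epsilon> powr \<beta> \<epsilon>)) / \<epsilon>))
      = U \<epsilon> (R - \<epsilon> powr \<beta> \<epsilon>) - (- (2 / q) * ((\<beta> \<epsilon> - 1) * ln (1 / \<epsilon>)) + 1 / q * ln (q * A / (2 * g R)))"
      unfolding z_def h_def by (simp only:)
  qed simp
  show "((\<lambda>\<epsilon>. deriv (U \<epsilon>) (R - \<epsilon> powr \<beta> \<epsilon>) / (- (2 / q) * \<epsilon> powr (- \<beta> \<epsilon>))) \<longlongrightarrow> 1) (at_right 0)"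
  proof -
    have "- 2 / (q * (R - (R - \<epsilon> powr \<beta> \<epsilon>))) = - (2 / q) * \<epsilon> powr (- \<beta> \<epsilon>)" for \<epsilon>
      by (simp add: powr_minus_divide)
    with asy(2) show ?thesis by (simp only:)
  qed
  show "((\<lambda>\<epsilon>. charge_density N R A B p q (U \<epsilon>) (R - \<epsilon> powr \<beta> \<epsilon>) /
        (2 * g R / q * \<epsilon> powr (- 2 * (\<beta> \<epsilon> - 1)))) \<longlongrightarrow> 1) (at_right 0)"
  proof (rule tendsto_eventually_eq[OF asy(3) eventually_mono[OF pos]])
    fix \<epsilon> :: real assume e: "0 < \<epsilon>"
    have "\<epsilon> / \<epsilon> powr \<beta> \<epsilon> = \<epsilon> powr (1 - \<beta> \<epsilon>)" using e by (simp add: powr_diff)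
    then have "(\<epsilon> / (R - (R - \<epsilon> powr \<beta> \<epsilon>)))\<^sup>2 = \<epsilon> powr (- 2 * (\<beta> \<epsilon> - 1))"
      using e by (simp add: power2_eq_square algebra_simps flip: powr_add)
    then show "charge_density N R A B p q (U \<epsilon>) (R - \<epsilon> powr \<beta> \<epsilon>) / (2 * g R / q * (\<epsilon> / (R - (R - \<epsilon> powr \<beta> \<epsilon>)))\<^sup>2)
      = charge_density N R A B p q (U \<epsilon>) (R - \<epsilon> powr \<beta> \<epsilon>) / (2 * g R / q * \<epsilon> powr (- 2 * (\<beta> \<epsilon> - 1)))"
      by simp
  qed simp
qed

end

end

lemma eventually_power_position:
  fixes \<beta> :: "real \<Rightarrow> real"
  assumes "(\<beta> \<longlongrightarrow> 1) (at_right 0)" "\<kappa>0 < 1" "1 < \<beta>0"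
  shows "\<forall>\<^sub>F \<epsilon> in at_right 0. R - \<epsilon> powr \<beta> \<epsilon> \<in> {R - \<epsilon> powr \<kappa>0 .. R - \<epsilon> powr \<beta>0}"
proof -
  have "\<forall>\<^sub>F \<epsilon> in at_right 0. \<kappa>0 < \<beta> \<epsilon>" "\<forall>\<^sub>F \<epsilon> in at_right 0. \<beta> \<epsilon> < \<beta>0"
    using assms order_tendstoD by blast+
  moreover have "\<forall>\<^sub>F \<epsilon>::real in at_right 0. 0 < \<epsilon> \<and> \<epsilon> < 1"
    by (rule eventually_at_rightI[of 0 1]) auto
  ultimately show ?thesis by eventually_elim (auto intro!: powr_mono')
qed

section \<open>The asymptotic expansions\<close>

theorem theorem5p2:
  fixes N :: nat and R A B p q :: real and g :: "real \<Rightarrow> real"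
    and U :: "real \<Rightarrow> real \<Rightarrow> real"
  assumes N: "N \<ge> 2" and R: "R > 0"
    and g_smooth: "smooth_on_real {0..R} g" and g_pos: "\<forall>r\<in>{0..R}. g r > 0"
    and A: "0 < A" and AB: "A < B" and p: "p > 0" and q: "q > 0"
    and sol: "\<forall>\<epsilon>>0. solves_Nstar N R g A B p q \<epsilon> (U \<epsilon>)"
  shows
   \<comment> \<open>Part (I)\<close>
   "((\<forall>(r :: real \<Rightarrow> real) (\<beta>0 :: real).
      ((\<forall>\<epsilon>>0. r \<epsilon> \<in> {0<..<R}) \<and> \<beta>0 > 1 \<and>
       (\<forall>\<beta>'\<in>{1<..<\<beta>0}. ((\<lambda>\<epsilon>. (R - r \<epsilon>) / \<epsilon> powr \<beta>') \<longlongrightarrow> 0) (at_right 0)) \<and>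
       (\<forall>\<beta>''>\<beta>0. filterlim (\<lambda>\<epsilon>. (R - r \<epsilon>) / \<epsilon> powr \<beta>'') at_top (at_right 0)) \<and>
       (((\<lambda>\<epsilon>. (R - r \<epsilon>) / \<epsilon> powr \<beta>0) \<longlongrightarrow> 0) (at_right 0) \<or>
        filterlim (\<lambda>\<epsilon>. (R - r \<epsilon>) / \<epsilon> powr \<beta>0) at_top (at_right 0)))
      \<longrightarrow>
      ((\<beta>0 < 2 \<or> (\<beta>0 = 2 \<and> filterlim (\<lambda>\<epsilon>. (R - r \<epsilon>) / \<epsilon> powr 2) at_top (at_right 0))) \<longrightarrow>
         ((\<lambda>\<epsilon>. U \<epsilon> (r \<epsilon>) -
            (- (2 / q) * (\<beta>0 - 1) * ln (1 / \<epsilon>) + (2 / q) * ln ((R - r \<epsilon>) / \<epsilon> powr \<beta>0)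
             + (2 / q) * ln (sqrt (q * A / (2 * g R))))) \<longlongrightarrow> 0) (at_right 0) \<and>
         ((\<lambda>\<epsilon>. deriv (U \<epsilon>) (r \<epsilon>) / (- 2 / (q * (R - r \<epsilon>)))) \<longlongrightarrow> 1) (at_right 0) \<and>
         ((\<lambda>\<epsilon>. charge_density N R A B p q (U \<epsilon>) (r \<epsilon>) /
                 ((2 * g R / q) * (\<epsilon> / (R - r \<epsilon>))\<^sup>2)) \<longlongrightarrow> 1) (at_right 0))
      \<and>
      ((\<beta>0 > 2 \<or> (\<beta>0 = 2 \<and> ((\<lambda>\<epsilon>. (R - r \<epsilon>) / \<epsilon> powr 2) \<longlongrightarrow> 0) (at_right 0))) \<longrightarrow>
         ((\<lambda>\<epsilon>. U \<epsilon> (r \<epsilon>) -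
            (- (2 / q) * ln (1 / \<epsilon>)
             + (2 / q) * ln (sqrt (A / (2 * q * g R)) * (2 * real N * g R / (R * (B - A))))))
            \<longlongrightarrow> 0) (at_right 0) \<and>
         ((\<lambda>\<epsilon>. deriv (U \<epsilon>) (r \<epsilon>) / (- (R * (B - A) / (real N * g R)) * \<epsilon> powr (-2)))
            \<longlongrightarrow> 1) (at_right 0) \<and>
         ((\<lambda>\<epsilon>. charge_density N R A B p q (U \<epsilon>) (r \<epsilon>) /
                 (q * R\<^sup>2 * (B - A)\<^sup>2 / (2 * (real N)\<^sup>2 * g R) * \<epsilon> powr (-2))) \<longlongrightarrow> 1) (at_right 0))))
   \<and>
   (\<forall>(\<Theta> :: real) (\<gamma> :: real) (\<tau> :: real) (n :: nat).
      (0 < \<Theta> \<and> \<Theta> < 1 \<and> \<gamma> > 0 \<and> n \<ge> 2) \<longrightarrow>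
      (let \<kappa>e = (\<lambda>\<epsilon>::real. 1 - ln (1 / \<epsilon>) powr (- \<Theta>));
           \<beta>1 = (\<lambda>\<epsilon>::real. 1 + \<gamma> * ln (1 / \<epsilon>) powr (- \<Theta>));
           \<beta>2 = (\<lambda>\<epsilon>::real. 1 + (ln (1 / \<epsilon>)) powr (-1) * (\<gamma> * (ln ^^ n) (1 / \<epsilon>) + \<tau>))
       in
        (\<forall>\<kappa> \<beta>. 0 < \<kappa> \<and> \<kappa> < 1 \<and> \<beta> > 1 \<longrightarrow>
           (\<forall>\<^sub>F \<epsilon> in at_right 0.
              R - \<epsilon> powr \<kappa>e \<epsilon> \<in> {R - \<epsilon> powr \<kappa> .. R - \<epsilon> powr \<beta>} \<and>
              R - \<epsilon> powr \<beta>1 \<epsilon> \<in> {R - \<epsilon> powr \<kappa> .. R - \<epsilon> powr \<beta>} \<and>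
              R - \<epsilon> powr \<beta>2 \<epsilon> \<in> {R - \<epsilon> powr \<kappa> .. R - \<epsilon> powr \<beta>})) \<and>
        ((\<lambda>\<epsilon>. \<bar>U \<epsilon> (R - \<epsilon> powr \<kappa>e \<epsilon>)\<bar>) \<longlongrightarrow> 0) (at_right 0) \<and>
        ((\<lambda>\<epsilon>. \<bar>deriv (U \<epsilon>) (R - \<epsilon> powr \<kappa>e \<epsilon>)\<bar>) \<longlongrightarrow> 0) (at_right 0) \<and>
        ((\<lambda>\<epsilon>. U \<epsilon> (R - \<epsilon> powr \<beta>1 \<epsilon>) -
            (- (2 * \<gamma> / q) * ln (1 / \<epsilon>) powr (1 - \<Theta>) + (1 / q) * ln (q * A / (2 * g R))))
           \<longlongrightarrow> 0) (at_right 0) \<and>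
        ((\<lambda>\<epsilon>. U \<epsilon> (R - \<epsilon> powr \<beta>2 \<epsilon>) -
            (- (2 * \<gamma> / q) * (ln ^^ n) (1 / \<epsilon>) + (1 / q) * (- 2 * \<tau> + ln (q * A / (2 * g R)))))
           \<longlongrightarrow> 0) (at_right 0) \<and>
        ((\<lambda>\<epsilon>. deriv (U \<epsilon>) (R - \<epsilon> powr \<beta>1 \<epsilon>) / (- (2 / q) * \<epsilon> powr (- \<beta>1 \<epsilon>)))
           \<longlongrightarrow> 1) (at_right 0) \<and>
        ((\<lambda>\<epsilon>. charge_density N R A B p q (U \<epsilon>) (R - \<epsilon> powr \<beta>1 \<epsilon>) /
                ((2 * g R / q) * \<epsilon> powr (- 2 * (\<beta>1 \<epsilon> - 1)))) \<longlongrightarrow> 1) (at_right 0) \<and>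
        ((n = 2 \<and> \<gamma> > 2) \<longrightarrow>
          ((\<lambda>\<epsilon>. deriv (U \<epsilon>) (R - \<epsilon> powr \<beta>2 \<epsilon>) / (- (2 / q) * \<epsilon> powr (- \<beta>2 \<epsilon>)))
             \<longlongrightarrow> 1) (at_right 0) \<and>
          ((\<lambda>\<epsilon>. charge_density N R A B p q (U \<epsilon>) (R - \<epsilon> powr \<beta>2 \<epsilon>) /
                  ((2 * g R / q) * \<epsilon> powr (- 2 * (\<beta>2 \<epsilon> - 1)))) \<longlongrightarrow> 1) (at_right 0))))"
proof -
  from g_smooth obtain D where D: "\<forall>x\<in>{0..R}. D 0 x = g x"
    "\<forall>k. \<forall>x\<in>{0..R}. (D k has_real_derivative D (Suc k) x) (at x within {0..R})"
    unfolding smooth_on_real_def by blast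
  have "continuous_on {0..R} (D (0::nat))"
    by (rule DERIV_continuous_on) (use D(2) in blast)
  then have g_cont: "continuous_on {0..R} g" using D(1) continuous_on_cong[of "{0..R}" "{0..R}" "D 0" g] by simp
  \<comment> \<open>Compactness supplies the constants of the locale: the minimum of
    \<open>g\<close>, positive because it is attained, and the maximum.\<close>
  obtain x0 where x0: "x0 \<in> {0..R}" "\<forall>r\<in>{0..R}. g x0 \<le> g r"
    using continuous_attains_inf[OF compact_Icc _ g_cont] R by auto
  obtain x1 where x1: "x1 \<in> {0..R}" "\<forall>r\<in>{0..R}. g r \<le> g x1"
    using continuous_attains_sup[OF compact_Icc _ g_cont] R by auto
  interpret layer_data N R A B p q "g x0" "g x1" g
    by unfold_locales (use assms x0 x1 g_cont in auto)
  note pos = eventually_at_right_less[of "0::real"]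

  have intermediate: "((\<lambda>\<epsilon>. U \<epsilon> (r \<epsilon>) -
            (- (2 / q) * (\<beta>0 - 1) * ln (1 / \<epsilon>) + (2 / q) * ln ((R - r \<epsilon>) / \<epsilon> powr \<beta>0)
             + (2 / q) * ln (sqrt (q * A / (2 * g R))))) \<longlongrightarrow> 0) (at_right 0) \<and>
         ((\<lambda>\<epsilon>. deriv (U \<epsilon>) (r \<epsilon>) / (- 2 / (q * (R - r \<epsilon>)))) \<longlongrightarrow> 1) (at_right 0) \<and>
         ((\<lambda>\<epsilon>. charge_density N R A B p q (U \<epsilon>) (r \<epsilon>) /
                 ((2 * g R / q) * (\<epsilon> / (R - r \<epsilon>))\<^sup>2)) \<longlongrightarrow> 1) (at_right 0)"
    if r: "\<forall>\<epsilon>>0. r \<epsilon> \<in> {0<..<R}" and b: "\<beta>0 > 1"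
      and small: "\<forall>\<beta>'\<in>{1<..<\<beta>0}. ((\<lambda>\<epsilon>. (R - r \<epsilon>) / \<epsilon> powr \<beta>') \<longlongrightarrow> 0) (at_right 0)"
      and large: "\<forall>\<beta>''>\<beta>0. filterlim (\<lambda>\<epsilon>. (R - r \<epsilon>) / \<epsilon> powr \<beta>'') at_top (at_right 0)"
      and regime: "\<beta>0 < 2 \<or> (\<beta>0 = 2 \<and> filterlim (\<lambda>\<epsilon>. (R - r \<epsilon>) / \<epsilon> powr 2) at_top (at_right 0))"
    for r :: "real \<Rightarrow> real" and \<beta>0 :: real
  proof -
    have ev: "\<forall>\<^sub>F \<epsilon> in at_right 0. r \<epsilon> \<in> {0<..<R}"
      using pos by eventually_elim (use r in auto)
    \<comment> \<open>An exponent strictly between 1 and \<open>\<beta>0\<close>: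
      \<open>small\<close> applies to it, and the surplus \<open>b' - 1 > 0\<close> gives a distance
      small against \<epsilon>.\<close>
    define b' where "b' = (1 + \<beta>0) / 2"
    have b': "1 < b'" "b' < \<beta>0" using b by (auto simp: b'_def)
    have "((\<lambda>\<epsilon>::real. \<epsilon> powr (b' - 1)) \<longlongrightarrow> 0) (at_right 0)" using b'(1) by real_asymp
    moreover have "((\<lambda>\<epsilon>. (R - r \<epsilon>) / \<epsilon> powr b') \<longlongrightarrow> 0) (at_right 0)" using small b' by simp
    ultimately have "((\<lambda>\<epsilon>. (R - r \<epsilon>) / \<epsilon> powr b' * \<epsilon> powr (b' - 1)) \<longlongrightarrow> 0 * 0) (at_right 0)"
      by (intro tendsto_mult)
    moreover have "\<forall>\<^sub>F \<epsilon> in at_right 0. (R - r \<epsilon>) / \<epsilon> powr b' * \<epsilon> powr (b' - 1) = (R - r \<epsilon>) / \<epsilon>"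
      using pos by eventually_elim (simp add: powr_diff)
    ultimately have close: "((\<lambda>\<epsilon>. (R - r \<epsilon>) / \<epsilon>) \<longlongrightarrow> 0) (at_right 0)"
      by (rule tendsto_eventually_eq) simp
    \<comment> \<open>For \<open>\<beta>0 < 2\<close> the exponent 2 is covered by
      \<open>large\<close>; for \<open>\<beta>0 = 2\<close> divergence is the extra
      assumption.\<close>
    have "filterlim (\<lambda>\<epsilon>. (R - r \<epsilon>) / \<epsilon> powr 2) at_top (at_right 0)"
      using regime large by blast
    moreover have "\<forall>\<^sub>F \<epsilon> in at_right 0. (R - r \<epsilon>) / \<epsilon> powr 2 = (R - r \<epsilon>) / \<epsilon>\<^sup>2"
      using pos by eventually_elim simp
    ultimately have far: "filterlim (\<lambda>\<epsilon>. (R - r \<epsilon>) / \<epsilon>\<^sup>2) at_top (at_right 0)"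
      by (simp cong: filterlim_cong)
    note asy = intermediate_solution[OF g_smooth sol ev close far]
    have "((\<lambda>\<epsilon>. U \<epsilon> (r \<epsilon>) -
            (- (2 / q) * (\<beta>0 - 1) * ln (1 / \<epsilon>) + (2 / q) * ln ((R - r \<epsilon>) / \<epsilon> powr \<beta>0)
             + (2 / q) * ln (sqrt (q * A / (2 * g R))))) \<longlongrightarrow> 0) (at_right 0)"
    proof (rule tendsto_eventually_eq[OF asy(1) eventually_mono[OF pos]])
      fix \<epsilon> :: real assume e: "0 < \<epsilon>"
      define x where "x = R - r \<epsilon>"
      define s where "s = sqrt (q * A / (2 * g R))"
      have x: "x > 0" using r e by (auto simp: x_def)
      have s: "s > 0" using q A gR by (simp add: s_def)
      \<comment> \<open>The terms containing \<open>\<beta>0\<close> cancel in the stated expansion,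
        which is \<open>ln (s * x / \<epsilon>)\<close> in another form.\<close>
      have "ln (s * (x / \<epsilon>)) = ln s + ln x - ln \<epsilon>"
        using x s e by (simp add: ln_mult_pos ln_div)
      moreover have "ln (x / \<epsilon> powr \<beta>0) = ln x - \<beta>0 * ln \<epsilon>"
        using x e by (simp add: ln_div ln_powr)
      moreover have "ln (1 / \<epsilon>) = - ln \<epsilon>" using e by (simp add: ln_div)
      ultimately have "2 / q * ln (s * (x / \<epsilon>)) =
          - (2 / q) * (\<beta>0 - 1) * ln (1 / \<epsilon>) + (2 / q) * ln (x / \<epsilon> powr \<beta>0) + (2 / q) * ln s"
        using q by (simp only:) (simp add: field_simps)
      then show "U \<epsilon> (r \<epsilon>) - 2 / q * ln (sqrt (q * A / (2 * g R)) * ((R - r \<epsilon>) / \<epsilon>)) = U \<epsilon> (r \<epsilon>) -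
            (- (2 / q) * (\<beta>0 - 1) * ln (1 / \<epsilon>) + (2 / q) * ln ((R - r \<epsilon>) / \<epsilon> powr \<beta>0)
             + (2 / q) * ln (sqrt (q * A / (2 * g R))))"
        unfolding x_def s_def by (simp only:)
    qed simp
    with asy(2,3) show ?thesis by blast
  qed

  have inner: "((\<lambda>\<epsilon>. U \<epsilon> (r \<epsilon>) -
            (- (2 / q) * ln (1 / \<epsilon>)
             + (2 / q) * ln (sqrt (A / (2 * q * g R)) * (2 * real N * g R / (R * (B - A))))))
            \<longlongrightarrow> 0) (at_right 0) \<and>
         ((\<lambda>\<epsilon>. deriv (U \<epsilon>) (r \<epsilon>) / (- (R * (B - A) / (real N * g R)) * \<epsilon> powr (-2)))
            \<longlongrightarrow> 1) (at_right 0) \<and>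
         ((\<lambda>\<epsilon>. charge_density N R A B p q (U \<epsilon>) (r \<epsilon>) /
                 (q * R\<^sup>2 * (B - A)\<^sup>2 / (2 * (real N)\<^sup>2 * g R) * \<epsilon> powr (-2))) \<longlongrightarrow> 1) (at_right 0)"
    if r: "\<forall>\<epsilon>>0. r \<epsilon> \<in> {0<..<R}"
      and small: "\<forall>\<beta>'\<in>{1<..<\<beta>0}. ((\<lambda>\<epsilon>. (R - r \<epsilon>) / \<epsilon> powr \<beta>') \<longlongrightarrow> 0) (at_right 0)"
      and regime: "\<beta>0 > 2 \<or> (\<beta>0 = 2 \<and> ((\<lambda>\<epsilon>. (R - r \<epsilon>) / \<epsilon> powr 2) \<longlongrightarrow> 0) (at_right 0))"
    for r :: "real \<Rightarrow> real" and \<beta>0 :: real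
  proof -
    have ev: "\<forall>\<^sub>F \<epsilon> in at_right 0. r \<epsilon> \<in> {0<..<R}"
      using pos by eventually_elim (use r in auto)
    \<comment> \<open>For \<open>\<beta>0 > 2\<close> the exponent 2 lies in the range of
      \<open>small\<close>.\<close>
    have "((\<lambda>\<epsilon>. (R - r \<epsilon>) / \<epsilon> powr 2) \<longlongrightarrow> 0) (at_right 0)"
      using regime small by auto
    then have near: "((\<lambda>\<epsilon>. (R - r \<epsilon>) / \<epsilon>\<^sup>2) \<longlongrightarrow> 0) (at_right 0)"
      by (rule tendsto_eventually_eq[OF _ eventually_mono[OF pos]]) auto
    note asy = inner_solution[OF g_smooth sol ev near]
    have minus2: "\<epsilon> powr (-2) = 1 / \<epsilon>\<^sup>2" if "\<epsilon> > 0" for \<epsilon> :: real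
      using that by (simp add: powr_minus_divide)
    define s where "s = sqrt (A / (2 * q * g R)) * (2 * real N * g R / (R * (B - A)))"
    have s: "s > 0" using A AB q R N gR by (auto simp: s_def intro!: mult_pos_pos divide_pos_pos)
    have seq: "2 * sqrt (q * A / (2 * g R)) / (q * C0) = s"
    proof -
      have "sqrt (q * A / (2 * g R)) = sqrt (A / (2 * q * g R) * q\<^sup>2)"
        using q by (intro arg_cong[where f = sqrt]) (simp add: power2_eq_square)
      also have "\<dots> = sqrt (A / (2 * q * g R)) * q" using q by (simp only: real_sqrt_mult real_sqrt_abs abs_of_pos)
      finally show ?thesis using q by (simp add: s_def C0_def)
    qed
    have "((\<lambda>\<epsilon>. U \<epsilon> (r \<epsilon>) - (- (2 / q) * ln (1 / \<epsilon>) + (2 / q) * ln s)) \<longlongrightarrow> 0) (at_right 0)"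
    proof (rule tendsto_eventually_eq[OF asy(1) eventually_mono[OF pos]])
      fix \<epsilon> :: real assume e: "0 < \<epsilon>"
      have "ln (s * \<epsilon>) = - ln (1 / \<epsilon>) + ln s" using s e by (simp add: ln_mult_pos ln_div)
      then show "U \<epsilon> (r \<epsilon>) - 2 / q * ln (2 * sqrt (q * A / (2 * g R)) / (q * C0) * \<epsilon>)
         = U \<epsilon> (r \<epsilon>) - (- (2 / q) * ln (1 / \<epsilon>) + (2 / q) * ln s)"
        unfolding seq by (simp add: distrib_left diff_divide_distrib)
    qed simp
    moreover have "((\<lambda>\<epsilon>. deriv (U \<epsilon>) (r \<epsilon>) / (- (R * (B - A) / (real N * g R)) * \<epsilon> powr (-2)))
            \<longlongrightarrow> 1) (at_right 0)"
    proof (rule tendsto_eventually_eq[OF asy(2) eventually_mono[OF pos]])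
      fix \<epsilon> :: real assume e: "0 < \<epsilon>"
      have "- C0 / \<epsilon>\<^sup>2 = - (R * (B - A) / (real N * g R)) * \<epsilon> powr (-2)"
        by (simp add: minus2[OF e] C0_def)
      then show "deriv (U \<epsilon>) (r \<epsilon>) / (- C0 / \<epsilon>\<^sup>2) =
          deriv (U \<epsilon>) (r \<epsilon>) / (- (R * (B - A) / (real N * g R)) * \<epsilon> powr (-2))" by (simp only:)
    qed simp
    moreover have "((\<lambda>\<epsilon>. charge_density N R A B p q (U \<epsilon>) (r \<epsilon>) /
                 (q * R\<^sup>2 * (B - A)\<^sup>2 / (2 * (real N)\<^sup>2 * g R) * \<epsilon> powr (-2))) \<longlongrightarrow> 1) (at_right 0)"
    proof (rule tendsto_eventually_eq[OF asy(3) eventually_mono[OF pos]])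
      fix \<epsilon> :: real assume e: "0 < \<epsilon>"
      have "q * g R * C0\<^sup>2 / (2 * \<epsilon>\<^sup>2) = q * R\<^sup>2 * (B - A)\<^sup>2 / (2 * (real N)\<^sup>2 * g R) * \<epsilon> powr (-2)"
        unfolding minus2[OF e] C0_def power_divide power_mult_distrib
        using gR by (simp add: power2_eq_square)
      then show "charge_density N R A B p q (U \<epsilon>) (r \<epsilon>) / (q * g R * C0\<^sup>2 / (2 * \<epsilon>\<^sup>2)) =
          charge_density N R A B p q (U \<epsilon>) (r \<epsilon>) /
            (q * R\<^sup>2 * (B - A)\<^sup>2 / (2 * (real N)\<^sup>2 * g R) * \<epsilon> powr (-2))" by (simp only:)
    qed simp
    ultimately show ?thesis unfolding s_def by blast
  qed

  have log_powers: "let \<kappa>e = (\<lambda>\<epsilon>::real. 1 - ln (1 / \<epsilon>) powr (- \<Theta>));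
           \<beta>1 = (\<lambda>\<epsilon>::real. 1 + \<gamma> * ln (1 / \<epsilon>) powr (- \<Theta>));
           \<beta>2 = (\<lambda>\<epsilon>::real. 1 + (ln (1 / \<epsilon>)) powr (-1) * (\<gamma> * (ln ^^ n) (1 / \<epsilon>) + \<tau>))
       in
        (\<forall>\<kappa> \<beta>. 0 < \<kappa> \<and> \<kappa> < 1 \<and> \<beta> > 1 \<longrightarrow>
           (\<forall>\<^sub>F \<epsilon> in at_right 0.
              R - \<epsilon> powr \<kappa>e \<epsilon> \<in> {R - \<epsilon> powr \<kappa> .. R - \<epsilon> powr \<beta>} \<and>
              R - \<epsilon> powr \<beta>1 \<epsilon> \<in> {R - \<epsilon> powr \<kappa> .. R - \<epsilon> powr \<beta>} \<and>
              R - \<epsilon> powr \<beta>2 \<epsilon> \<in> {R - \<epsilon> powr \<kappa> .. R - \<epsilon> powr \<beta>})) \<and>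
        ((\<lambda>\<epsilon>. \<bar>U \<epsilon> (R - \<epsilon> powr \<kappa>e \<epsilon>)\<bar>) \<longlongrightarrow> 0) (at_right 0) \<and>
        ((\<lambda>\<epsilon>. \<bar>deriv (U \<epsilon>) (R - \<epsilon> powr \<kappa>e \<epsilon>)\<bar>) \<longlongrightarrow> 0) (at_right 0) \<and>
        ((\<lambda>\<epsilon>. U \<epsilon> (R - \<epsilon> powr \<beta>1 \<epsilon>) -
            (- (2 * \<gamma> / q) * ln (1 / \<epsilon>) powr (1 - \<Theta>) + (1 / q) * ln (q * A / (2 * g R))))
           \<longlongrightarrow> 0) (at_right 0) \<and>
        ((\<lambda>\<epsilon>. U \<epsilon> (R - \<epsilon> powr \<beta>2 \<epsilon>) -
            (- (2 * \<gamma> / q) * (ln ^^ n) (1 / \<epsilon>) + (1 / q) * (- 2 * \<tau> + ln (q * A / (2 * g R)))))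
           \<longlongrightarrow> 0) (at_right 0) \<and>
        ((\<lambda>\<epsilon>. deriv (U \<epsilon>) (R - \<epsilon> powr \<beta>1 \<epsilon>) / (- (2 / q) * \<epsilon> powr (- \<beta>1 \<epsilon>)))
           \<longlongrightarrow> 1) (at_right 0) \<and>
        ((\<lambda>\<epsilon>. charge_density N R A B p q (U \<epsilon>) (R - \<epsilon> powr \<beta>1 \<epsilon>) /
                ((2 * g R / q) * \<epsilon> powr (- 2 * (\<beta>1 \<epsilon> - 1)))) \<longlongrightarrow> 1) (at_right 0) \<and>
        ((n = 2 \<and> \<gamma> > 2) \<longrightarrow>
          ((\<lambda>\<epsilon>. deriv (U \<epsilon>) (R - \<epsilon> powr \<beta>2 \<epsilon>) / (- (2 / q) * \<epsilon> powr (- \<beta>2 \<epsilon>)))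
             \<longlongrightarrow> 1) (at_right 0) \<and>
          ((\<lambda>\<epsilon>. charge_density N R A B p q (U \<epsilon>) (R - \<epsilon> powr \<beta>2 \<epsilon>) /
                  ((2 * g R / q) * \<epsilon> powr (- 2 * (\<beta>2 \<epsilon> - 1)))) \<longlongrightarrow> 1) (at_right 0))"
    if \<Theta>: "0 < \<Theta>" "\<Theta> < 1" and \<gamma>: "\<gamma> > 0" and n: "n \<ge> 2" for \<Theta> \<gamma> \<tau> :: real and n :: nat
  proof -
    define L where "L \<epsilon> = ln (1 / \<epsilon>)" for \<epsilon> :: real
    define l where "l \<epsilon> = (ln ^^ n) (1 / \<epsilon>)" for \<epsilon> :: real
    define \<kappa>e where "\<kappa>e \<epsilon> = 1 - L \<epsilon> powr (- \<Theta>)" for \<epsilon>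
    define \<beta>1 where "\<beta>1 \<epsilon> = 1 + \<gamma> * L \<epsilon> powr (- \<Theta>)" for \<epsilon>
    define \<beta>2 where "\<beta>2 \<epsilon> = 1 + L \<epsilon> powr (-1) * (\<gamma> * l \<epsilon> + \<tau>)" for \<epsilon>
    have L_pos: "\<forall>\<^sub>F \<epsilon> in at_right 0. L \<epsilon> > 0" unfolding L_def by real_asymp
    have inv_top: "filterlim (\<lambda>\<epsilon>::real. 1 / \<epsilon>) at_top (at_right 0)" by real_asymp
    have L_top: "filterlim L at_top (at_right 0)" unfolding L_def by real_asymp
    have l_top: "filterlim l at_top (at_right 0)"
      unfolding l_def by (rule filterlim_compose[OF ln_iterate_at_top inv_top])
    \<comment> \<open>\<open>l\<close> is the \<open>m\<close>-fold logarithm of \<open>L\<close>,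
      and \<open>m \<ge> 1\<close> makes it negligible against \<open>L\<close>.\<close>
    obtain m where m: "n = Suc m" "m \<ge> 1" using n by (cases n) auto
    have l_L: "((\<lambda>\<epsilon>. l \<epsilon> / L \<epsilon>) \<longlongrightarrow> 0) (at_right 0)"
      using filterlim_compose[OF ln_iterate_over_self[OF m(2)] L_top]
      by (simp add: l_def L_def m(1) funpow_swap1)
    have k: "(\<kappa>e \<longlongrightarrow> 1) (at_right 0)" unfolding \<kappa>e_def L_def using \<Theta> by real_asymp
    have b1: "(\<beta>1 \<longlongrightarrow> 1) (at_right 0)" unfolding \<beta>1_def L_def using \<Theta> by real_asymp
    have b1_top: "filterlim (\<lambda>\<epsilon>. (\<beta>1 \<epsilon> - 1) * ln (1 / \<epsilon>)) at_top (at_right 0)"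
      unfolding \<beta>1_def L_def using \<Theta> \<gamma> by real_asymp
    have "((\<lambda>\<epsilon>. 1 + (\<gamma> * (l \<epsilon> / L \<epsilon>) + \<tau> * inverse (L \<epsilon>))) \<longlongrightarrow> 1 + (\<gamma> * 0 + \<tau> * 0)) (at_right 0)"
      by (intro tendsto_intros l_L tendsto_inverse_0_at_top L_top)
    then have b2: "(\<beta>2 \<longlongrightarrow> 1) (at_right 0)"
    proof (rule tendsto_eventually_eq[OF _ eventually_mono[OF L_pos]])
      fix \<epsilon> assume "0 < L \<epsilon>"
      then show "1 + (\<gamma> * (l \<epsilon> / L \<epsilon>) + \<tau> * inverse (L \<epsilon>)) = \<beta>2 \<epsilon>"
        by (simp add: \<beta>2_def powr_minus divide_inverse algebra_simps)
    qed simp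
    have b2_L: "(\<beta>2 \<epsilon> - 1) * L \<epsilon> = \<gamma> * l \<epsilon> + \<tau>" if "L \<epsilon> > 0" for \<epsilon>
      using that by (simp add: \<beta>2_def powr_minus)
    have b1_L: "(\<beta>1 \<epsilon> - 1) * L \<epsilon> = \<gamma> * L \<epsilon> powr (1 - \<Theta>)" if "L \<epsilon> > 0" for \<epsilon>
    proof -
      have "L \<epsilon> powr (- \<Theta> + 1) = L \<epsilon> powr (- \<Theta>) * L \<epsilon> powr 1"
        by (rule powr_add)
      then show ?thesis using that by (simp add: \<beta>1_def)
    qed
    have "filterlim (\<lambda>\<epsilon>. \<tau> + \<gamma> * l \<epsilon>) at_top (at_right 0)"
      by (intro filterlim_tendsto_add_at_top[OF tendsto_const]
          filterlim_tendsto_pos_mult_at_top[OF tendsto_const \<gamma>] l_top)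
    moreover have "\<forall>\<^sub>F \<epsilon> in at_right 0. \<tau> + \<gamma> * l \<epsilon> = (\<beta>2 \<epsilon> - 1) * ln (1 / \<epsilon>)"
      using L_pos by eventually_elim (use b2_L in \<open>simp add: L_def\<close>)
    ultimately have b2_top: "filterlim (\<lambda>\<epsilon>. (\<beta>2 \<epsilon> - 1) * ln (1 / \<epsilon>)) at_top (at_right 0)"
      by (simp cong: filterlim_cong)
    note asy1 = power_position[OF g_smooth sol b1 b1_top]
    note asy2 = power_position[OF g_smooth sol b2 b2_top]
    have D0: "((\<lambda>\<epsilon>. \<epsilon> powr \<kappa>e \<epsilon>) \<longlongrightarrow> 0) (at_right 0)"
      unfolding \<kappa>e_def L_def using \<Theta> by real_asymp
    have D1: "filterlim (\<lambda>\<epsilon>. (R - (R - \<epsilon> powr \<kappa>e \<epsilon>)) / \<epsilon>) at_top (at_right 0)"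
      unfolding \<kappa>e_def L_def diff_diff_eq2 add_diff_cancel_left' using \<Theta> by real_asymp
    \<comment> \<open>Here the distance over \<epsilon> is
      \<open>exp (L powr (1 - \<Theta>))\<close>. As \<open>\<Theta> < 1\<close>, this outgrows
      every multiple of \<open>L\<close>, so its negative exponential beats
      \<open>1 / \<epsilon>\<^sup>2 = exp (2 * L)\<close>.\<close>
    have D2: "((\<lambda>\<epsilon>. exp (- (c * ((R - (R - \<epsilon> powr \<kappa>e \<epsilon>)) / \<epsilon>))) / \<epsilon>\<^sup>2) \<longlongrightarrow> 0) (at_right 0)" if "c > 0" for c
      unfolding \<kappa>e_def L_def diff_diff_eq2 add_diff_cancel_left' using \<Theta> that by real_asymp
    have "\<forall>\<^sub>F \<epsilon> in at_right 0. \<epsilon> powr \<kappa>e \<epsilon> < R / 2" using D0 R by (intro order_tendstoD) auto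
    then have half: "\<forall>\<^sub>F \<epsilon> in at_right 0. R / 2 \<le> R - \<epsilon> powr \<kappa>e \<epsilon>" by eventually_elim simp
    have lt: "\<forall>\<^sub>F \<epsilon> in at_right 0. R - \<epsilon> powr \<kappa>e \<epsilon> < R" using pos by eventually_elim simp
    note asy0 = outer_solution[OF g_smooth sol half lt D1 D2]
    have "\<forall>\<kappa> \<beta>. 0 < \<kappa> \<and> \<kappa> < 1 \<and> \<beta> > 1 \<longrightarrow>
           (\<forall>\<^sub>F \<epsilon> in at_right 0.
              R - \<epsilon> powr \<kappa>e \<epsilon> \<in> {R - \<epsilon> powr \<kappa> .. R - \<epsilon> powr \<beta>} \<and>
              R - \<epsilon> powr \<beta>1 \<epsilon> \<in> {R - \<epsilon> powr \<kappa> .. R - \<epsilon> powr \<beta>} \<and>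
              R - \<epsilon> powr \<beta>2 \<epsilon> \<in> {R - \<epsilon> powr \<kappa> .. R - \<epsilon> powr \<beta>})"
      by (intro allI impI eventually_conj eventually_power_position k b1 b2) auto
    moreover have "((\<lambda>\<epsilon>. \<bar>U \<epsilon> (R - \<epsilon> powr \<kappa>e \<epsilon>)\<bar>) \<longlongrightarrow> 0) (at_right 0)"
      "((\<lambda>\<epsilon>. \<bar>deriv (U \<epsilon>) (R - \<epsilon> powr \<kappa>e \<epsilon>)\<bar>) \<longlongrightarrow> 0) (at_right 0)"
      by (intro tendsto_rabs_zero asy0; assumption)+
    moreover have "((\<lambda>\<epsilon>. U \<epsilon> (R - \<epsilon> powr \<beta>1 \<epsilon>) -
            (- (2 * \<gamma> / q) * L \<epsilon> powr (1 - \<Theta>) + (1 / q) * ln (q * A / (2 * g R))))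
           \<longlongrightarrow> 0) (at_right 0)"
    proof (rule tendsto_eventually_eq[OF asy1(1)[folded L_def] eventually_mono[OF L_pos]])
      fix \<epsilon> assume "0 < L \<epsilon>"
      then show "U \<epsilon> (R - \<epsilon> powr \<beta>1 \<epsilon>) - (- (2 / q) * ((\<beta>1 \<epsilon> - 1) * L \<epsilon>) + 1 / q * ln (q * A / (2 * g R)))
        = U \<epsilon> (R - \<epsilon> powr \<beta>1 \<epsilon>) - (- (2 * \<gamma> / q) * L \<epsilon> powr (1 - \<Theta>) + (1 / q) * ln (q * A / (2 * g R)))"
        unfolding b1_L[OF \<open>0 < L \<epsilon>\<close>] by simp
    qed simp
    moreover have "((\<lambda>\<epsilon>. U \<epsilon> (R - \<epsilon> powr \<beta>2 \<epsilon>) -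
            (- (2 * \<gamma> / q) * l \<epsilon> + (1 / q) * (- 2 * \<tau> + ln (q * A / (2 * g R)))))
           \<longlongrightarrow> 0) (at_right 0)"
    proof (rule tendsto_eventually_eq[OF asy2(1)[folded L_def] eventually_mono[OF L_pos]])
      fix \<epsilon> assume "0 < L \<epsilon>"
      have "- (2 / q) * (\<gamma> * l \<epsilon> + \<tau>) + 1 / q * z = - (2 * \<gamma> / q) * l \<epsilon> + (1 / q) * (- 2 * \<tau> + z)" for z
        using q by (simp add: field_simps)
      then show "U \<epsilon> (R - \<epsilon> powr \<beta>2 \<epsilon>) - (- (2 / q) * ((\<beta>2 \<epsilon> - 1) * L \<epsilon>) + 1 / q * ln (q * A / (2 * g R)))
        = U \<epsilon> (R - \<epsilon> powr \<beta>2 \<epsilon>) - (- (2 * \<gamma> / q) * l \<epsilon> + (1 / q) * (- 2 * \<tau> + ln (q * A / (2 * g R))))"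
        unfolding b2_L[OF \<open>0 < L \<epsilon>\<close>] by (simp only:)
    qed simp
    ultimately show ?thesis
      using asy1(2,3) asy2(2,3)
      unfolding Let_def L_def[symmetric] l_def[symmetric]
        \<kappa>e_def[symmetric] \<beta>1_def[symmetric] \<beta>2_def[symmetric]
      by blast
  qed

  show ?thesis
    by (intro conjI allI impI; (elim conjE)?)
      (use intermediate inner log_powers in blast)+
qed

end
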